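(* Let $f$ denote one of the following four parameters, each defined for every finitely generated group $G=\langle S\rangle$ with finite symmetric generating set $S=S^{-1}$: the spectral radius $\rho(G,S)$; the asymptotic entropy $h(G,S)$; the site percolation critical probability $p_c^{\mathrm{s}}(G,S)$; the bond percolation critical probability $p_c^{\mathrm{b}}(G,S)$. Then there is a family of $4$-regular Cayley graphs $\{\mathrm{Cay}(G_\omega,S_\omega)\}$ of finitely generated groups $G_\omega=\langle S_\omega\rangle$ such that the set of parameter values $\{f(G_\omega,S_\omega)\}$ has the cardinality of the continuum.
   Context: All generating sets are finite and symmetric, $S=S^{-1}$. $\mathrm{Cay}(G,S)$ is the Cayley graph of $G$ with respect to $S$ (vertices $g\in G$, edges $\{g,gs\}$, $s\in S$); $e$ is the identity. Spectral radius: $\rho(G,S):=\limsup_{n\to\infty}\frac1{|S|}\sqrt[n]{c(n)}$, where $c(n)$ is the number of words of length $n$ in the alphabet $S$ that equal $e$ in $G$. Asymptotic entropy: $h(G,S):=\lim_{n\to\infty}\frac{\mathrm H(\mu_n)}{n}$, where $\mu_n$ is the distribution at time $n$ of the simple random walk on $\mathrm{Cay}(G,S)$ started at $e$, and $\mathrm H(\mu)=-\sum_{g\in\mathrm{supp}(\mu)}\mu(g)\log\mu(g)$. Critical probabilities: in Bernoulli site (respectively bond) percolation with parameter $p$, the vertices (respectively edges) of $\mathrm{Cay}(G,S)$ are open with probability $p$ and closed with probability $1-p$, independently. Let $\theta^{\mathrm s}(G,S,p)$ (respectively $\theta^{\mathrm b}(G,S,p)$) be the probability that $e$ lies in an infinite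 connected open component. Then $p_c^{\mathrm s}(G,S):=\sup\{p:\theta^{\mathrm s}(G,S,p)=0\}$ and $p_c^{\mathrm b}(G,S):=\sup\{p:\theta^{\mathrm b}(G,S,p)=0\}$. *)

theory Defs
  imports "HOL-Probability.Probability" "HOL-Algebra.Generated_Groups" "HOL-Library.Equipollence"
begin

section \<open>Cayley graphs\<close>

definition symmetric_generating_set :: "('a, 'b) monoid_scheme \<Rightarrow> 'a set \<Rightarrow> bool" where
  "symmetric_generating_set G S \<longleftrightarrow>
     finite S \<and> S \<subseteq> carrier G \<and> (\<lambda>s. inv\<^bsub>G\<^esub> s) ` S = S \<and> generate G S = carrier G"

text \<open>The vertex set of the Cayley graph is \<^term>\<open>carrier G\<close>. Undirected edges are unordered
  pairs, so a generating involution contributes one edge at each vertex; an identity element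
  in the generating set would contribute a loop, i.e. a singleton.\<close>

definition cayley_edges :: "('a, 'b) monoid_scheme \<Rightarrow> 'a set \<Rightarrow> 'a set set" where
  "cayley_edges G S = {{g, g \<otimes>\<^bsub>G\<^esub> s} | g s. g \<in> carrier G \<and> s \<in> S}"

text \<open>Regularity is understood for simple graphs: loops are excluded.\<close>

definition regular_simple_graph :: "nat \<Rightarrow> 'v set \<Rightarrow> 'v set set \<Rightarrow> bool" where
  "regular_simple_graph d V E \<longleftrightarrow>
     (\<forall>a\<in>E. a \<subseteq> V \<and> card a = 2) \<and> (\<forall>v\<in>V. card {a \<in> E. v \<in> a} = d)"

section \<open>Spectral radius\<close>

definition returning_words :: "('a, 'b) monoid_scheme \<Rightarrow> 'a set \<Rightarrow> nat \<Rightarrow> 'a list set" where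
  "returning_words G S n =
     {w. length w = n \<and> set w \<subseteq> S \<and> foldr (\<lambda>s g. s \<otimes>\<^bsub>G\<^esub> g) w \<one>\<^bsub>G\<^esub> = \<one>\<^bsub>G\<^esub>}"

text \<open>The upper limit is taken in the extended reals; it lies in the unit interval for
  finite \<^term>\<open>S\<close>, so converting it back to a real number loses nothing.\<close>

definition spectral_radius :: "('a, 'b) monoid_scheme \<Rightarrow> 'a set \<Rightarrow> real" where
  "spectral_radius G S =
     real_of_ereal (limsup (\<lambda>n. ereal (1 / real (card S) *
       root n (real (card (returning_words G S n))))))"

section \<open>Asymptotic entropy\<close>

primrec walk_pmf :: "('a, 'b) monoid_scheme \<Rightarrow> 'a set \<Rightarrow> nat \<Rightarrow> 'a pmf" where
  "walk_pmf G S 0 = return_pmf \<one>\<^bsub>G\<^esub>"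
| "walk_pmf G S (Suc n) =
     bind_pmf (walk_pmf G S n) (\<lambda>g. pmf_of_set {h. {g, h} \<in> cayley_edges G S})"

definition shannon_entropy :: "'a pmf \<Rightarrow> real" where
  "shannon_entropy \<mu> = - (\<Sum>\<^sub>\<infinity>g\<in>set_pmf \<mu>. pmf \<mu> g * ln (pmf \<mu> g))"

definition asymptotic_entropy :: "('a, 'b) monoid_scheme \<Rightarrow> 'a set \<Rightarrow> real" where
  "asymptotic_entropy G S = lim (\<lambda>n. shannon_entropy (walk_pmf G S n) / real n)"

section \<open>Percolation\<close>

text \<open>The connected component of a vertex in a graph; empty if the vertex is not in the graph.\<close>

definition component_of :: "'v set \<Rightarrow> 'v set set \<Rightarrow> 'v \<Rightarrow> 'v set" where
  "component_of V E v =
     {w. v \<in> V \<and> (v, w) \<in> {(x, y). x \<in> V \<and> y \<in> V \<and> {x, y} \<in> E}\<^sup>*}"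

text \<open>A configuration assigns to each site (or bond) the value \<^term>\<open>True\<close> if it is open.
  The index sets are countable for a finitely generated group, so the percolation events below
  are measurable in the product space.\<close>

definition bernoulli_config :: "'i set \<Rightarrow> real \<Rightarrow> ('i \<Rightarrow> bool) measure" where
  "bernoulli_config I p = Pi\<^sub>M I (\<lambda>_. measure_pmf (bernoulli_pmf p))"

definition theta_site :: "('a, 'b) monoid_scheme \<Rightarrow> 'a set \<Rightarrow> real \<Rightarrow> real" where
  "theta_site G S p =
     (let M = bernoulli_config (carrier G) p in
      measure M {\<xi> \<in> space M.
        infinite (component_of {v \<in> carrier G. \<xi> v} (cayley_edges G S) \<one>\<^bsub>G\<^esub>)})"

definition theta_bond :: "('a, 'b) monoid_scheme \<Rightarrow> 'a set \<Rightarrow> real \<Rightarrow> real" where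
  "theta_bond G S p =
     (let M = bernoulli_config (cayley_edges G S) p in
      measure M {\<xi> \<in> space M.
        infinite (component_of (carrier G) {a \<in> cayley_edges G S. \<xi> a} \<one>\<^bsub>G\<^esub>)})"

definition pc_site :: "('a, 'b) monoid_scheme \<Rightarrow> 'a set \<Rightarrow> real" where
  "pc_site G S = Sup {p \<in> {0..1}. theta_site G S p = 0}"

definition pc_bond :: "('a, 'b) monoid_scheme \<Rightarrow> 'a set \<Rightarrow> real" where
  "pc_bond G S = Sup {p \<in> {0..1}. theta_bond G S p = 0}"

end

theory Submission
  imports Defs
begin

text \<open>Let \<open>A\<close> be a group generated by three involutions and \<open>A'\<close> a proper quotient of it, with
  generators again distinct. All four parameters differ between the free products \<open>A * C\<^sub>2\<close> and
  \<open>A' * C\<^sub>2\<close>, each with four generating involutions. Hence a chain of such quotients indexed by the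
  reals gives an injective family of values. The chain is made of groups of permutations of copies
  of \<open>\<int>\<close>, one copy for each element of a Dedekind cut.

  If \<open>z\<close> is a nontrivial kernel element and \<open>s\<close> runs through the generators of \<open>A\<close>, then the kernel
  elements \<open>s t z t s\<close> play ping-pong on \<open>A * C\<^sub>2\<close>. For the spectral radius, let \<open>T\<close> and \<open>T'\<close> sum over
  all words of a fixed even length \<open>k\<close>; passing to fibrewise \<open>\<ell>\<^sup>2\<close>-norms, ping-pong gives
  \<open>\<langle>T f, f\<rangle> \<le> \<langle>T' f', f'\<rangle> - \<delta> \<parallel>f\<parallel>\<^sup>2\<close>. For the entropy, it shows that multiplication by a
  random one of the three elements adds a fixed amount to the entropy of any distribution conditioned
  on its image, so that \<open>H(\<mu>\<^sub>n) - H(\<mu>'\<^sub>n)\<close> grows linearly.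

  For percolation, the cluster in \<open>A * C\<^sub>2\<close> is a branching process of clusters in cosets of \<open>A\<close>: the
  critical \<open>p\<close> solves \<open>p (\<chi>(p) - 1) = 1\<close>, where \<open>\<chi>\<close> is the expected cluster size in \<open>A\<close>.
  Exploring a cluster of \<open>A'\<close> and lifting it shows that \<open>\<chi>\<close> drops strictly in the quotient. There is
  no jump at the threshold, because counting self-avoiding walks in degree three controls
  \<open>\<chi>\<close> uniformly below \<open>p = 1/2\<close>, and the threshold is at most \<open>9/20\<close>.\<close>

section \<open>Counting words and the spectral radius\<close>

text \<open>A proper quotient alone need not move the parameters: dividing by a finite kernel
  changes neither the spectral radius nor the entropy. The factor \<open>C\<^sub>2\<close> turns one
  nontrivial kernel element into three that play ping-pong, and three is the least number for which
  the mass estimate in \<open>pingpong_ip\<close> closes. For percolation the same factor arranges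
  the cosets of \<open>A\<close> in a tree, so the threshold depends on a single expectation in
  \<open>A\<close>. The bound 9/20 comes from the ball of radius two in \<open>A\<close>, which has
  1 + 3 + 6 vertices. It has to stay below 1/2, where the number 3 * 2^(k-1) of paths of length k
  stops being summable against p^k. The kernel element is a commutator given by a word of even
  length, because the operator argument needs even powers, whose moments are nonnegative. Only
  strict monotonicity along an uncountable chain is used, so no continuity of the parameters in the
  group enters.\<close>

definition words :: "'a set \<Rightarrow> nat \<Rightarrow> 'a list set" where
  "words S n = {w. set w \<subseteq> S \<and> length w = n}"

lemma finite_words: "finite S \<Longrightarrow> finite (words S n)"
  unfolding words_def by (rule finite_lists_length_eq)

lemma card_words: "finite S \<Longrightarrow> card (words S n) = card S ^ n"
  unfolding words_def by (rule card_lists_length_eq)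

lemma words_0 [simp]: "words S 0 = {[]}"
  by (auto simp: words_def)

lemma sum_words_Suc: "(\<Sum>w\<in>words S (Suc n). g w) = (\<Sum>s\<in>S. \<Sum>w\<in>words S n. g (s # w))"
proof -
  have "(\<Sum>w\<in>words S (Suc n). g w) = (\<Sum>(s,w)\<in>S \<times> words S n. g (s # w))"
    by (rule sum.reindex_bij_witness[where i = "\<lambda>(s,w). s # w" and j = "\<lambda>w. (hd w, tl w)"])
       (auto simp: words_def length_Suc_conv)
  then show ?thesis by (simp add: sum.cartesian_product)
qed

lemma sum_words_append:
  "(\<Sum>w\<in>words S (m + n). g w) = (\<Sum>u\<in>words S m. \<Sum>v\<in>words S n. g (u @ v))"
  by (induction m arbitrary: g) (simp_all add: sum_words_Suc)

lemma sum_words_rev: "(\<Sum>w\<in>words S n. g (rev w)) = (\<Sum>w\<in>words S n. g w)"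
  by (rule sum.reindex_bij_witness[where i = rev and j = rev]) (auto simp: words_def)

definition wprod :: "('a, 'b) monoid_scheme \<Rightarrow> 'a list \<Rightarrow> 'a" where
  "wprod G w = foldr (\<lambda>s g. s \<otimes>\<^bsub>G\<^esub> g) w \<one>\<^bsub>G\<^esub>"

lemma wprod_Nil [simp]: "wprod G [] = \<one>\<^bsub>G\<^esub>"
  and wprod_Cons [simp]: "wprod G (s # w) = s \<otimes>\<^bsub>G\<^esub> wprod G w"
  by (simp_all add: wprod_def)

context group begin

lemma wprod_closed [simp]: "set w \<subseteq> carrier G \<Longrightarrow> wprod G w \<in> carrier G"
  by (induction w) auto

lemma wprod_append:
  "set u \<subseteq> carrier G \<Longrightarrow> set v \<subseteq> carrier G \<Longrightarrow> wprod G (u @ v) = wprod G u \<otimes> wprod G v"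
  by (induction u) (auto simp: m_assoc)

end

text \<open>Generators of order two make the reversed word the inverse, so the symmetry of the walk
  operator and of the law of the walk is a reindexing of sums by \<open>rev\<close>.\<close>

locale involution_marked = group G for G :: "('a, 'b) monoid_scheme" (structure) +
  fixes S :: "'a set"
  assumes fin_S: "finite S" and S_closed: "S \<subseteq> carrier G" and S_nonempty: "S \<noteq> {}"
    and S_involution: "s \<in> S \<Longrightarrow> s \<otimes> s = \<one>"
begin

lemma words_closed: "w \<in> words S n \<Longrightarrow> wprod G w \<in> carrier G"
  using S_closed by (auto simp: words_def)

lemma finW [simp]: "finite (words S n)"
  by (rule finite_words[OF fin_S])

lemma inv_gen: "s \<in> S \<Longrightarrow> inv s = s"
  using S_closed S_involution by (auto intro!: inv_equality)

lemma inv_wprod: "w \<in> words S n \<Longrightarrow> inv (wprod G w) = wprod G (rev w)"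
proof (induction w arbitrary: n)
  case (Cons s w)
  then have s: "s \<in> S" "s \<in> carrier G" and w: "w \<in> words S (length w)" "set w \<subseteq> carrier G"
    using S_closed by (auto simp: words_def)
  have "inv (wprod G (s # w)) = wprod G (rev w) \<otimes> s"
    using s w Cons.IH[OF w(1)] by (simp add: inv_mult_group inv_gen)
  also have "\<dots> = wprod G (rev (s # w))"
    using s w by (simp add: wprod_append)
  finally show ?case .
qed simp

section \<open>Finitely supported functions and the walk operator\<close>

definition supp :: "('a \<Rightarrow> real) \<Rightarrow> 'a set" where
  "supp f = {x \<in> carrier G. f x \<noteq> 0}"

text \<open>Functions are total on the type, so only values on the carrier count. Summing over the
  support of the first argument alone gives a finite sum for every \<open>g\<close> as soon as
  \<open>f\<close> is finitely supported.\<close>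

definition ip :: "('a \<Rightarrow> real) \<Rightarrow> ('a \<Rightarrow> real) \<Rightarrow> real" where
  "ip f g = (\<Sum>x\<in>supp f. f x * g x)"

definition shift :: "'a \<Rightarrow> ('a \<Rightarrow> real) \<Rightarrow> 'a \<Rightarrow> real" where
  "shift w f = (\<lambda>x. f (x \<otimes> w))"

text \<open>The \<open>n\<close>-th power of the adjacency operator without the factor
  \<open>1 / deg ^ n\<close>, so that operator bounds read
  \<open>(deg * spectral_radius) ^ n\<close>.\<close>

definition walk :: "nat \<Rightarrow> ('a \<Rightarrow> real) \<Rightarrow> 'a \<Rightarrow> real" where
  "walk n f = (\<lambda>x. \<Sum>w\<in>words S n. f (x \<otimes> wprod G w))"

definition moment :: "nat \<Rightarrow> ('a \<Rightarrow> real) \<Rightarrow> real" where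
  "moment n f = ip f (walk n f)"

lemma ip_eq: "finite X \<Longrightarrow> supp f \<subseteq> X \<Longrightarrow> X \<subseteq> carrier G \<Longrightarrow> ip f g = (\<Sum>x\<in>X. f x * g x)"
  unfolding ip_def by (rule sum.mono_neutral_left) (auto simp: supp_def)

lemma supp_closed: "supp f \<subseteq> carrier G"
  by (auto simp: supp_def)

lemma ip_comm: assumes "finite (supp f)" "finite (supp g)" shows "ip f g = ip g f"
proof -
  have "ip f g = (\<Sum>x\<in>supp f \<union> supp g. f x * g x)"
    by (rule ip_eq) (use assms supp_closed in auto)
  moreover have "ip g f = (\<Sum>x\<in>supp f \<union> supp g. g x * f x)"
    by (rule ip_eq) (use assms supp_closed in auto)
  ultimately show ?thesis by (simp add: mult.commute)
qed

lemma ip_cong: "(\<And>x. x \<in> carrier G \<Longrightarrow> g x = h x) \<Longrightarrow> ip f g = ip f h"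
  unfolding ip_def supp_def by (rule sum.cong) auto

lemma supp_shift: assumes "w \<in> carrier G" shows "supp (shift w f) = (\<lambda>x. x \<otimes> inv w) ` supp f"
proof (intro equalityI subsetI)
  fix x assume "x \<in> supp (shift w f)"
  then have "x \<in> carrier G" "x \<otimes> w \<in> supp f" using assms by (auto simp: supp_def shift_def)
  then show "x \<in> (\<lambda>x. x \<otimes> inv w) ` supp f"
    using assms by (intro image_eqI[of _ _ "x \<otimes> w"]) (simp_all add: m_assoc)
next
  fix x assume "x \<in> (\<lambda>x. x \<otimes> inv w) ` supp f"
  then show "x \<in> supp (shift w f)" using assms by (auto simp: supp_def shift_def m_assoc)
qed

lemma ip_shift: assumes "w \<in> carrier G" shows "ip (shift w f) (shift w g) = ip f g"
proof -
  have "inj_on (\<lambda>x. x \<otimes> inv w) (supp f)"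
    using assms supp_closed by (intro inj_onI) (metis inv_closed right_cancel subsetD)
  then have "ip (shift w f) (shift w g) = (\<Sum>x\<in>supp f. shift w f (x \<otimes> inv w) * shift w g (x \<otimes> inv w))"
    unfolding ip_def supp_shift[OF assms] by (simp add: sum.reindex)
  also have "\<dots> = ip f g"
    unfolding ip_def by (rule sum.cong) (use assms in \<open>auto simp: shift_def supp_def m_assoc\<close>)
  finally show ?thesis .
qed

lemma ip_shift_inv: assumes "w \<in> carrier G" shows "ip (shift (inv w) f) g = ip f (shift w g)"
proof -
  have "ip (shift (inv w) f) g = ip (shift w (shift (inv w) f)) (shift w g)"
    using assms by (simp add: ip_shift)
  also have "\<dots> = ip f (shift w g)"
  proof -
    have "supp (shift w (shift (inv w) f)) = supp f"
      using assms by (auto simp: supp_def shift_def m_assoc)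
    then show ?thesis unfolding ip_def
      by (intro sum.cong) (use assms in \<open>auto simp: supp_def shift_def m_assoc\<close>)
  qed
  finally show ?thesis .
qed

lemma ip_sum_right: "ip f (\<lambda>x. \<Sum>i\<in>I. g i x) = (\<Sum>i\<in>I. ip f (g i))"
  unfolding ip_def by (simp add: sum_distrib_left) (rule sum.swap)

lemma supp_sum: "supp (\<lambda>x. \<Sum>i\<in>I. g i x) \<subseteq> (\<Union>i\<in>I. supp (g i))"
  by (force simp: supp_def intro: ccontr dest: sum.neutral)

lemma ip_sum_left:
  assumes "finite I" "\<And>i. i \<in> I \<Longrightarrow> finite (supp (f i))" "finite (supp g)"
  shows "ip (\<lambda>x. \<Sum>i\<in>I. f i x) g = (\<Sum>i\<in>I. ip (f i) g)"
proof -
  have "finite (supp (\<lambda>x. \<Sum>i\<in>I. f i x))"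
    by (rule finite_subset[OF supp_sum]) (use assms in auto)
  then have "ip (\<lambda>x. \<Sum>i\<in>I. f i x) g = ip g (\<lambda>x. \<Sum>i\<in>I. f i x)"
    using assms by (intro ip_comm)
  also have "\<dots> = (\<Sum>i\<in>I. ip (f i) g)"
    unfolding ip_sum_right using assms by (intro sum.cong ip_comm) auto
  finally show ?thesis .
qed

lemma walk_shift: "walk n f = (\<lambda>x. \<Sum>w\<in>words S n. shift (wprod G w) f x)"
  by (simp add: walk_def shift_def)

lemma finite_supp_shift: "finite (supp f) \<Longrightarrow> w \<in> carrier G \<Longrightarrow> finite (supp (shift w f))"
  by (simp add: supp_shift)

lemma finite_supp_walk: assumes "finite (supp f)" shows "finite (supp (walk n f))"
  unfolding walk_shift
  by (rule finite_subset[OF supp_sum]) (use assms in \<open>auto intro!: finite_supp_shift words_closed\<close>)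

lemma walk_walk: "x \<in> carrier G \<Longrightarrow> walk n (walk m f) x = walk (n + m) f x"
  unfolding walk_def sum_words_append
proof (intro sum.cong refl)
  fix u v assume x: "x \<in> carrier G" and u: "u \<in> words S n" and v: "v \<in> words S m"
  have "set u \<subseteq> carrier G" "set v \<subseteq> carrier G" using u v S_closed by (auto simp: words_def)
  then show "f (x \<otimes> wprod G u \<otimes> wprod G v) = f (x \<otimes> wprod G (u @ v))"
    using x by (simp add: wprod_append m_assoc)
qed

lemma moment_eq: "moment n f = (\<Sum>w\<in>words S n. ip f (shift (wprod G w) f))"
  by (simp add: moment_def walk_shift ip_sum_right)

lemma ip_walk_adjoint: assumes "finite (supp f)" "finite (supp g)"
  shows "ip (walk n f) g = ip f (walk n g)"
proof -
  have "ip (walk n f) g = (\<Sum>w\<in>words S n. ip (shift (wprod G w) f) g)"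
    unfolding walk_shift using assms by (intro ip_sum_left) (auto intro!: finite_supp_shift words_closed)
  also have "\<dots> = (\<Sum>w\<in>words S n. ip (shift (wprod G (rev w)) f) g)"
    by (rule sum_words_rev[symmetric])
  also have "\<dots> = (\<Sum>w\<in>words S n. ip f (shift (wprod G w) g))"
    by (intro sum.cong refl) (simp add: inv_wprod[symmetric] ip_shift_inv words_closed)
  also have "\<dots> = ip f (walk n g)"
    by (simp add: walk_shift ip_sum_right)
  finally show ?thesis .
qed

lemma ip_walk_walk: assumes "finite (supp f)"
  shows "ip (walk n f) (walk m f) = moment (n + m) f"
  using assms unfolding moment_def
  by (subst ip_walk_adjoint) (auto intro: finite_supp_walk ip_cong walk_walk)

lemma ip_self_nonneg: "ip f f \<ge> 0"
  unfolding ip_def by (intro sum_nonneg) simp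

lemma ip_Cauchy_Schwarz: assumes "finite (supp f)" "finite (supp g)"
  shows "(ip f g)\<^sup>2 \<le> ip f f * ip g g"
proof -
  let ?X = "supp f \<union> supp g"
  have X: "finite ?X" "?X \<subseteq> carrier G" using assms supp_closed by auto
  have "ip f g = (\<Sum>x\<in>?X. f x * g x)" "ip f f = (\<Sum>x\<in>?X. (f x)\<^sup>2)" "ip g g = (\<Sum>x\<in>?X. (g x)\<^sup>2)"
    using X by (subst ip_eq[of ?X]; simp add: power2_eq_square)+
  then show ?thesis using Cauchy_Schwarz_ineq_sum[of f g ?X] by simp
qed

lemma moment_even_nonneg: "finite (supp f) \<Longrightarrow> moment (n + n) f \<ge> 0"
  by (simp add: ip_self_nonneg flip: ip_walk_walk)

lemma moment_Cauchy_Schwarz: assumes "finite (supp f)"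
  shows "(moment (n + m) f)\<^sup>2 \<le> moment (n + n) f * moment (m + m) f"
  using ip_Cauchy_Schwarz[OF finite_supp_walk[OF assms] finite_supp_walk[OF assms], of n m]
  by (simp add: ip_walk_walk assms)

lemma moment_0: "moment 0 f = ip f f"
  unfolding moment_def walk_def by (auto intro!: ip_cong)

definition dirac :: "'a \<Rightarrow> 'a \<Rightarrow> real" where
  "dirac y = (\<lambda>x. if x = y then 1 else 0)"

lemma supp_dirac: "y \<in> carrier G \<Longrightarrow> supp (dirac y) = {y}"
  by (auto simp: supp_def dirac_def)

lemma ip_dirac: "y \<in> carrier G \<Longrightarrow> ip (dirac y) f = f y"
  by (simp add: ip_def supp_dirac) (simp add: dirac_def)

abbreviation count :: "nat \<Rightarrow> nat" where
  "count n \<equiv> card (returning_words G S n)"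

lemma returning_words_eq: "returning_words G S n = {w \<in> words S n. wprod G w = \<one>}"
  by (auto simp: returning_words_def words_def wprod_def)

lemma moment_dirac: assumes "y \<in> carrier G" shows "moment n (dirac y) = real (count n)"
proof -
  have "moment n (dirac y) = (\<Sum>w\<in>words S n. dirac y (y \<otimes> wprod G w))"
    using assms by (simp add: moment_def ip_dirac walk_def)
  also have "\<dots> = (\<Sum>w\<in>words S n. if wprod G w = \<one> then 1 else 0)"
    using assms words_closed by (intro sum.cong) (auto simp: dirac_def)
  also have "\<dots> = real (count n)"
    unfolding returning_words_eq by (subst sum.inter_filter[symmetric]) auto
  finally show ?thesis .
qed

text \<open>Cauchy-Schwarz with the path cut in the middle: at even times no two points are joined
  by more words than a point with itself.\<close>

lemma walk_dirac_le: assumes "x \<in> carrier G" "y \<in> carrier G"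
  shows "walk (n + n) (dirac y) x \<le> real (count (n + n))"
proof -
  have fs: "finite (supp (dirac x))" "finite (supp (dirac y))"
    using assms by (simp_all add: supp_dirac)
  have "walk (n + n) (dirac y) x = ip (dirac x) (walk n (walk n (dirac y)))"
    using assms by (simp add: ip_dirac walk_walk)
  also have "\<dots> = ip (walk n (dirac x)) (walk n (dirac y))"
    using fs by (intro ip_walk_adjoint[symmetric] finite_supp_walk)
  finally have *: "walk (n + n) (dirac y) x = ip (walk n (dirac x)) (walk n (dirac y))" .
  have "(walk (n + n) (dirac y) x)\<^sup>2 \<le> (real (count (n + n)))\<^sup>2"
    unfolding * power2_eq_square[of "real _"]
    using ip_Cauchy_Schwarz[OF finite_supp_walk[OF fs(1)] finite_supp_walk[OF fs(2)], of n n]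
    by (simp add: ip_walk_walk fs moment_dirac assms)
  then show ?thesis by (rule power2_le_imp_le) simp
qed

text \<open>A crude bound, but its constant depends on \<open>f\<close> and not on \<open>n\<close>;
  high powers remove it in \<open>moment_le_spectral_radius\<close>.\<close>

lemma moment_le: assumes "finite (supp f)"
  shows "moment (n + n) f \<le> (\<Sum>x\<in>supp f. \<bar>f x\<bar>)\<^sup>2 * real (count (n + n))"
proof -
  have "walk (n + n) f x = (\<Sum>y\<in>supp f. f y * walk (n + n) (dirac y) x)" if x: "x \<in> carrier G" for x
  proof -
    have "f z = (\<Sum>y\<in>supp f. f y * dirac y z)" if "z \<in> carrier G" for z
    proof -
      have "(\<Sum>y\<in>supp f. f y * dirac y z) = (\<Sum>y\<in>supp f. if y = z then f y else 0)"
        by (intro sum.cong) (auto simp: dirac_def)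
      then show ?thesis using assms that by (auto simp: sum.delta supp_def)
    qed
    then have "walk (n + n) f x = (\<Sum>w\<in>words S (n + n). \<Sum>y\<in>supp f. f y * dirac y (x \<otimes> wprod G w))"
      unfolding walk_def using x words_closed by (intro sum.cong) auto
    then show ?thesis unfolding walk_def sum_distrib_left by (subst sum.swap)
  qed
  then have "moment (n + n) f = (\<Sum>x\<in>supp f. f x * (\<Sum>y\<in>supp f. f y * walk (n + n) (dirac y) x))"
    unfolding moment_def ip_def by (intro sum.cong) (auto simp: supp_def)
  also have "\<dots> = (\<Sum>x\<in>supp f. \<Sum>y\<in>supp f. f x * f y * walk (n + n) (dirac y) x)"
    by (simp add: sum_distrib_left mult.assoc)
  also have "\<dots> \<le> (\<Sum>x\<in>supp f. \<Sum>y\<in>supp f. \<bar>f x\<bar> * \<bar>f y\<bar> * real (count (n + n)))"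
  proof (intro sum_mono)
    fix x y assume "x \<in> supp f" "y \<in> supp f"
    then have c: "x \<in> carrier G" "y \<in> carrier G" by (auto simp: supp_def)
    have "0 \<le> walk (n + n) (dirac y) x"
      unfolding walk_def dirac_def by (intro sum_nonneg) auto
    then have "f x * f y * walk (n + n) (dirac y) x \<le> \<bar>f x * f y\<bar> * walk (n + n) (dirac y) x"
      by (intro mult_right_mono) auto
    also have "\<dots> \<le> \<bar>f x * f y\<bar> * real (count (n + n))"
      using walk_dirac_le[OF c] by (intro mult_left_mono) auto
    finally show "f x * f y * walk (n + n) (dirac y) x \<le> \<bar>f x\<bar> * \<bar>f y\<bar> * real (count (n + n))"
      by (simp add: abs_mult)
  qed
  also have "\<dots> = (\<Sum>x\<in>supp f. \<bar>f x\<bar>)\<^sup>2 * real (count (n + n))"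
    by (simp add: power2_eq_square sum_distrib_left sum_distrib_right mult.assoc) (rule sum.swap)
  finally show ?thesis .
qed

abbreviation "deg \<equiv> card S"

lemma deg_pos: "deg > 0"
  using fin_S S_nonempty by (simp add: card_gt_0_iff)

lemma count_0 [simp]: "count 0 = 1"
proof -
  have "returning_words G S 0 = {[]}" by (auto simp: returning_words_eq)
  then show ?thesis by simp
qed

lemma count_le: "count n \<le> deg ^ n"
  unfolding returning_words_eq card_words[OF fin_S, symmetric]
  by (intro card_mono) auto

lemma count_mult_le: "count m * count n \<le> count (m + n)"
proof -
  have "count m * count n = card ((\<lambda>(u, v). u @ v) ` (returning_words G S m \<times> returning_words G S n))"
  proof (subst card_image)
    show "inj_on (\<lambda>(u, v). u @ v) (returning_words G S m \<times> returning_words G S n)"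
      by (auto simp: inj_on_def returning_words_eq words_def)
  qed (simp add: card_cartesian_product)
  also have "\<dots> \<le> count (m + n)"
  proof (intro card_mono subsetI)
    show "finite (returning_words G S (m + n))" by (simp add: returning_words_eq)
    fix w assume "w \<in> (\<lambda>(u, v). u @ v) ` (returning_words G S m \<times> returning_words G S n)"
    then show "w \<in> returning_words G S (m + n)"
      using S_closed by (auto simp: returning_words_eq words_def wprod_append subset_eq)
  qed
  finally show ?thesis .
qed

lemma count_power_le: "count n ^ j \<le> count (j * n)"
proof (induction j)
  case 0 then show ?case by simp
next
  case (Suc j)
  have "count n ^ Suc j \<le> count n * count (j * n)" using Suc by simp
  also have "\<dots> \<le> count (n + j * n)" by (rule count_mult_le)
  finally show ?case by simp
qed

definition rad_seq :: "nat \<Rightarrow> real" where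
  "rad_seq n = 1 / real deg * root n (real (count n))"

lemma rad_seq_bounds: "0 \<le> rad_seq n" "n > 0 \<Longrightarrow> rad_seq n \<le> 1"
proof -
  show "0 \<le> rad_seq n" by (cases "n = 0") (simp_all add: rad_seq_def)
  assume n: "n > 0"
  have "real (count n) \<le> real deg ^ n" using count_le[of n] by (metis of_nat_le_iff of_nat_power)
  then have "root n (real (count n)) \<le> root n (real deg ^ n)" using n by (intro real_root_le_mono)
  then show "rad_seq n \<le> 1" using n deg_pos by (simp add: rad_seq_def real_root_power_cancel)
qed

lemma spectral_radius_limsup: "limsup (\<lambda>n. ereal (rad_seq n)) = ereal (spectral_radius G S)"
proof -
  have "limsup (\<lambda>n. ereal (rad_seq n)) \<le> 1"
    using rad_seq_bounds(2) by (intro Limsup_bounded) (auto intro!: eventually_sequentiallyI[of 1])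
  moreover have "0 \<le> limsup (\<lambda>n. ereal (rad_seq n))"
    using rad_seq_bounds(1) by (intro le_Limsup) auto
  ultimately have "\<bar>limsup (\<lambda>n. ereal (rad_seq n))\<bar> \<noteq> \<infinity>" by auto
  then show ?thesis unfolding spectral_radius_def rad_seq_def[symmetric]
    by (simp add: ereal_real)
qed

lemma spectral_radius_nonneg: "spectral_radius G S \<ge> 0"
proof -
  have "0 \<le> limsup (\<lambda>n. ereal (rad_seq n))"
    using rad_seq_bounds(1) by (intro le_Limsup) auto
  then show ?thesis by (simp add: spectral_radius_limsup)
qed

text \<open>Supermultiplicativity: a value \<open>rad_seq n\<close> above the upper limit would
  persist at all multiples of \<open>n\<close>.\<close>

lemma count_le_spectral_radius: "real (count n) \<le> (real deg * spectral_radius G S) ^ n"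
proof (cases "n = 0")
  case True then show ?thesis by simp
next
  case False
  have "rad_seq n \<le> spectral_radius G S"
  proof (rule ccontr)
    assume "\<not> ?thesis"
    then have "limsup (\<lambda>n. ereal (rad_seq n)) < ereal (rad_seq n)" by (simp add: spectral_radius_limsup)
    then have "eventually (\<lambda>m. ereal (rad_seq m) < ereal (rad_seq n)) sequentially"
      by (rule Limsup_lessD)
    then obtain N where N: "\<And>m. m \<ge> N \<Longrightarrow> rad_seq m < rad_seq n"
      by (auto simp: eventually_sequentially)
    let ?j = "Suc N"
    have "real (count n) ^ ?j \<le> real (count (?j * n))"
      using count_power_le[of n ?j] by (metis of_nat_le_iff of_nat_power)
    then have "root (?j * n) (real (count n) ^ ?j) \<le> root (?j * n) (real (count (?j * n)))"
      using False by (intro real_root_le_mono) auto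
    moreover have "root (?j * n) (real (count n) ^ ?j) = root n (real (count n))"
      using False by (subst mult.commute, subst real_root_mult_exp) (simp add: real_root_power_cancel del: power_Suc)
    ultimately have "rad_seq n \<le> rad_seq (?j * n)"
      unfolding rad_seq_def by (intro mult_left_mono) auto
    moreover have "?j * n \<ge> N" using False by (cases n) auto
    ultimately show False using N by fastforce
  qed
  then have "root n (real (count n)) \<le> real deg * spectral_radius G S"
    using deg_pos by (simp add: rad_seq_def field_simps)
  then have "root n (real (count n)) ^ n \<le> (real deg * spectral_radius G S) ^ n"
    by (intro power_mono real_root_pos_pos_le) auto
  then show ?thesis using False by simp
qed

lemma spectral_radius_le:
  assumes "\<And>n. real (count n) \<le> lam ^ n" "lam \<ge> 0" shows "real deg * spectral_radius G S \<le> lam"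
proof -
  have "rad_seq n \<le> lam / real deg" if "n \<ge> 1" for n
  proof -
    have "root n (real (count n)) \<le> root n (lam ^ n)"
      using that assms by (intro real_root_le_mono) auto
    then show ?thesis using that assms deg_pos by (simp add: rad_seq_def real_root_power_cancel divide_right_mono)
  qed
  then have "limsup (\<lambda>n. ereal (rad_seq n)) \<le> ereal (lam / real deg)"
    by (intro Limsup_bounded) (auto intro!: eventually_sequentiallyI[of 1])
  then show ?thesis using deg_pos by (simp add: spectral_radius_limsup field_simps)
qed

text \<open>The norm bound of the spectral theorem, obtained from log-convexity of the even moments,
  \<open>(q n)^2 <= q 0 * q (2 n)\<close>. Along \<open>2 ^ j * m\<close> the ratio
  \<open>q m / q 0\<close> is raised to the power \<open>2 ^ j\<close>, while
  \<open>moment_le\<close> bounds the growth by \<open>C * b ^ (2 ^ j)\<close> with \<open>C\<close>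
  independent of \<open>j\<close>.\<close>

lemma moment_le_spectral_radius: assumes fs: "finite (supp f)"
  shows "moment (m + m) f \<le> (real deg * spectral_radius G S) ^ (m + m) * ip f f"
proof (rule ccontr)
  define b where "b = (real deg * spectral_radius G S) ^ (m + m)"
  define q where "q n = moment (n + n) f" for n
  define C where "C = (\<Sum>x\<in>supp f. \<bar>f x\<bar>)\<^sup>2"
  assume "\<not> ?thesis"
  then have gt: "q m > b * q 0" by (simp add: q_def b_def moment_0)
  have b0: "b \<ge> 0" using spectral_radius_nonneg by (simp add: b_def)
  have qn: "q n \<ge> 0" for n using fs by (simp add: q_def moment_even_nonneg)
  have C: "C \<ge> 0" by (simp add: C_def)
  have logc: "(q n)\<^sup>2 \<le> q 0 * q (n + n)" for n
    using moment_Cauchy_Schwarz[OF fs, of 0 "n + n"] by (simp add: q_def)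
  have q0: "q 0 > 0"
  proof (rule ccontr)
    assume "\<not> q 0 > 0"
    then have "q 0 = 0" using qn[of 0] by simp
    with logc[of m] have "q m = 0" by simp
    then show False using gt \<open>q 0 = 0\<close> by simp
  qed
  have bound: "q (2 ^ j * m) \<le> C * b ^ (2 ^ j)" for j
  proof -
    have "q (2 ^ j * m) \<le> C * real (count (2 ^ j * m + 2 ^ j * m))"
      using moment_le[OF fs] by (simp add: q_def C_def)
    also have "\<dots> \<le> C * (real deg * spectral_radius G S) ^ (2 ^ j * m + 2 ^ j * m)"
      using C count_le_spectral_radius by (intro mult_left_mono) auto
    also have "2 ^ j * m + 2 ^ j * m = (m + m) * 2 ^ j" by (simp add: algebra_simps)
    finally show ?thesis by (simp add: b_def power_mult)
  qed
  have lower: "(q m / q 0) ^ (2 ^ j) \<le> q (2 ^ j * m) / q 0" for j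
  proof (induction j)
    case (Suc j)
    have "(q m / q 0) ^ (2 ^ Suc j) = ((q m / q 0) ^ (2 ^ j))\<^sup>2" by (metis power_Suc2 power_mult)
    also have "\<dots> \<le> (q (2 ^ j * m) / q 0)\<^sup>2"
      using Suc qn q0 by (intro power_mono) auto
    also have "\<dots> \<le> q 0 * q (2 ^ j * m + 2 ^ j * m) / (q 0)\<^sup>2"
      using logc by (simp add: power_divide divide_right_mono)
    also have "\<dots> = q (2 ^ Suc j * m) / q 0"
      using q0 by (simp add: power2_eq_square mult_2 distrib_right)
    finally show ?case .
  qed (simp add: )
  define u where "u = q m / q 0"
  have ub: "u > b" using gt q0 by (simp add: u_def field_simps)
  have le: "u ^ (2 ^ j) \<le> C / q 0 * b ^ (2 ^ j)" for j
    using order_trans[OF lower[of j] divide_right_mono[OF bound[of j], of "q 0"]] q0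
    by (simp add: u_def)
  show False
  proof (cases "b = 0")
    case True then show False using le[of 0] ub by simp
  next
    case False
    then have bp: "b > 0" using b0 by simp
    then have "u / b > 1" using ub by simp
    then obtain n where n: "C / q 0 < (u / b) ^ n" using real_arch_pow by blast
    have "(u / b) ^ n \<le> (u / b) ^ (2 ^ n)"
      using \<open>u / b > 1\<close> by (intro power_increasing) (auto intro: less_imp_le)
    also have "\<dots> \<le> C / q 0" using le[of n] bp by (simp add: power_divide field_simps)
    finally show False using n by simp
  qed
qed

text \<open>The shift by \<open>z\<close> carries everything outside \<open>E z\<close> into
  \<open>E z\<close>. If \<open>f\<close> were nearly invariant under all three shifts, each of
  three disjoint sets would therefore hold about half of the total mass.\<close>

lemma pingpong_ip:
  assumes Z: "Z \<subseteq> words S k" "card Z = 3" and disj: "disjoint_family_on E Z"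
    and pp: "\<And>z g. z \<in> Z \<Longrightarrow> g \<in> carrier G \<Longrightarrow> g \<notin> E z \<Longrightarrow> g \<otimes> wprod G z \<in> E z"
    and fs: "finite (supp f)"
  shows "(\<Sum>z\<in>Z. ip f (shift (wprod G z) f)) \<le> (3 - 1/12) * ip f f"
proof -
  have finZ: "finite Z" using Z(2) by (metis card.infinite zero_neq_numeral)
  define D where "D z = 2 * ip f f - 2 * ip f (shift (wprod G z) f)" for z
  define e where "e z = (\<Sum>x\<in>supp f \<inter> E z. (f x)\<^sup>2)" for z
  have ipf: "ip f f = (\<Sum>x\<in>supp f. (f x)\<^sup>2)" by (simp add: ip_def power2_eq_square)
  have main: "ip f f - e z \<le> 3/2 * e z + 3 * D z" if z: "z \<in> Z" for z
  proof -
    let ?w = "wprod G z"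
    let ?h = "shift ?w f"
    let ?X = "supp f \<union> supp ?h"
    have w: "?w \<in> carrier G" using z Z words_closed by auto
    have X: "finite ?X" "?X \<subseteq> carrier G" using fs w finite_supp_shift[OF fs w] supp_closed by auto
    have "D z = ip f f - 2 * ip f ?h + ip ?h ?h" using w by (simp add: D_def ip_shift)
    also have "\<dots> = (\<Sum>x\<in>?X. f x * f x) - 2 * (\<Sum>x\<in>?X. f x * ?h x) + (\<Sum>x\<in>?X. ?h x * ?h x)"
      using X by (simp add: ip_eq[of ?X])
    also have "\<dots> = (\<Sum>x\<in>?X. (f x - ?h x)\<^sup>2)"
      by (simp add: power2_eq_square algebra_simps sum.distrib sum_subtractf sum_distrib_left)
    finally have D: "D z = (\<Sum>x\<in>?X. (f x - ?h x)\<^sup>2)" .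
    have inj: "inj_on (\<lambda>x. x \<otimes> ?w) (supp f - E z)"
      using w supp_closed by (intro inj_onI) (metis Diff_iff right_cancel subsetD)
    have "(\<Sum>x\<in>supp f - E z. (?h x)\<^sup>2) = (\<Sum>y\<in>(\<lambda>x. x \<otimes> ?w) ` (supp f - E z). (f y)\<^sup>2)"
      using inj by (simp add: sum.reindex shift_def)
    also have "\<dots> = (\<Sum>y\<in>(\<lambda>x. x \<otimes> ?w) ` (supp f - E z) \<inter> supp f. (f y)\<^sup>2)"
      using fs w by (intro sum.mono_neutral_right) (auto simp: supp_def)
    also have "\<dots> \<le> e z"
      unfolding e_def using fs pp[OF z] by (intro sum_mono2) (auto simp: supp_def)
    finally have h: "(\<Sum>x\<in>supp f - E z. (?h x)\<^sup>2) \<le> e z" .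
    have "ip f f - e z = (\<Sum>x\<in>supp f - E z. (f x)\<^sup>2)"
      unfolding ipf e_def using fs by (simp add: sum_diff Diff_Int_distrib sum.Int_Diff[of "supp f" _ "E z"])
    \<comment> \<open>The inequality \<open>a^2 <= (1 + t) b^2 + (1 + 1/t) (a - b)^2\<close> at t =
      1/2. The factor 3/2 has to stay below 2, the least value, in units of \<open>ip f f\<close>,
      of the masses outside the three disjoint sets added up.\<close>
    also have "\<dots> \<le> (\<Sum>x\<in>supp f - E z. 3/2 * (?h x)\<^sup>2 + 3 * (f x - ?h x)\<^sup>2)"
    proof (intro sum_mono)
      fix x
      have "3/2 * (?h x)\<^sup>2 + 3 * (f x - ?h x)\<^sup>2 - (f x)\<^sup>2 = (2 * f x - 3 * ?h x)\<^sup>2 / 2"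
        by (simp add: power2_eq_square field_simps)
      moreover have "(2 * f x - 3 * ?h x)\<^sup>2 / 2 \<ge> 0" by simp
      ultimately show "(f x)\<^sup>2 \<le> 3/2 * (?h x)\<^sup>2 + 3 * (f x - ?h x)\<^sup>2" by linarith
    qed
    also have "\<dots> = 3/2 * (\<Sum>x\<in>supp f - E z. (?h x)\<^sup>2) + 3 * (\<Sum>x\<in>supp f - E z. (f x - ?h x)\<^sup>2)"
      by (simp add: sum.distrib sum_distrib_left)
    also have "(\<Sum>x\<in>supp f - E z. (f x - ?h x)\<^sup>2) \<le> D z"
      unfolding D using X by (intro sum_mono2) auto
    finally show ?thesis using h by simp
  qed
  have "(\<Sum>z\<in>Z. e z) = (\<Sum>x\<in>(\<Union>z\<in>Z. supp f \<inter> E z). (f x)\<^sup>2)"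
    unfolding e_def using finZ fs disj
    by (intro sum.UNION_disjoint[symmetric]) (auto simp: disjoint_family_on_def)
  also have "\<dots> \<le> ip f f" unfolding ipf using fs by (intro sum_mono2) auto
  finally have se: "(\<Sum>z\<in>Z. e z) \<le> ip f f" .
  \<comment> \<open>In units of \<open>ip f f\<close> this becomes
    \<open>3 - 1 <= 3/2 + 3 * (sum of D)\<close>, so the \<open>D z\<close> add up to at least 1/6.
    Since \<open>D z\<close> is twice the defect of one inner product, the total 3 loses half of
    that.\<close>
  have "(\<Sum>z\<in>Z. ip f f - e z) \<le> (\<Sum>z\<in>Z. 3/2 * e z + 3 * D z)"
    using main by (intro sum_mono)
  then have "3 * ip f f - (\<Sum>z\<in>Z. e z) \<le> 3/2 * (\<Sum>z\<in>Z. e z) + 3 * (\<Sum>z\<in>Z. D z)"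
    using Z(2) by (simp add: sum_subtractf sum.distrib sum_distrib_left)
  moreover have "(\<Sum>z\<in>Z. D z) = 6 * ip f f - 2 * (\<Sum>z\<in>Z. ip f (shift (wprod G z) f))"
    using Z(2) by (simp add: D_def sum_subtractf sum_distrib_left)
  ultimately show ?thesis using se by simp
qed

end

text \<open>Injectivity on the generators lets the walks on \<open>G\<close> and \<open>G'\<close>
  be summed over the same words.\<close>

locale involution_covering =
  G: involution_marked G S + G': involution_marked G' S'
  for G :: "('a, 'b) monoid_scheme" and S and G' :: "('c, 'd) monoid_scheme" and S' +
  fixes \<pi> :: "'a \<Rightarrow> 'c"
  assumes hom: "\<pi> \<in> hom G G'" and bij: "bij_betw \<pi> S S'"
begin

lemma hom_closed [simp]: "x \<in> carrier G \<Longrightarrow> \<pi> x \<in> carrier G'"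
  and hom_mult [simp]: "x \<in> carrier G \<Longrightarrow> y \<in> carrier G \<Longrightarrow> \<pi> (x \<otimes>\<^bsub>G\<^esub> y) = \<pi> x \<otimes>\<^bsub>G'\<^esub> \<pi> y"
  using hom by (auto simp: hom_def)

lemma hom_one [simp]: "\<pi> \<one>\<^bsub>G\<^esub> = \<one>\<^bsub>G'\<^esub>"
  using hom_mult[of "\<one>\<^bsub>G\<^esub>" "\<one>\<^bsub>G\<^esub>"] hom_closed[of "\<one>\<^bsub>G\<^esub>"] G'.l_cancel_one[of "\<pi> \<one>\<^bsub>G\<^esub>" "\<pi> \<one>\<^bsub>G\<^esub>"] by simp

lemma card_S': "card S' = card S"
  using bij bij_betw_same_card by metis

lemma hom_wprod: "w \<in> words S n \<Longrightarrow> \<pi> (wprod G w) = wprod G' (map \<pi> w)"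
proof (induction w arbitrary: n)
  case (Cons s w)
  then have "s \<in> carrier G" "w \<in> words S (length w)" using G.S_closed by (auto simp: words_def)
  then show ?case using Cons.IH[of "length w"] G.words_closed by simp
qed simp

lemma sum_words_covering: "(\<Sum>w\<in>words S' n. g w) = (\<Sum>w\<in>words S n. g (map \<pi> w))"
proof (induction n arbitrary: g)
  case (Suc n)
  have "(\<Sum>s\<in>S'. \<Sum>w\<in>words S n. g (s # map \<pi> w)) = (\<Sum>s\<in>S. \<Sum>w\<in>words S n. g (\<pi> s # map \<pi> w))"
    using sum.reindex_bij_betw[OF bij, symmetric] .
  then show ?case using Suc by (simp add: sum_words_Suc)
qed simp

definition fibre_norm :: "('a \<Rightarrow> real) \<Rightarrow> 'c \<Rightarrow> real" where
  "fibre_norm f y = sqrt (\<Sum>x\<in>{x\<in>G.supp f. \<pi> x = y}. (f x)\<^sup>2)"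

lemma supp_fibre_norm: "G'.supp (fibre_norm f) \<subseteq> \<pi> ` G.supp f"
proof
  fix y assume "y \<in> G'.supp (fibre_norm f)"
  then have "(\<Sum>x\<in>{x\<in>G.supp f. \<pi> x = y}. (f x)\<^sup>2) \<noteq> 0" by (auto simp: G'.supp_def fibre_norm_def)
  then have "{x\<in>G.supp f. \<pi> x = y} \<noteq> {}" by (metis (no_types, lifting) sum.empty)
  then show "y \<in> \<pi> ` G.supp f" by auto
qed

text \<open>Right translation by \<open>w\<close> injects the fibre over \<open>y\<close> into the
  fibre over \<open>y\<close> times \<open>\<pi> w\<close>; Cauchy-Schwarz on each fibre gives the
  bound.\<close>

lemma ip_fibre_norm:
  assumes fs: "finite (G.supp f)" and w: "w \<in> carrier G"
  shows "G.ip f (G.shift w f) \<le> G'.ip (fibre_norm f) (G'.shift (\<pi> w) (fibre_norm f))"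
    and "G'.ip (fibre_norm f) (fibre_norm f) = G.ip f f"
proof -
  let ?Y = "\<pi> ` G.supp f"
  let ?F = "\<lambda>y. {x \<in> G.supp f. \<pi> x = y}"
  have Y: "finite ?Y" "?Y \<subseteq> carrier G'" using fs by (auto simp: G.supp_def)
  have ip': "G'.ip (fibre_norm f) g = (\<Sum>y\<in>?Y. fibre_norm f y * g y)" for g
    using fs Y by (intro G'.ip_eq supp_fibre_norm) auto
  have "G.ip f (G.shift w f) = (\<Sum>y\<in>?Y. \<Sum>x\<in>?F y. f x * f (x \<otimes>\<^bsub>G\<^esub> w))"
    unfolding G.ip_def G.shift_def using fs by (rule sum.image_gen)
  also have "\<dots> \<le> (\<Sum>y\<in>?Y. fibre_norm f y * fibre_norm f (y \<otimes>\<^bsub>G'\<^esub> \<pi> w))"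
  proof (intro sum_mono)
    fix y assume y: "y \<in> ?Y"
    have "(\<Sum>x\<in>?F y. f x * f (x \<otimes>\<^bsub>G\<^esub> w))\<^sup>2 \<le> (\<Sum>x\<in>?F y. (f x)\<^sup>2) * (\<Sum>x\<in>?F y. (f (x \<otimes>\<^bsub>G\<^esub> w))\<^sup>2)"
      by (rule Cauchy_Schwarz_ineq_sum)
    also have "(\<Sum>x\<in>?F y. (f (x \<otimes>\<^bsub>G\<^esub> w))\<^sup>2) \<le> (\<Sum>x\<in>?F (y \<otimes>\<^bsub>G'\<^esub> \<pi> w). (f x)\<^sup>2)"
    proof -
      have inj: "inj_on (\<lambda>x. x \<otimes>\<^bsub>G\<^esub> w) (?F y)"
        using w by (intro inj_onI) (auto simp: G.supp_def)
      have finF: "finite (?F y)" for y using fs by simp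
      have "(\<Sum>x\<in>?F y. (f (x \<otimes>\<^bsub>G\<^esub> w))\<^sup>2) = (\<Sum>x\<in>(\<lambda>x. x \<otimes>\<^bsub>G\<^esub> w) ` ?F y. (f x)\<^sup>2)"
        using inj by (simp add: sum.reindex)
      also have "\<dots> = (\<Sum>x\<in>(\<lambda>x. x \<otimes>\<^bsub>G\<^esub> w) ` ?F y \<inter> G.supp f. (f x)\<^sup>2)"
        using finite_imageI[OF finF[of y]] w by (intro sum.mono_neutral_right) (auto simp: G.supp_def)
      also have "\<dots> \<le> (\<Sum>x\<in>?F (y \<otimes>\<^bsub>G'\<^esub> \<pi> w). (f x)\<^sup>2)"
        using finF[of "y \<otimes>\<^bsub>G'\<^esub> \<pi> w"] w by (intro sum_mono2) (auto simp: G.supp_def)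
      finally show ?thesis .
    qed
    finally have "(\<Sum>x\<in>?F y. f x * f (x \<otimes>\<^bsub>G\<^esub> w))\<^sup>2
        \<le> (\<Sum>x\<in>?F y. (f x)\<^sup>2) * (\<Sum>x\<in>?F (y \<otimes>\<^bsub>G'\<^esub> \<pi> w). (f x)\<^sup>2)"
      by (simp add: mult_left_mono sum_nonneg)
    then have "\<bar>\<Sum>x\<in>?F y. f x * f (x \<otimes>\<^bsub>G\<^esub> w)\<bar> \<le> sqrt ((\<Sum>x\<in>?F y. (f x)\<^sup>2) * (\<Sum>x\<in>?F (y \<otimes>\<^bsub>G'\<^esub> \<pi> w). (f x)\<^sup>2))"
      by (simp add: real_le_rsqrt)
    then show "(\<Sum>x\<in>?F y. f x * f (x \<otimes>\<^bsub>G\<^esub> w)) \<le> fibre_norm f y * fibre_norm f (y \<otimes>\<^bsub>G'\<^esub> \<pi> w)"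
      by (simp add: fibre_norm_def real_sqrt_mult)
  qed
  finally show "G.ip f (G.shift w f) \<le> G'.ip (fibre_norm f) (G'.shift (\<pi> w) (fibre_norm f))"
    by (simp add: ip' G'.shift_def)
  have "G'.ip (fibre_norm f) (fibre_norm f) = (\<Sum>y\<in>?Y. \<Sum>x\<in>?F y. f x * f x)"
    unfolding ip' by (intro sum.cong refl) (simp add: fibre_norm_def sum_nonneg flip: power2_eq_square)
  also have "\<dots> = G.ip f f"
    unfolding G.ip_def using fs by (rule sum.image_gen[symmetric])
  finally show "G'.ip (fibre_norm f) (fibre_norm f) = G.ip f f" .
qed

lemma spectral_radius_strict:
  assumes Z: "Z \<subseteq> words S (m + m)" "card Z = 3" "m > 0" and disj: "disjoint_family_on E Z"
    and ker: "\<And>z. z \<in> Z \<Longrightarrow> \<pi> (wprod G z) = \<one>\<^bsub>G'\<^esub>"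
    and pp: "\<And>z g. z \<in> Z \<Longrightarrow> g \<in> carrier G \<Longrightarrow> g \<notin> E z \<Longrightarrow> g \<otimes>\<^bsub>G\<^esub> wprod G z \<in> E z"
  shows "spectral_radius G S < spectral_radius G' S'"
proof -
  \<comment> \<open>The power is the bound of \<open>moment_le_spectral_radius\<close> for the
    \<open>m + m\<close> step operator of the quotient; 1/12 is the loss in
    \<open>pingpong_ip\<close>.\<close>
  define lam where "lam = (real (card S) * spectral_radius G' S') ^ (m + m) - 1/12"
  have key: "G.moment (m + m) f \<le> lam * G.ip f f" if fs: "finite (G.supp f)" for f
  proof -
    let ?F = "fibre_norm f"
    have fs': "finite (G'.supp ?F)" using finite_subset[OF supp_fibre_norm[of f]] fs by simp
    have finZ: "Z \<subseteq> words S (m + m)" "finite (words S (m + m))" using Z by auto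
    have "G.moment (m + m) f = (\<Sum>w\<in>words S (m + m) - Z. G.ip f (G.shift (wprod G w) f))
        + (\<Sum>w\<in>Z. G.ip f (G.shift (wprod G w) f))"
      unfolding G.moment_eq using finZ by (rule sum.subset_diff)
    \<comment> \<open>The words in \<open>Z\<close> are trivial in the quotient and contribute the
      full \<open>3 * ip f f\<close> there, but at most \<open>(3 - 1/12) * ip f f\<close> upstairs.
      This is the source of strictness.\<close>
    also have "(\<Sum>w\<in>Z. G.ip f (G.shift (wprod G w) f)) \<le> (3 - 1/12) * G.ip f f"
      using Z disj pp fs by (intro G.pingpong_ip) auto
    also have "(3 - 1/12) * G.ip f f = (\<Sum>w\<in>Z. G'.ip ?F (G'.shift (\<pi> (wprod G w)) ?F)) - 1/12 * G.ip f f"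
    proof -
      have "G'.ip ?F (G'.shift (\<pi> (wprod G w)) ?F) = G.ip f f" if "w \<in> Z" for w
      proof -
        have "G'.ip ?F (G'.shift (\<pi> (wprod G w)) ?F) = G'.ip ?F ?F"
          using ker[OF that] by (intro G'.ip_cong) (simp add: G'.shift_def)
        then show ?thesis using ip_fibre_norm(2)[OF fs, of "\<one>\<^bsub>G\<^esub>"] by simp
      qed
      then show ?thesis using Z(2) by (simp add: algebra_simps)
    qed
    also have "(\<Sum>w\<in>words S (m + m) - Z. G.ip f (G.shift (wprod G w) f))
        \<le> (\<Sum>w\<in>words S (m + m) - Z. G'.ip ?F (G'.shift (\<pi> (wprod G w)) ?F))"
      using fs by (intro sum_mono ip_fibre_norm G.words_closed[of _ "m + m"]) auto
    finally have "G.moment (m + m) f \<le> (\<Sum>w\<in>words S (m + m) - Z. G'.ip ?F (G'.shift (\<pi> (wprod G w)) ?F))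
        + (\<Sum>w\<in>Z. G'.ip ?F (G'.shift (\<pi> (wprod G w)) ?F)) - 1/12 * G.ip f f" by simp
    also have "\<dots> = (\<Sum>w\<in>words S (m + m). G'.ip ?F (G'.shift (\<pi> (wprod G w)) ?F)) - 1/12 * G.ip f f"
      using sum.subset_diff[OF finZ] by (metis (no_types, lifting))
    also have "\<dots> = G'.moment (m + m) ?F - 1/12 * G.ip f f"
      unfolding G'.moment_eq sum_words_covering
      by (intro arg_cong2[where f = minus] sum.cong refl) (simp add: hom_wprod)
    also have "\<dots> \<le> lam * G.ip f f"
      using G'.moment_le_spectral_radius[OF fs', of m] ip_fibre_norm(2)[OF fs, of "\<one>\<^bsub>G\<^esub>"]
      by (simp add: lam_def card_S' algebra_simps)
    finally show ?thesis .
  qed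
  \<comment> \<open>Iterating \<open>key\<close> on the point mass at \<open>\<one>\<close> turns
    the operator bound into a bound for return counts.\<close>
  define f where "f n = (G.walk m ^^ n) (G.dirac \<one>\<^bsub>G\<^esub>)" for n
  have d1: "finite (G.supp (G.dirac \<one>\<^bsub>G\<^esub>))" by (simp add: G.supp_dirac)
  have fs: "finite (G.supp (f n))" for n
    by (induction n) (simp_all add: f_def d1 G.finite_supp_walk)
  have lam0: "lam \<ge> 0"
  proof -
    have "0 \<le> G.moment (m + m) (f 0)" by (rule G.moment_even_nonneg[OF fs])
    also have "\<dots> \<le> lam * G.ip (f 0) (f 0)" by (rule key[OF fs])
    also have "G.ip (f 0) (f 0) = 1" using G.moment_dirac[of "\<one>\<^bsub>G\<^esub>" 0] by (simp add: f_def G.moment_0)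
    finally show ?thesis by simp
  qed
  have norm: "G.ip (f n) (f n) \<le> lam ^ n" for n
  proof (induction n)
    case 0 show ?case using G.moment_dirac[of "\<one>\<^bsub>G\<^esub>" 0] by (simp add: f_def G.moment_0)
  next
    case (Suc n)
    have "G.ip (f (Suc n)) (f (Suc n)) = G.moment (m + m) (f n)"
      using G.ip_walk_walk[OF fs, of m n m] by (simp add: f_def)
    also have "\<dots> \<le> lam * G.ip (f n) (f n)" by (rule key[OF fs])
    also have "\<dots> \<le> lam * lam ^ n" using Suc lam0 by (intro mult_left_mono)
    finally show ?case by simp
  qed
  have fw: "f n x = G.walk (n * m) (G.dirac \<one>\<^bsub>G\<^esub>) x" if "x \<in> carrier G" for n x
    using that
  proof (induction n arbitrary: x)
    case 0 then show ?case by (simp add: f_def G.walk_def)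
  next
    case (Suc n)
    have "f (Suc n) x = G.walk m (f n) x" by (simp add: f_def)
    also have "\<dots> = G.walk m (G.walk (n * m) (G.dirac \<one>\<^bsub>G\<^esub>)) x"
      unfolding G.walk_def[of m] using Suc G.words_closed by (intro sum.cong) auto
    finally show ?case using Suc.prems by (simp add: G.walk_walk)
  qed
  \<comment> \<open>The return counts are controlled at multiples of \<open>m + m\<close> only;
    supermultiplicativity carries the bound to every \<open>n\<close>.\<close>
  have "real (G.count n) ^ (m + m) \<le> lam ^ n" for n
  proof -
    have "real (G.count n) ^ (m + m) \<le> real (G.count ((m + m) * n))"
      using G.count_power_le[of n "m + m"] by (metis of_nat_le_iff of_nat_power)
    also have "\<dots> = G.moment (n * m + n * m) (G.dirac \<one>\<^bsub>G\<^esub>)"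
      by (simp add: G.moment_dirac algebra_simps)
    also have "\<dots> = G.ip (f n) (f n)"
    proof -
      have "G.ip (f n) (f n) = G.ip (f n) (G.walk (n * m) (G.dirac \<one>\<^bsub>G\<^esub>))"
        by (rule G.ip_cong) (rule fw)
      also have "\<dots> = G.ip (G.walk (n * m) (G.dirac \<one>\<^bsub>G\<^esub>)) (f n)"
        using fs d1 by (intro G.ip_comm G.finite_supp_walk)
      also have "\<dots> = G.ip (G.walk (n * m) (G.dirac \<one>\<^bsub>G\<^esub>)) (G.walk (n * m) (G.dirac \<one>\<^bsub>G\<^esub>))"
        by (rule G.ip_cong) (rule fw)
      finally show ?thesis by (simp add: G.ip_walk_walk d1)
    qed
    also have "\<dots> \<le> lam ^ n" by (rule norm)
    finally show ?thesis .
  qed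
  moreover have "lam ^ n = (root (m + m) lam ^ n) ^ (m + m)" for n
  proof -
    have "(root (m + m) lam ^ n) ^ (m + m) = (root (m + m) lam ^ (m + m)) ^ n"
      by (simp only: power_mult[symmetric] mult.commute)
    then show ?thesis using lam0 Z(3) by simp
  qed
  ultimately have le: "real (G.count n) ^ (m + m) \<le> (root (m + m) lam ^ n) ^ (m + m)" for n
    by metis
  have "real (G.count n) \<le> root (m + m) lam ^ n" for n
    using le[of n] lam0 Z(3) by (subst (asm) power_mono_iff) (auto intro: real_root_pos_pos_le)
  then have "real (card S) * spectral_radius G S \<le> root (m + m) lam"
    using lam0 by (intro G.spectral_radius_le real_root_pos_pos_le)
  then have "(real (card S) * spectral_radius G S) ^ (m + m) \<le> root (m + m) lam ^ (m + m)"
    using G.spectral_radius_nonneg by (intro power_mono) auto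
  also have "\<dots> = lam" using lam0 Z(3) by simp
  also have "\<dots> < (real (card S) * spectral_radius G' S') ^ (m + m)" by (simp add: lam_def)
  finally have "real (card S) * spectral_radius G S < real (card S) * spectral_radius G' S'"
    by (rule power_less_imp_less_base) (simp add: G'.spectral_radius_nonneg)
  then show ?thesis by (rule mult_left_less_imp_less) simp
qed

end

section \<open>Asymptotic entropy\<close>

text \<open>Fekete's lemma. \<open>asymptotic_entropy\<close> is defined by \<open>lim\<close>,
  which carries information only for a convergent sequence.\<close>

lemma subadditive_convergent:
  fixes a :: "nat \<Rightarrow> real"
  assumes sub: "\<And>m n. a (m + n) \<le> a m + a n" and nonneg: "\<And>n. a n \<ge> 0"
  shows "convergent (\<lambda>n. a n / real n)"
proof -
  define L where "L = Inf ((\<lambda>n. a n / real n) ` {1..})"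
  have bdd: "bdd_below ((\<lambda>n. a n / real n) ` {1..})"
    by (rule bdd_belowI[of _ 0]) (auto simp: nonneg)
  have ge: "L \<le> a n / real n" if "n \<ge> 1" for n
    unfolding L_def using that bdd by (intro cInf_lower) auto
  have "(\<lambda>n. a n / real n) \<longlonglongrightarrow> L"
  proof (rule LIMSEQ_I)
    fix e :: real assume e: "e > 0"
    have "\<exists>y\<in>(\<lambda>n. a n / real n) ` {1..}. y < L + e / 2"
      using cInf_less_iff[OF _ bdd, of "L + e / 2"] e by (simp add: L_def)
    then obtain k where k: "k \<ge> 1" "a k / real k < L + e / 2" by auto
    define C where "C = (\<Sum>r<k. a r)"
    have C: "a r \<le> C" if "r < k" for r
      unfolding C_def using that nonneg by (intro member_le_sum) auto
    have step: "a (q * k + r) \<le> real q * a k + a r" for q r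
    proof (induction q)
      case (Suc q)
      have "a (Suc q * k + r) = a (k + (q * k + r))" by (simp add: algebra_simps)
      also have "\<dots> \<le> a k + (real q * a k + a r)" using sub[of k "q * k + r"] Suc by simp
      finally show ?case by (simp add: algebra_simps)
    qed simp
    have upper: "a n / real n \<le> a k / real k + C / real n" if n: "n \<ge> 1" for n
    proof -
      have "a n \<le> real (n div k) * a k + a (n mod k)" using step[of "n div k" "n mod k"] by simp
      also have "real (n div k) * a k \<le> (real n / real k) * a k"
        using nonneg of_nat_div_le_of_nat[of n k, where 'a = real] by (intro mult_right_mono) simp_all
      also have "a (n mod k) \<le> C" using k by (intro C) simp
      finally have "a n / real n \<le> (real n / real k * a k + C) / real n"
        using n by (intro divide_right_mono) auto
      also have "\<dots> = a k / real k + C / real n" using n k by (simp add: field_simps)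
      finally show ?thesis .
    qed
    obtain N where N: "2 * C / e < real N" using reals_Archimedean2 by blast
    show "\<exists>no. \<forall>n\<ge>no. norm (a n / real n - L) < e"
    proof (intro exI[of _ "max 1 N"] allI impI)
      fix n assume n: "n \<ge> max 1 N"
      then have "2 * C / e < real n" using N by linarith
      then have "C / real n < e / 2" using e n by (simp add: field_simps)
      moreover have "a n / real n \<le> a k / real k + C / real n" "L \<le> a n / real n"
        using upper[of n] ge[of n] n by simp_all
      ultimately have "a n / real n - L < e" "a n / real n - L \<ge> 0" using k by linarith+
      then show "norm (a n / real n - L) < e" by simp
    qed
  qed
  then show ?thesis by (auto simp: convergent_def)
qed

text \<open>The log-sum inequality. The condition \<open>a i <= b i\<close> makes \<open>b i\<close>
  positive wherever \<open>a i\<close> is.\<close>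

lemma log_sum:
  fixes a b :: "'i \<Rightarrow> real"
  assumes fin: "finite I" and a: "\<And>i. i \<in> I \<Longrightarrow> 0 \<le> a i" and b: "\<And>i. i \<in> I \<Longrightarrow> a i \<le> b i"
  shows "(\<Sum>i\<in>I. a i * ln (b i / a i)) \<le> (\<Sum>i\<in>I. a i) * ln ((\<Sum>i\<in>I. b i) / (\<Sum>i\<in>I. a i))"
proof -
  define A where "A = (\<Sum>i\<in>I. a i)"
  define B where "B = (\<Sum>i\<in>I. b i)"
  show ?thesis
  proof (cases "A = 0")
    case True
    then have "a i = 0" if "i \<in> I" for i using that fin a by (simp add: A_def sum_nonneg_eq_0_iff)
    then show ?thesis by simp
  next
    case False
    then have A: "A > 0" using a by (simp add: A_def sum_nonneg less_le)
    have "B \<ge> A" unfolding A_def B_def using b by (intro sum_mono)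
    then have B: "B > 0" using A by simp
    \<comment> \<open>The bound \<open>ln t <= t - 1\<close> at
      \<open>t = b i * A / (a i * B)\<close>; the correction terms add up to zero over
      \<open>I\<close>.\<close>
    have "a i * ln (b i / a i) \<le> a i * ln (B / A) + (b i * A / B - a i)" if i: "i \<in> I" for i
    proof (cases "a i = 0")
      case True then show ?thesis using A B b[OF i] by simp
    next
      case False
      then have ai: "a i > 0" and bi: "b i > 0" using a[OF i] b[OF i] by auto
      have "ln (b i / a i) - ln (B / A) = ln (b i * A / (a i * B))"
        using ai bi A B by (simp add: ln_div ln_mult)
      also have "\<dots> \<le> b i * A / (a i * B) - 1"
        using ai bi A B by (intro ln_le_minus_one) auto
      finally have "a i * (ln (b i / a i) - ln (B / A)) \<le> a i * (b i * A / (a i * B) - 1)"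
        using ai by (intro mult_left_mono) auto
      then show ?thesis using ai by (simp add: algebra_simps)
    qed
    then have "(\<Sum>i\<in>I. a i * ln (b i / a i)) \<le> (\<Sum>i\<in>I. a i * ln (B / A) + (b i * A / B - a i))"
      by (intro sum_mono)
    also have "\<dots> = A * ln (B / A) + (B * A / B - A)"
      by (simp add: sum.distrib sum_subtractf A_def B_def sum_distrib_right sum_divide_distrib)
    finally show ?thesis using B by (simp add: A_def[symmetric] B_def[symmetric])
  qed
qed

text \<open>Relative entropy dominates the squared Hellinger distance, by
  \<open>ln t <= t - 1\<close> at \<open>t = sqrt (Q / P)\<close>. The term \<open>P - Q\<close>
  cancels after summation over distributions of equal mass.\<close>

lemma hellinger_le_relative_entropy:
  fixes P Q :: real
  assumes "P \<ge> 0" "Q \<ge> 0" "P > 0 \<Longrightarrow> Q > 0"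
  shows "(sqrt P - sqrt Q)\<^sup>2 + P - Q \<le> P * ln (P / Q)"
proof (cases "P = 0")
  case False
  then have pos: "P > 0" "Q > 0" using assms by auto
  have "P * ln (P / Q) = - 2 * P * ln (sqrt (Q / P))"
    using pos by (simp add: ln_sqrt ln_div algebra_simps)
  also have "\<dots> \<ge> - 2 * P * (sqrt (Q / P) - 1)"
    using pos by (intro mult_left_mono_neg ln_le_minus_one) auto
  also have "- 2 * P * (sqrt (Q / P) - 1) = (sqrt P - sqrt Q)\<^sup>2 + P - Q"
  proof -
    have "P * sqrt (Q / P) = sqrt P * sqrt Q"
      using pos by (simp add: real_sqrt_divide field_simps)
    then show ?thesis using pos by (simp add: power2_diff algebra_simps)
  qed
  finally show ?thesis .
qed (use assms in simp)

section \<open>Entropy of the walk\<close>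

context involution_marked begin

lemma sum_shift:
  assumes "finite X" "X \<subseteq> carrier G" "w \<in> carrier G" "supp (shift w f) \<subseteq> X"
    and h: "\<And>x. x \<in> carrier G \<Longrightarrow> f x = 0 \<Longrightarrow> h x = 0"
  shows "(\<Sum>x\<in>X. h (x \<otimes> w)) = (\<Sum>x\<in>supp f. h x)"
proof -
  have "(\<Sum>x\<in>X. h (x \<otimes> w)) = (\<Sum>x\<in>supp (shift w f). h (x \<otimes> w))"
    using assms by (intro sum.mono_neutral_right) (auto simp: supp_def shift_def)
  also have "\<dots> = (\<Sum>x\<in>supp f. h x)"
    by (rule sum.reindex_bij_witness[where i = "\<lambda>x. x \<otimes> inv w" and j = "\<lambda>x. x \<otimes> w"])
       (use assms in \<open>auto simp: supp_def shift_def m_assoc\<close>)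
  finally show ?thesis .
qed

definition mass :: "nat \<Rightarrow> 'a \<Rightarrow> real" where
  "mass n = (\<lambda>x. walk n (dirac \<one>) x / real deg ^ n)"

text \<open>At \<open>x\<close> the operator counts the words leading from \<open>x\<close> to
  \<open>\<one>\<close>; reversing them gives the words with product \<open>x\<close>.\<close>

lemma mass_eq: assumes "x \<in> carrier G"
  shows "mass n x = real (card {w \<in> words S n. wprod G w = x}) / real deg ^ n"
proof -
  have "walk n (dirac \<one>) x = (\<Sum>w\<in>words S n. dirac \<one> (x \<otimes> wprod G (rev w)))"
    unfolding walk_def by (rule sum_words_rev[symmetric])
  also have "\<dots> = (\<Sum>w\<in>words S n. if wprod G w = x then 1 else 0)"
  proof (intro sum.cong refl)
    fix w assume w: "w \<in> words S n"
    have "x \<otimes> inv (wprod G w) = \<one> \<longleftrightarrow> wprod G w = x"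
      using assms words_closed[OF w] by (metis inv_closed inv_equality inv_inv r_inv)
    then show "dirac \<one> (x \<otimes> wprod G (rev w)) = (if wprod G w = x then 1 else 0)"
      using w by (auto simp: dirac_def inv_wprod[symmetric])
  qed
  also have "\<dots> = real (card {w \<in> words S n. wprod G w = x})"
    by (subst sum.inter_filter[symmetric]) auto
  finally show ?thesis by (simp add: mass_def)
qed

lemma mass_nonneg: "mass n x \<ge> 0"
  by (simp add: mass_def walk_def dirac_def sum_nonneg)

lemma finite_supp_mass: "finite (supp (mass n))"
proof -
  have "supp (mass n) = supp (walk n (dirac \<one>))" using deg_pos by (auto simp: supp_def mass_def)
  then show ?thesis by (simp add: finite_supp_walk supp_dirac)
qed

lemma mass_add: assumes "x \<in> carrier G" shows "mass (n + m) x = walk n (mass m) x / real deg ^ n"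
proof -
  have "walk n (mass m) x = walk n (walk m (dirac \<one>)) x / real deg ^ m"
    by (simp add: mass_def walk_def sum_divide_distrib)
  then show ?thesis using assms by (simp add: mass_def walk_walk power_add)
qed

lemma sum_mass: "(\<Sum>x\<in>supp (mass n). mass n x) = 1"
proof (induction n)
  case 0
  have "supp (mass 0) = {\<one>}" by (auto simp: supp_def mass_def walk_def dirac_def)
  then show ?case by (simp add: mass_def walk_def dirac_def)
next
  case (Suc n)
  define X where "X = (\<Union>w\<in>words S 1. supp (shift (wprod G w) (mass n))) \<union> supp (mass (Suc n))"
  have X: "finite X" "X \<subseteq> carrier G"
    using finite_supp_mass supp_closed by (auto simp: X_def intro!: finite_supp_shift words_closed)
  have "(\<Sum>x\<in>supp (mass (Suc n)). mass (Suc n) x) = (\<Sum>x\<in>X. mass (Suc n) x)"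
    using X by (intro sum.mono_neutral_left) (auto simp: X_def supp_def)
  also have "\<dots> = (\<Sum>x\<in>X. (\<Sum>w\<in>words S 1. mass n (x \<otimes> wprod G w)) / real deg)"
    using X mass_add[of _ 1 n] by (intro sum.cong) (auto simp: walk_def)
  also have "\<dots> = (\<Sum>w\<in>words S 1. \<Sum>x\<in>X. mass n (x \<otimes> wprod G w)) / real deg"
    by (subst sum.swap) (simp add: sum_divide_distrib)
  also have "\<dots> = (\<Sum>w\<in>words S 1. 1) / real deg"
  proof (intro arg_cong2[where f = "(/)"] sum.cong refl)
    fix w assume w: "w \<in> words S 1"
    have "(\<Sum>x\<in>X. mass n (x \<otimes> wprod G w)) = (\<Sum>x\<in>supp (mass n). mass n x)"
      using w X words_closed by (intro sum_shift) (auto simp: X_def)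
    then show "(\<Sum>x\<in>X. mass n (x \<otimes> wprod G w)) = 1" using Suc by simp
  qed
  also have "\<dots> = 1" using deg_pos by (simp add: card_words[OF fin_S])
  finally show ?case .
qed

text \<open>An unordered edge may be listed from its other end; the same involution then leads
  back.\<close>

lemma neighbours: assumes "g \<in> carrier G"
  shows "{h. {g, h} \<in> cayley_edges G S} = (\<lambda>s. g \<otimes> s) ` S"
proof (intro equalityI subsetI)
  fix h assume "h \<in> {h. {g, h} \<in> cayley_edges G S}"
  then obtain g' s where gs: "g' \<in> carrier G" "s \<in> S" "{g, h} = {g', g' \<otimes> s}"
    by (auto simp: cayley_edges_def)
  have "g' \<otimes> s \<otimes> s = g'"
    using gs S_closed by (subst m_assoc) (auto simp: S_involution)
  then have "g' \<in> (\<lambda>t. g' \<otimes> s \<otimes> t) ` S" using gs by (metis image_eqI)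
  then show "h \<in> (\<lambda>s. g \<otimes> s) ` S" using gs by (auto simp: doubleton_eq_iff)
qed (use assms in \<open>auto simp: cayley_edges_def\<close>)

lemma inj_mult: "g \<in> carrier G \<Longrightarrow> inj_on (\<lambda>s. g \<otimes> s) S"
  using S_closed by (intro inj_onI) (auto simp: subset_eq)

text \<open>The walk is defined by a uniform choice among neighbouring vertices, while the sums here
  run over generators. The two agree because distinct generators lead to distinct
  neighbours.\<close>

lemma pmf_walk:
  "pmf (walk_pmf G S n) x = (if x \<in> carrier G then mass n x else 0)"
proof (induction n arbitrary: x)
  case 0
  then show ?case by (auto simp: mass_def walk_def dirac_def)
next
  case (Suc n)
  let ?P = "walk_pmf G S n"
  let ?N = "\<lambda>g. {h. {g, h} \<in> cayley_edges G S}"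
  have sub: "set_pmf ?P \<subseteq> carrier G" using Suc by (auto simp: set_pmf_eq)
  have N: "pmf (pmf_of_set (?N g)) x = indicator ((\<lambda>s. g \<otimes> s) ` S) x / real deg" if "g \<in> set_pmf ?P" for g
  proof -
    have g: "g \<in> carrier G" using that sub by auto
    show ?thesis unfolding neighbours[OF g]
      using fin_S S_nonempty inj_mult[OF g] by (subst pmf_of_set) (auto simp: card_image)
  qed
  have eq: "pmf (walk_pmf G S (Suc n)) x = (\<integral>g. indicator ((\<lambda>s. g \<otimes> s) ` S) x / real deg \<partial>measure_pmf ?P)"
    unfolding walk_pmf.simps pmf_bind by (intro integral_cong_AE) (auto simp: AE_measure_pmf_iff N)
  show ?case
  proof (cases "x \<in> carrier G")
    case False
    have "indicator ((\<lambda>s. g \<otimes> s) ` S) x = (0::real)" if "g \<in> set_pmf ?P" for g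
      using that sub S_closed False by (auto simp: indicator_def)
    then have "pmf (walk_pmf G S (Suc n)) x = (\<integral>g. 0 \<partial>measure_pmf ?P)"
      unfolding eq by (intro integral_cong_AE) (auto simp: AE_measure_pmf_iff)
    then show ?thesis using False by simp
  next
    case x: True
    have "pmf (walk_pmf G S (Suc n)) x = (\<Sum>g\<in>(\<lambda>s. x \<otimes> s) ` S. indicator ((\<lambda>s. g \<otimes> s) ` S) x / real deg * pmf ?P g)"
      unfolding eq
    proof (rule integral_measure_pmf_real)
      show "finite ((\<lambda>s. x \<otimes> s) ` S)" using fin_S by simp
      fix g assume g: "g \<in> set_pmf ?P" "indicator ((\<lambda>s. g \<otimes> s) ` S) x / real deg \<noteq> 0"
      then obtain s where s: "s \<in> S" "x = g \<otimes> s" by (auto simp: indicator_def split: if_splits)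
      then have "x \<otimes> s = g" using g sub S_closed by (subst s(2), subst m_assoc) (auto simp: S_involution)
      then show "g \<in> (\<lambda>s. x \<otimes> s) ` S" using s by (metis image_eqI)
    qed
    also have "\<dots> = (\<Sum>s\<in>S. indicator ((\<lambda>t. x \<otimes> s \<otimes> t) ` S) x / real deg * pmf ?P (x \<otimes> s))"
      using inj_mult[OF x] by (simp add: sum.reindex)
    also have "\<dots> = (\<Sum>s\<in>S. mass n (x \<otimes> s) / real deg)"
    proof (intro sum.cong refl)
      fix s assume s: "s \<in> S"
      then have sc: "s \<in> carrier G" using S_closed by auto
      have "x = x \<otimes> s \<otimes> s" using s sc x by (simp add: m_assoc S_involution)
      then have "x \<in> (\<lambda>t. x \<otimes> s \<otimes> t) ` S" using s by auto
      then show "indicator ((\<lambda>t. x \<otimes> s \<otimes> t) ` S) x / real deg * pmf ?P (x \<otimes> s) = mass n (x \<otimes> s) / real deg"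
        using x sc by (simp add: Suc)
    qed
    also have "\<dots> = mass (Suc n) x"
    proof -
      have "mass (Suc n) x = walk 1 (mass n) x / real deg" using x mass_add[of x 1 n] by simp
      then show ?thesis using S_closed x by (simp add: walk_def sum_words_Suc[where S = S and n = 0, simplified] sum_divide_distrib subset_eq)
    qed
    finally show ?thesis using x by simp
  qed
qed

definition ent :: "('a \<Rightarrow> real) \<Rightarrow> real" where
  "ent f = - (\<Sum>x\<in>supp f. f x * ln (f x))"

lemma shannon_entropy_walk: "shannon_entropy (walk_pmf G S n) = ent (mass n)"
proof -
  have "set_pmf (walk_pmf G S n) = supp (mass n)"
    by (auto simp: set_pmf_eq pmf_walk supp_def)
  then show ?thesis
    unfolding shannon_entropy_def ent_def using finite_supp_mass
    by (simp add: pmf_walk) (intro sum.cong refl, auto simp: supp_def)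
qed

lemma mass_le_1: assumes "x \<in> carrier G" shows "mass n x \<le> 1"
proof (cases "x \<in> supp (mass n)")
  case True
  then have "mass n x \<le> (\<Sum>x\<in>supp (mass n). mass n x)"
    using finite_supp_mass mass_nonneg by (intro member_le_sum) auto
  then show ?thesis by (simp add: sum_mass)
qed (use assms in \<open>simp add: supp_def\<close>)

lemma ent_mass_nonneg: "ent (mass n) \<ge> 0"
proof -
  have "(\<Sum>x\<in>supp (mass n). mass n x * ln (mass n x)) \<le> 0"
  proof (intro sum_nonpos)
    fix x assume "x \<in> supp (mass n)"
    then have "mass n x > 0" "mass n x \<le> 1"
      using mass_nonneg[of n x] mass_le_1 by (auto simp: supp_def)
    then show "mass n x * ln (mass n x) \<le> 0" by (simp add: mult_nonneg_nonpos)
  qed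
  then show ?thesis by (simp add: ent_def)
qed

text \<open>Here \<open>x \<otimes> y\<close> stands where a convolution has \<open>x\<close> times
  the inverse of \<open>y\<close>; the law of the walk is invariant under inversion.\<close>

lemma mass_convolution: assumes "x \<in> carrier G"
  shows "mass (n + m) x = (\<Sum>y\<in>supp (mass n). mass n y * mass m (x \<otimes> y))"
proof -
  let ?p = "wprod G ` words S n"
  have "walk n (mass m) x = (\<Sum>y\<in>?p. \<Sum>w\<in>{w \<in> words S n. wprod G w = y}. mass m (x \<otimes> wprod G w))"
    unfolding walk_def by (rule sum.image_gen) simp
  also have "\<dots> = (\<Sum>y\<in>?p. real (card {w \<in> words S n. wprod G w = y}) * mass m (x \<otimes> y))"
    by (intro sum.cong refl) simp
  finally have "mass (n + m) x = (\<Sum>y\<in>?p. mass n y * mass m (x \<otimes> y))"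
    using assms words_closed by (subst mass_add) (auto simp: mass_eq sum_divide_distrib intro!: sum.cong)
  also have "\<dots> = (\<Sum>y\<in>supp (mass n). mass n y * mass m (x \<otimes> y))"
  proof (rule sum.mono_neutral_right)
    show "supp (mass n) \<subseteq> ?p"
    proof
      fix y assume "y \<in> supp (mass n)"
      then have "{w \<in> words S n. wprod G w = y} \<noteq> {}"
        by (auto simp: supp_def mass_eq)
      then show "y \<in> ?p" by auto
    qed
  qed (use words_closed in \<open>auto simp: supp_def\<close>)
  finally show ?thesis .
qed

text \<open>The product of two independent elements is a function of the pair: each summand of the
  convolution is at most \<open>mass (n + m) x\<close>, so logarithms can be compared summand by
  summand.\<close>

lemma ent_subadditive: "ent (mass (n + m)) \<le> ent (mass n) + ent (mass m)"
proof -
  define X where "X = (\<Union>y\<in>supp (mass n). supp (shift y (mass m))) \<union> supp (mass (n + m))"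
  have sc: "y \<in> carrier G" if "y \<in> supp (mass n)" for y using that by (simp add: supp_def)
  have X: "finite X" "X \<subseteq> carrier G"
    unfolding X_def using finite_supp_mass supp_closed by (auto intro!: finite_supp_shift intro: sc)
  have Z: "(\<Sum>x\<in>X. h (x \<otimes> y)) = (\<Sum>x\<in>supp (mass m). h x)"
    if "y \<in> supp (mass n)" "\<And>x. x \<in> carrier G \<Longrightarrow> mass m x = 0 \<Longrightarrow> h x = 0" for y and h :: "'a \<Rightarrow> real"
    using that X sc by (intro sum_shift) (auto simp: X_def)
  have "(\<Sum>x\<in>supp (mass (n + m)). mass (n + m) x * ln (mass (n + m) x)) = (\<Sum>x\<in>X. mass (n + m) x * ln (mass (n + m) x))"
    using X by (intro sum.mono_neutral_left) (auto simp: X_def supp_def)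
  also have "\<dots> = (\<Sum>x\<in>X. \<Sum>y\<in>supp (mass n). mass n y * mass m (x \<otimes> y) * ln (mass (n + m) x))"
  proof (rule sum.cong[OF refl])
    fix x assume "x \<in> X"
    then have "x \<in> carrier G" using X by auto
    from mass_convolution[OF this, of n m]
    show "mass (n + m) x * ln (mass (n + m) x) = (\<Sum>y\<in>supp (mass n). mass n y * mass m (x \<otimes> y) * ln (mass (n + m) x))"
      by (simp add: sum_distrib_right)
  qed
  also have "\<dots> \<ge> (\<Sum>x\<in>X. \<Sum>y\<in>supp (mass n). mass n y * mass m (x \<otimes> y) * (ln (mass n y) + ln (mass m (x \<otimes> y))))"
  proof (intro sum_mono)
    fix x y assume x: "x \<in> X" and y: "y \<in> supp (mass n)"
    show "mass n y * mass m (x \<otimes> y) * (ln (mass n y) + ln (mass m (x \<otimes> y)))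
        \<le> mass n y * mass m (x \<otimes> y) * ln (mass (n + m) x)"
    proof (cases "mass m (x \<otimes> y) = 0")
      case False
      then have pos: "mass m (x \<otimes> y) > 0" "mass n y > 0"
        using mass_nonneg[of m "x \<otimes> y"] mass_nonneg[of n y] y by (auto simp: supp_def)
      have "mass n y * mass m (x \<otimes> y) \<le> mass (n + m) x"
        using x X y finite_supp_mass mass_nonneg
        by (subst mass_convolution) (auto intro!: member_le_sum[of y _ "\<lambda>y. mass n y * mass m (x \<otimes> y)"])
      then have "ln (mass n y * mass m (x \<otimes> y)) \<le> ln (mass (n + m) x)"
        using pos by (subst ln_le_cancel_iff) (auto intro: less_le_trans[OF mult_pos_pos])
      then show ?thesis using pos by (intro mult_left_mono) (auto simp: ln_mult)
    qed simp
  qed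
  also have "(\<Sum>x\<in>X. \<Sum>y\<in>supp (mass n). mass n y * mass m (x \<otimes> y) * (ln (mass n y) + ln (mass m (x \<otimes> y))))
     = (\<Sum>y\<in>supp (mass n). mass n y * ln (mass n y) * (\<Sum>x\<in>X. mass m (x \<otimes> y))
          + mass n y * (\<Sum>x\<in>X. mass m (x \<otimes> y) * ln (mass m (x \<otimes> y))))"
    by (subst sum.swap) (simp add: algebra_simps sum.distrib sum_distrib_left)
  also have "\<dots> = (\<Sum>y\<in>supp (mass n). mass n y * ln (mass n y) + mass n y * (- ent (mass m)))"
    using Z[of _ "mass m"] Z[of _ "\<lambda>x. mass m x * ln (mass m x)"]
    by (intro sum.cong refl) (simp add: sum_mass ent_def)
  also have "\<dots> = - ent (mass n) - ent (mass m)"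
    by (simp add: sum.distrib sum_mass ent_def sum_negf flip: sum_distrib_right)
  finally show ?thesis by (simp add: ent_def)
qed

lemma asymptotic_entropy_LIMSEQ:
  "(\<lambda>n. ent (mass n) / real n) \<longlonglongrightarrow> asymptotic_entropy G S"
  unfolding asymptotic_entropy_def shannon_entropy_walk
  using subadditive_convergent[of "\<lambda>n. ent (mass n)"] ent_subadditive ent_mass_nonneg
  by (simp add: convergent_LIMSEQ_iff)

end

section \<open>Conditional entropy over the fibres of a covering\<close>

context involution_covering begin

definition push :: "('a \<Rightarrow> real) \<Rightarrow> 'c \<Rightarrow> real" where
  "push f y = (\<Sum>x\<in>{x\<in>G.supp f. \<pi> x = y}. f x)"

text \<open>The entropy of a point conditioned on its image under \<open>\<pi>\<close>. It is
  homogeneous of degree one in \<open>f\<close>, so the unnormalised \<open>walk\<close> can be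
  inserted.\<close>

definition gain :: "('a \<Rightarrow> real) \<Rightarrow> real" where
  "gain f = (\<Sum>x\<in>G.supp f. f x * ln (push f (\<pi> x) / f x))"

lemma push_eq:
  assumes "finite X" "G.supp f \<subseteq> X" "X \<subseteq> carrier G"
  shows "push f y = (\<Sum>x\<in>{x\<in>X. \<pi> x = y}. f x)"
  unfolding push_def using assms by (intro sum.mono_neutral_left) (auto simp: G.supp_def)

lemma push_mass: assumes y: "y \<in> carrier G'" shows "push (G.mass n) y = G'.mass n y"
proof -
  let ?p = "wprod G ` words S n"
  let ?C = "\<lambda>x. {w \<in> words S n. wprod G w = x}"
  have p: "finite ?p" "?p \<subseteq> carrier G" using G.words_closed by auto
  have sub: "G.supp (G.mass n) \<subseteq> ?p"
  proof
    fix x assume "x \<in> G.supp (G.mass n)"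
    then have "?C x \<noteq> {}" by (auto simp: G.supp_def G.mass_eq)
    then show "x \<in> ?p" by auto
  qed
  have "push (G.mass n) y = (\<Sum>x\<in>{x\<in>?p. \<pi> x = y}. real (card (?C x)) / real (card S) ^ n)"
    unfolding push_eq[OF p(1) sub p(2)] using p(2) by (intro sum.cong refl G.mass_eq) auto
  also have "\<dots> = (\<Sum>x\<in>{x\<in>?p. \<pi> x = y}. real (card (?C x))) / real (card S) ^ n"
    by (simp add: sum_divide_distrib)
  also have "(\<Sum>x\<in>{x\<in>?p. \<pi> x = y}. real (card (?C x))) = real (card (\<Union>x\<in>{x\<in>?p. \<pi> x = y}. ?C x))"
    using p(1) by (subst card_UN_disjoint) auto
  also have "(\<Union>x\<in>{x\<in>?p. \<pi> x = y}. ?C x) = {w \<in> words S n. \<pi> (wprod G w) = y}"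
    by auto
  also have "real (card {w \<in> words S n. \<pi> (wprod G w) = y}) = (\<Sum>w\<in>words S n. if wprod G' (map \<pi> w) = y then 1 else 0)"
    by (subst sum.inter_filter[symmetric]) (auto simp: hom_wprod intro!: arg_cong[where f = card])
  also have "\<dots> = (\<Sum>w\<in>words S' n. if wprod G' w = y then 1 else 0)"
    by (rule sum_words_covering[symmetric])
  also have "\<dots> = real (card {w \<in> words S' n. wprod G' w = y})"
    by (subst sum.inter_filter[symmetric]) auto
  finally show ?thesis using y by (simp add: G'.mass_eq card_S')
qed

text \<open>The chain rule: entropy is the entropy of the image plus the entropy conditioned on the
  image.\<close>

lemma gain_mass: "gain (G.mass n) = G.ent (G.mass n) - G'.ent (G'.mass n)"
proof -
  let ?m = "G.mass n"
  let ?X = "G.supp ?m"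
  have X: "finite ?X" by (rule G.finite_supp_mass)
  have pos: "?m x > 0" if "x \<in> ?X" for x using that G.mass_nonneg[of n x] by (auto simp: G.supp_def)
  have ge: "push ?m (\<pi> x) \<ge> ?m x" if "x \<in> ?X" for x
    unfolding push_def using that X G.mass_nonneg by (intro member_le_sum) auto
  have "gain ?m = (\<Sum>x\<in>?X. ?m x * ln (push ?m (\<pi> x)) - ?m x * ln (?m x))"
    unfolding gain_def
  proof (intro sum.cong refl)
    fix x assume "x \<in> ?X"
    then show "?m x * ln (push ?m (\<pi> x) / ?m x) = ?m x * ln (push ?m (\<pi> x)) - ?m x * ln (?m x)"
      using pos[of x] ge[of x] by (simp add: ln_div algebra_simps)
  qed
  also have "\<dots> = (\<Sum>x\<in>?X. ?m x * ln (push ?m (\<pi> x))) + G.ent ?m"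
    by (simp add: sum_subtractf G.ent_def)
  also have "(\<Sum>x\<in>?X. ?m x * ln (push ?m (\<pi> x))) = (\<Sum>y\<in>\<pi> ` ?X. \<Sum>x\<in>{x\<in>?X. \<pi> x = y}. ?m x * ln (push ?m (\<pi> x)))"
    using X by (rule sum.image_gen)
  also have "\<dots> = (\<Sum>y\<in>\<pi> ` ?X. push ?m y * ln (push ?m y))"
    by (intro sum.cong refl) (simp add: push_def sum_distrib_right)
  also have "\<dots> = (\<Sum>y\<in>\<pi> ` ?X. G'.mass n y * ln (G'.mass n y))"
    by (intro sum.cong refl) (auto simp: push_mass G.supp_def)
  also have "\<dots> = - G'.ent (G'.mass n)"
    unfolding G'.ent_def minus_minus
  proof (rule sum.mono_neutral_right)
    show "finite (\<pi> ` ?X)" using X by simp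
    show "G'.supp (G'.mass n) \<subseteq> \<pi> ` ?X"
    proof
      fix y assume y: "y \<in> G'.supp (G'.mass n)"
      then have "push ?m y \<noteq> 0" by (auto simp: push_mass G'.supp_def)
      then have "{x\<in>?X. \<pi> x = y} \<noteq> {}" unfolding push_def by (metis (no_types, lifting) sum.empty)
      then show "y \<in> \<pi> ` ?X" by auto
    qed
  qed (auto simp: G'.supp_def G.supp_def)
  finally show ?thesis by simp
qed

lemma push_walk:
  assumes fs: "finite (G.supp f)" and y: "y \<in> carrier G'"
  shows "push (G.walk k f) y = (\<Sum>w\<in>words S k. push f (y \<otimes>\<^bsub>G'\<^esub> \<pi> (wprod G w)))"
proof -
  define X where "X = (\<Union>w\<in>words S k. G.supp (G.shift (wprod G w) f))"
  have X: "finite X" "X \<subseteq> carrier G"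
    unfolding X_def using fs G.supp_closed by (auto intro!: G.finite_supp_shift G.words_closed)
  have sub: "G.supp (G.walk k f) \<subseteq> X" unfolding X_def G.walk_shift by (rule G.supp_sum)
  have "push (G.walk k f) y = (\<Sum>x\<in>{x\<in>X. \<pi> x = y}. \<Sum>w\<in>words S k. f (x \<otimes>\<^bsub>G\<^esub> wprod G w))"
    unfolding push_eq[OF X(1) sub X(2)] by (simp add: G.walk_def)
  also have "\<dots> = (\<Sum>w\<in>words S k. \<Sum>x\<in>{x\<in>X. \<pi> x = y}. f (x \<otimes>\<^bsub>G\<^esub> wprod G w))"
    by (rule sum.swap)
  also have "\<dots> = (\<Sum>w\<in>words S k. push f (y \<otimes>\<^bsub>G'\<^esub> \<pi> (wprod G w)))"
  proof (intro sum.cong refl)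
    fix w assume w: "w \<in> words S k"
    let ?u = "wprod G w"
    have u: "?u \<in> carrier G" by (rule G.words_closed[OF w])
    have "(\<Sum>x\<in>{x\<in>X. \<pi> x = y}. f (x \<otimes>\<^bsub>G\<^esub> ?u))
        = (\<Sum>x\<in>X. (if \<pi> (x \<otimes>\<^bsub>G\<^esub> ?u) = y \<otimes>\<^bsub>G'\<^esub> \<pi> ?u then f (x \<otimes>\<^bsub>G\<^esub> ?u) else 0))"
      using X u y by (simp add: sum.inter_filter) (intro sum.cong refl, auto)
    also have "\<dots> = (\<Sum>x\<in>G.supp f. if \<pi> x = y \<otimes>\<^bsub>G'\<^esub> \<pi> ?u then f x else 0)"
      using X u w by (intro G.sum_shift[where h = "\<lambda>x. if \<pi> x = y \<otimes>\<^bsub>G'\<^esub> \<pi> ?u then f x else 0"]) (auto simp: X_def)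
    also have "\<dots> = push f (y \<otimes>\<^bsub>G'\<^esub> \<pi> ?u)"
      unfolding push_def using fs by (simp add: sum.inter_filter)
    finally show "(\<Sum>x\<in>{x\<in>X. \<pi> x = y}. f (x \<otimes>\<^bsub>G\<^esub> ?u)) = push f (y \<otimes>\<^bsub>G'\<^esub> \<pi> ?u)" .
  qed
  finally show ?thesis .
qed

text \<open>The function \<open>walk k f\<close> is a sum of shifts of \<open>f\<close>, each with
  the gain of \<open>f\<close>, and conditional entropy is concave; this gives the main term. The
  three shifts by \<open>Z\<close> are merged first. They have the same image, so merging raises the
  gain by their unnormalised Jensen-Shannon divergence, which ping-pong keeps away from
  zero.\<close>

lemma gain_walk:
  assumes Z: "Z \<subseteq> words S k" "card Z = 3" and disj: "disjoint_family_on E Z"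
    and ker: "\<And>z. z \<in> Z \<Longrightarrow> \<pi> (wprod G z) = \<one>\<^bsub>G'\<^esub>"
    and pp: "\<And>z g. z \<in> Z \<Longrightarrow> g \<in> carrier G \<Longrightarrow> g \<notin> E z \<Longrightarrow> g \<otimes>\<^bsub>G\<^esub> wprod G z \<in> E z"
    and fs: "finite (G.supp f)" and nonneg: "\<And>x. f x \<ge> 0" and total: "(\<Sum>x\<in>G.supp f. f x) = 1"
  shows "real (card S) ^ k * gain f + 1/6 \<le> gain (G.walk k f)"
proof -
  let ?W = "words S k"
  let ?u = "wprod G"
  have finW: "finite ?W" by simp
  have finZ: "finite Z" using Z(2) by (metis card.infinite zero_neq_numeral)
  have uc: "?u w \<in> carrier G" if "w \<in> ?W" for w using that by (rule G.words_closed)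
  have zc: "?u z \<in> carrier G" if "z \<in> Z" for z using that Z uc by auto
  define X where "X = (\<Union>w\<in>?W. G.supp (G.shift (?u w) f))"
  have X: "finite X" "X \<subseteq> carrier G"
    unfolding X_def using fs G.supp_closed by (auto intro!: G.finite_supp_shift uc)
  have X_sum: "(\<Sum>x\<in>X. h (x \<otimes>\<^bsub>G\<^esub> ?u w)) = (\<Sum>x\<in>G.supp f. h x)"
    if "w \<in> ?W" "\<And>x. x \<in> carrier G \<Longrightarrow> f x = 0 \<Longrightarrow> h x = 0" for w and h :: "'a \<Rightarrow> real"
    using that X uc by (intro G.sum_shift) (auto simp: X_def)
  define a where "a x w = f (x \<otimes>\<^bsub>G\<^esub> ?u w)" for x w
  define b where "b x w = push f (\<pi> (x \<otimes>\<^bsub>G\<^esub> ?u w))" for x w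
  have push_ge: "f x \<le> push f (\<pi> x)" if "x \<in> carrier G" for x
  proof (cases "f x = 0")
    case True then show ?thesis using nonneg by (simp add: push_def sum_nonneg)
  next
    case False
    then have "x \<in> {y \<in> G.supp f. \<pi> y = \<pi> x}" using that by (simp add: G.supp_def)
    then show ?thesis unfolding push_def using fs nonneg by (intro member_le_sum) auto
  qed
  have a0: "0 \<le> a x w" for x w by (simp add: a_def nonneg)
  have ab: "a x w \<le> b x w" if "x \<in> X" "w \<in> ?W" for x w
    unfolding a_def b_def using that X uc by (intro push_ge) auto
  define s where "s x = (\<Sum>z\<in>Z. a x z)" for x
  define Q where "Q x = s x / 3" for x
  have s0: "s x \<ge> 0" for x by (simp add: s_def sum_nonneg a0)
  have bz: "b x z = push f (\<pi> x)" if "x \<in> X" "z \<in> Z" for x z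
  proof -
    have "x \<in> carrier G" using that X by auto
    then show ?thesis using that zc ker by (simp add: b_def)
  qed
  have walk_a: "G.walk k f x = (\<Sum>w\<in>?W - Z. a x w) + s x" for x
    unfolding G.walk_def a_def s_def by (rule sum.subset_diff[OF Z(1) finW])
  have walk_b: "push (G.walk k f) (\<pi> x) = (\<Sum>w\<in>?W - Z. b x w) + (\<Sum>z\<in>Z. b x z)" if "x \<in> X" for x
  proof -
    have "push (G.walk k f) (\<pi> x) = (\<Sum>w\<in>?W. b x w)"
      using that X uc by (subst push_walk[OF fs]) (auto simp: b_def intro!: sum.cong)
    then show ?thesis using sum.subset_diff[OF Z(1) finW] by metis
  qed
  have "(\<Sum>x\<in>X. (\<Sum>w\<in>?W - Z. a x w * ln (b x w / a x w)) + s x * ln ((\<Sum>z\<in>Z. b x z) / s x))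
      \<le> (\<Sum>x\<in>X. G.walk k f x * ln (push (G.walk k f) (\<pi> x) / G.walk k f x))"
  proof (intro sum_mono)
    fix x assume x: "x \<in> X"
    \<comment> \<open>The log-sum inequality is applied at each point to the words outside
      \<open>Z\<close> and one further index, \<open>None\<close>, for the three words of
      \<open>Z\<close> together.\<close>
    define aa where "aa i = (case i of None \<Rightarrow> s x | Some w \<Rightarrow> a x w)" for i
    define bb where "bb i = (case i of None \<Rightarrow> (\<Sum>z\<in>Z. b x z) | Some w \<Rightarrow> b x w)" for i
    let ?I = "insert None (Some ` (?W - Z))"
    have split: "(\<Sum>i\<in>?I. h i) = (\<Sum>w\<in>?W - Z. h (Some w)) + h None" for h :: "_ \<Rightarrow> real"
      by (subst sum.insert) (auto simp: sum.reindex)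
    have "(\<Sum>i\<in>?I. aa i * ln (bb i / aa i)) \<le> (\<Sum>i\<in>?I. aa i) * ln ((\<Sum>i\<in>?I. bb i) / (\<Sum>i\<in>?I. aa i))"
    proof (rule log_sum)
      show "finite ?I" by simp
      fix i assume "i \<in> ?I"
      then show "0 \<le> aa i" "aa i \<le> bb i"
        using a0 ab[OF x] s0 subsetD[OF Z(1)] by (auto simp: aa_def bb_def s_def intro!: sum_mono)
    qed
    then show "(\<Sum>w\<in>?W - Z. a x w * ln (b x w / a x w)) + s x * ln ((\<Sum>z\<in>Z. b x z) / s x)
        \<le> G.walk k f x * ln (push (G.walk k f) (\<pi> x) / G.walk k f x)"
      unfolding split using walk_a walk_b[OF x] by (simp add: aa_def bb_def)
  qed
  also have "\<dots> = gain (G.walk k f)"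
    unfolding gain_def
  proof (rule sum.mono_neutral_right)
    show "G.supp (G.walk k f) \<subseteq> X" unfolding X_def G.walk_shift by (rule G.supp_sum)
  qed (use X in \<open>auto simp: G.supp_def\<close>)
  finally have step: "(\<Sum>w\<in>?W - Z. \<Sum>x\<in>X. a x w * ln (b x w / a x w)) + (\<Sum>x\<in>X. s x * ln ((\<Sum>z\<in>Z. b x z) / s x))
      \<le> gain (G.walk k f)"
    by (subst sum.swap) (simp add: sum.distrib)
  have gain_w: "(\<Sum>x\<in>X. a x w * ln (b x w / a x w)) = gain f" if "w \<in> ?W" for w
    unfolding a_def b_def gain_def
    using that by (intro X_sum[where h = "\<lambda>x. f x * ln (push f (\<pi> x) / f x)"]) auto
  \<comment> \<open>On \<open>Z\<close> all \<open>b x z\<close> are equal, so the merged term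
    exceeds the separate ones exactly by the relative entropy of the shifts with respect to their
    mean \<open>Q\<close>.\<close>
  have star: "s x * ln ((\<Sum>z\<in>Z. b x z) / s x) = (\<Sum>z\<in>Z. a x z * ln (b x z / a x z)) + (\<Sum>z\<in>Z. a x z * ln (a x z / Q x))"
    if x: "x \<in> X" for x
  proof -
    have xc: "x \<in> carrier G" using x X by auto
    have "a x z * ln ((\<Sum>z\<in>Z. b x z) / s x) = a x z * ln (b x z / a x z) + a x z * ln (a x z / Q x)"
      if z: "z \<in> Z" for z
    proof (cases "a x z = 0")
      case False
      then have az: "a x z > 0" using a0[of x z] by simp
      have "a x z \<le> s x" unfolding s_def using z finZ a0 by (intro member_le_sum) auto
      then have sx: "s x > 0" using az by simp
      have pz: "push f (\<pi> x) > 0" using ab[OF x, of z] z Z az bz[OF x z] by auto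
      have "(\<Sum>z\<in>Z. b x z) = 3 * push f (\<pi> x)" using bz[OF x] Z(2) by simp
      then show ?thesis using az sx pz bz[OF x z]
        by (simp add: Q_def ln_div ln_mult algebra_simps)
    qed simp
    then have "(\<Sum>z\<in>Z. a x z * ln ((\<Sum>z\<in>Z. b x z) / s x)) = (\<Sum>z\<in>Z. a x z * ln (b x z / a x z) + a x z * ln (a x z / Q x))"
      by (intro sum.cong) auto
    then show ?thesis by (simp add: sum.distrib flip: sum_distrib_right s_def)
  qed
  have massz: "(\<Sum>x\<in>X. a x z) = 1" if "z \<in> Z" for z
    unfolding a_def total[symmetric] using that Z by (intro X_sum) auto
  \<comment> \<open>The constants are those of \<open>pingpong_ip\<close>, with square roots of
    densities in the role of functions: \<open>3 - 1 <= 3/2 + 3 * H\<close> gives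
    \<open>H >= 1/6\<close>.\<close>
  have K: "1/6 \<le> (\<Sum>x\<in>X. \<Sum>z\<in>Z. a x z * ln (a x z / Q x))"
  proof -
    have Q0: "Q x \<ge> 0" for x using s0 by (simp add: Q_def)
    have aQ: "Q x > 0" if "a x z > 0" "z \<in> Z" for x z
    proof -
      have "a x z \<le> s x" unfolding s_def using that finZ a0 by (intro member_le_sum) auto
      then show ?thesis using that by (simp add: Q_def)
    qed
    define H where "H = (\<Sum>x\<in>X. \<Sum>z\<in>Z. (sqrt (a x z) - sqrt (Q x))\<^sup>2)"
    have "H = (\<Sum>x\<in>X. \<Sum>z\<in>Z. (sqrt (a x z) - sqrt (Q x))\<^sup>2 + a x z - Q x)"
      unfolding H_def by (rule sum.cong[OF refl]) (simp add: sum.distrib sum_subtractf Q_def s_def Z(2))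
    also have "\<dots> \<le> (\<Sum>x\<in>X. \<Sum>z\<in>Z. a x z * ln (a x z / Q x))"
      using a0 Q0 aQ by (intro sum_mono hellinger_le_relative_entropy) auto
    finally have H_le: "H \<le> (\<Sum>x\<in>X. \<Sum>z\<in>Z. a x z * ln (a x z / Q x))" .
    have sumQ: "(\<Sum>x\<in>X. Q x) = 1"
    proof -
      have "(\<Sum>x\<in>X. s x) = (\<Sum>z\<in>Z. \<Sum>x\<in>X. a x z)" unfolding s_def by (rule sum.swap)
      also have "\<dots> = 3" using massz Z(2) by simp
      finally show ?thesis by (simp add: Q_def flip: sum_divide_distrib)
    qed
    \<comment> \<open>What the shift by \<open>z\<close> leaves outside \<open>E z\<close> comes
      from the mass of \<open>f\<close> inside \<open>E z\<close>.\<close>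
    have lower: "1 - (\<Sum>x\<in>G.supp f \<inter> E z. f x) \<le> (\<Sum>x\<in>X \<inter> E z. a x z)" if z: "z \<in> Z" for z
    proof -
      have "(\<Sum>x\<in>X - E z. a x z) = (\<Sum>x\<in>X. if x \<notin> E z then a x z else 0)"
        using X by (simp add: sum.inter_filter[symmetric] set_diff_eq)
      also have "\<dots> \<le> (\<Sum>x\<in>X. if x \<otimes>\<^bsub>G\<^esub> ?u z \<in> E z then f (x \<otimes>\<^bsub>G\<^esub> ?u z) else 0)"
        using pp[OF z] X nonneg by (intro sum_mono) (auto simp: a_def)
      also have "\<dots> = (\<Sum>x\<in>G.supp f. if x \<in> E z then f x else 0)"
        using z Z by (intro X_sum[where h = "\<lambda>x. if x \<in> E z then f x else 0"]) auto
      also have "\<dots> = (\<Sum>x\<in>G.supp f \<inter> E z. f x)"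
        using fs by (simp add: sum.inter_restrict)
      finally have "(\<Sum>x\<in>X - E z. a x z) \<le> (\<Sum>x\<in>G.supp f \<inter> E z. f x)" .
      moreover have "(\<Sum>x\<in>X. a x z) = (\<Sum>x\<in>X \<inter> E z. a x z) + (\<Sum>x\<in>X - E z. a x z)"
        using X by (intro sum.Int_Diff)
      ultimately show ?thesis using massz[OF z] by simp
    qed
    have upper: "(\<Sum>x\<in>X \<inter> E z. a x z) \<le> 3/2 * (\<Sum>x\<in>X \<inter> E z. Q x) + 3 * (\<Sum>x\<in>X. (sqrt (a x z) - sqrt (Q x))\<^sup>2)" for z
    proof -
      have "(\<Sum>x\<in>X \<inter> E z. a x z) \<le> (\<Sum>x\<in>X \<inter> E z. 3/2 * Q x + 3 * (sqrt (a x z) - sqrt (Q x))\<^sup>2)"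
      proof (intro sum_mono)
        fix x
        define p where "p = sqrt (a x z)"
        define q where "q = sqrt (Q x)"
        have "3/2 * q\<^sup>2 + 3 * (p - q)\<^sup>2 - p\<^sup>2 = (2 * p - 3 * q)\<^sup>2 / 2"
          by (simp add: power2_eq_square field_simps)
        moreover have "(2 * p - 3 * q)\<^sup>2 / 2 \<ge> 0" by simp
        moreover have "a x z = p\<^sup>2" "Q x = q\<^sup>2" using a0 Q0 by (simp_all add: p_def q_def)
        ultimately show "a x z \<le> 3/2 * Q x + 3 * (sqrt (a x z) - sqrt (Q x))\<^sup>2"
          unfolding p_def[symmetric] q_def[symmetric] by linarith
      qed
      also have "\<dots> = 3/2 * (\<Sum>x\<in>X \<inter> E z. Q x) + 3 * (\<Sum>x\<in>X \<inter> E z. (sqrt (a x z) - sqrt (Q x))\<^sup>2)"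
        by (simp add: sum.distrib sum_distrib_left)
      also have "(\<Sum>x\<in>X \<inter> E z. (sqrt (a x z) - sqrt (Q x))\<^sup>2) \<le> (\<Sum>x\<in>X. (sqrt (a x z) - sqrt (Q x))\<^sup>2)"
        using X by (intro sum_mono2) auto
      finally show ?thesis by simp
    qed
    have disjoint_sum: "(\<Sum>z\<in>Z. \<Sum>x\<in>Y \<inter> E z. g x) \<le> (\<Sum>x\<in>Y. g x)"
      if "finite Y" "\<And>x. g x \<ge> 0" for Y and g :: "'a \<Rightarrow> real"
    proof -
      have "(\<Sum>z\<in>Z. \<Sum>x\<in>Y \<inter> E z. g x) = (\<Sum>x\<in>(\<Union>z\<in>Z. Y \<inter> E z). g x)"
        using finZ that disj by (intro sum.UNION_disjoint[symmetric]) (auto simp: disjoint_family_on_def)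
      also have "\<dots> \<le> (\<Sum>x\<in>Y. g x)" using that by (intro sum_mono2) auto
      finally show ?thesis .
    qed
    have "(\<Sum>z\<in>Z. 1 - (\<Sum>x\<in>G.supp f \<inter> E z. f x))
       \<le> (\<Sum>z\<in>Z. 3/2 * (\<Sum>x\<in>X \<inter> E z. Q x) + 3 * (\<Sum>x\<in>X. (sqrt (a x z) - sqrt (Q x))\<^sup>2))"
      by (rule sum_mono) (rule order_trans[OF lower upper])
    also have "\<dots> = 3/2 * (\<Sum>z\<in>Z. \<Sum>x\<in>X \<inter> E z. Q x) + 3 * H"
      unfolding H_def by (subst sum.swap[of _ Z X]) (simp add: sum.distrib sum_distrib_left)
    also have "\<dots> \<le> 3/2 * 1 + 3 * H"
      using disjoint_sum[of X Q] X Q0 sumQ by simp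
    finally have "3 - (\<Sum>z\<in>Z. \<Sum>x\<in>G.supp f \<inter> E z. f x) \<le> 3/2 + 3 * H"
      using Z(2) by (simp add: sum_subtractf)
    moreover have "(\<Sum>z\<in>Z. \<Sum>x\<in>G.supp f \<inter> E z. f x) \<le> 1"
      using disjoint_sum[of "G.supp f" f] fs nonneg total by simp
    ultimately show ?thesis using H_le by simp
  qed
  have "(\<Sum>x\<in>X. s x * ln ((\<Sum>z\<in>Z. b x z) / s x))
      = (\<Sum>z\<in>Z. \<Sum>x\<in>X. a x z * ln (b x z / a x z)) + (\<Sum>x\<in>X. \<Sum>z\<in>Z. a x z * ln (a x z / Q x))"
    by (subst sum.swap) (simp add: star sum.distrib)
  moreover have "(\<Sum>w\<in>?W - Z. \<Sum>x\<in>X. a x w * ln (b x w / a x w)) + (\<Sum>z\<in>Z. \<Sum>x\<in>X. a x z * ln (b x z / a x z))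
      = (\<Sum>w\<in>?W. \<Sum>x\<in>X. a x w * ln (b x w / a x w))"
    by (rule sum.subset_diff[OF Z(1) finW, symmetric])
  moreover have "\<dots> = real (card S) ^ k * gain f"
    using gain_w by (simp add: card_words G.fin_S)
  ultimately show ?thesis using step K by linarith
qed

lemma push_scale: "c \<noteq> 0 \<Longrightarrow> push (\<lambda>x. f x / c) y = push f y / c"
  by (simp add: push_def G.supp_def sum_divide_distrib)

lemma gain_scale: assumes "c \<noteq> 0" shows "gain (\<lambda>x. f x / c) = gain f / c"
  using assms by (simp add: gain_def push_scale G.supp_def sum_divide_distrib)

lemma gain_cong: assumes "\<And>x. x \<in> carrier G \<Longrightarrow> f x = g x" shows "gain f = gain g"
proof -
  have s: "G.supp f = G.supp g" using assms by (auto simp: G.supp_def)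
  have p: "push f y = push g y" for y
    unfolding push_def s using assms by (intro sum.cong) (auto simp: G.supp_def)
  show ?thesis unfolding gain_def s p using assms by (intro sum.cong) (auto simp: G.supp_def)
qed

lemma asymptotic_entropy_strict:
  assumes Z: "Z \<subseteq> words S k" "card Z = 3" "k > 0" and disj: "disjoint_family_on E Z"
    and ker: "\<And>z. z \<in> Z \<Longrightarrow> \<pi> (wprod G z) = \<one>\<^bsub>G'\<^esub>"
    and pp: "\<And>z g. z \<in> Z \<Longrightarrow> g \<in> carrier G \<Longrightarrow> g \<notin> E z \<Longrightarrow> g \<otimes>\<^bsub>G\<^esub> wprod G z \<in> E z"
  shows "asymptotic_entropy G' S' < asymptotic_entropy G S"
proof -
  \<comment> \<open>The increment 1/6 of \<open>gain_walk\<close>, divided by the number of words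
    because \<open>mass\<close> is normalised.\<close>
  define c where "c = 1 / (6 * real (card S) ^ k)"
  have d: "real (card S) ^ k > 0" using G.deg_pos by simp
  have step: "gain (G.mass n) + c \<le> gain (G.mass (k + n))" for n
  proof -
    have "gain (G.mass (k + n)) = gain (G.walk k (G.mass n)) / real (card S) ^ k"
    proof -
      have "gain (G.mass (k + n)) = gain (\<lambda>x. G.walk k (G.mass n) x / real (card S) ^ k)"
        by (rule gain_cong) (rule G.mass_add)
      then show ?thesis using d by (simp add: gain_scale)
    qed
    moreover have "real (card S) ^ k * gain (G.mass n) + 1/6 \<le> gain (G.walk k (G.mass n))"
      by (rule gain_walk[OF Z(1,2) disj ker pp G.finite_supp_mass G.mass_nonneg G.sum_mass])
    ultimately show ?thesis using d by (simp add: c_def field_simps)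
  qed
  have gain_ge: "real j * c + gain (G.mass 0) \<le> gain (G.mass (k * j))" for j
  proof (induction j)
    case (Suc j)
    then show ?case using step[of "k * j"] by (simp add: algebra_simps)
  qed simp
  have "gain (G.mass 0) = 0"
  proof -
    have "G.supp (G.mass 0) = {\<one>\<^bsub>G\<^esub>}" by (auto simp: G.supp_def G.mass_def G.walk_def G.dirac_def)
    moreover have "{x. x = \<one>\<^bsub>G\<^esub> \<and> \<pi> x = \<one>\<^bsub>G'\<^esub>} = {\<one>\<^bsub>G\<^esub>}" by auto
    ultimately show ?thesis by (simp add: gain_def push_def)
  qed
  then have diff: "real j * c \<le> G.ent (G.mass (k * j)) - G'.ent (G'.mass (k * j))" for j
    using gain_ge[of j] by (simp add: gain_mass)
  have sm: "strict_mono (\<lambda>j. k * j)" using Z(3) by (simp add: strict_mono_def)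
  have "(\<lambda>j. G.ent (G.mass (k * j)) / real (k * j) - G'.ent (G'.mass (k * j)) / real (k * j))
      \<longlonglongrightarrow> asymptotic_entropy G S - asymptotic_entropy G' S'"
    using LIMSEQ_subseq_LIMSEQ[OF G.asymptotic_entropy_LIMSEQ sm]
      LIMSEQ_subseq_LIMSEQ[OF G'.asymptotic_entropy_LIMSEQ sm]
    by (intro tendsto_diff) (simp_all add: o_def)
  moreover have "\<forall>\<^sub>F j in sequentially. c / real k \<le> G.ent (G.mass (k * j)) / real (k * j) - G'.ent (G'.mass (k * j)) / real (k * j)"
  proof (rule eventually_sequentiallyI[of 1])
    fix j :: nat assume "j \<ge> 1"
    then show "c / real k \<le> G.ent (G.mass (k * j)) / real (k * j) - G'.ent (G'.mass (k * j)) / real (k * j)"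
      using diff[of j] Z(3) by (simp add: field_simps)
  qed
  ultimately have "c / real k \<le> asymptotic_entropy G S - asymptotic_entropy G' S'"
    by (intro tendsto_lowerbound[where F = sequentially]) auto
  moreover have "c / real k > 0" using d Z(3) by (simp add: c_def)
  ultimately show ?thesis by simp
qed

end

section \<open>Percolation on finite index sets\<close>

text \<open>Expectation over a random subset of a finite set, each index being kept with probability
  \<open>p\<close>. The percolation estimates are made in these finite sums;
  \<open>bernoulli_cylinder\<close> identifies them with the product measure.\<close>

definition rexp :: "real \<Rightarrow> 'i set \<Rightarrow> ('i set \<Rightarrow> real) \<Rightarrow> real" where
  "rexp p F g = (\<Sum>A\<in>Pow F. p ^ card A * (1 - p) ^ card (F - A) * g A)"

abbreviation rprob :: "real \<Rightarrow> 'i set \<Rightarrow> ('i set \<Rightarrow> bool) \<Rightarrow> real" where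
  "rprob p F Q \<equiv> rexp p F (\<lambda>A. of_bool (Q A))"

lemma rexp_empty [simp]: "rexp p {} g = g {}"
  by (simp add: rexp_def)

lemma rexp_insert:
  assumes "finite F" "i \<notin> F"
  shows "rexp p (insert i F) g = p * rexp p F (\<lambda>A. g (insert i A)) + (1 - p) * rexp p F g"
proof -
  have inj: "inj_on (insert i) (Pow F)"
    using assms by (auto simp: inj_on_def)
  have fin: "finite A" if "A \<in> Pow F" for A using that assms finite_subset by auto
  have "rexp p (insert i F) g = (\<Sum>A\<in>Pow F. p ^ card A * (1 - p) ^ card (insert i F - A) * g A)
     + (\<Sum>A\<in>Pow F. p ^ card (insert i A) * (1 - p) ^ card (insert i F - insert i A) * g (insert i A))"
    unfolding rexp_def Pow_insert using assms inj
    by (subst sum.union_disjoint) (auto simp: sum.reindex)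
  also have "(\<Sum>A\<in>Pow F. p ^ card A * (1 - p) ^ card (insert i F - A) * g A) = (1 - p) * rexp p F g"
    unfolding rexp_def sum_distrib_left
  proof (intro sum.cong refl)
    fix A assume A: "A \<in> Pow F"
    then have "insert i F - A = insert i (F - A)" using assms by auto
    then have "card (insert i F - A) = Suc (card (F - A))" using assms A by auto
    then show "p ^ card A * (1 - p) ^ card (insert i F - A) * g A = (1 - p) * (p ^ card A * (1 - p) ^ card (F - A) * g A)"
      by simp
  qed
  also have "(\<Sum>A\<in>Pow F. p ^ card (insert i A) * (1 - p) ^ card (insert i F - insert i A) * g (insert i A))
     = p * rexp p F (\<lambda>A. g (insert i A))"
    unfolding rexp_def sum_distrib_left
  proof (intro sum.cong refl)
    fix A assume A: "A \<in> Pow F"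
    have "insert i F - insert i A = F - A" using A assms by auto
    moreover have "i \<notin> A" using A assms by auto
    ultimately show "p ^ card (insert i A) * (1 - p) ^ card (insert i F - insert i A) * g (insert i A)
      = p * (p ^ card A * (1 - p) ^ card (F - A) * g (insert i A))"
      using fin[OF A] by simp
  qed
  finally show ?thesis by simp
qed

lemma rexp_cong: "(\<And>A. A \<subseteq> F \<Longrightarrow> g A = h A) \<Longrightarrow> rexp p F g = rexp p F h"
  unfolding rexp_def by (intro sum.cong) auto

lemma rexp_mono:
  assumes "0 \<le> p" "p \<le> 1" "\<And>A. A \<subseteq> F \<Longrightarrow> g A \<le> h A"
  shows "rexp p F g \<le> rexp p F h"
  unfolding rexp_def using assms by (intro sum_mono mult_left_mono) auto

lemma rexp_sum: "rexp p F (\<lambda>A. \<Sum>i\<in>I. g i A) = (\<Sum>i\<in>I. rexp p F (g i))"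
  unfolding rexp_def by (subst sum.swap) (simp add: sum_distrib_left)

lemma rexp_add: "rexp p F (\<lambda>A. g A + h A) = rexp p F g + rexp p F h"
  by (simp add: rexp_def algebra_simps sum.distrib)

lemma rexp_diff: "rexp p F (\<lambda>A. g A - h A) = rexp p F g - rexp p F h"
  by (simp add: rexp_def algebra_simps sum_subtractf)

lemma rexp_cmult: "rexp p F (\<lambda>A. c * g A) = c * rexp p F g"
  by (simp add: rexp_def sum_distrib_left mult_ac)

lemma rexp_const [simp]: "finite F \<Longrightarrow> rexp p F (\<lambda>A. c) = c"
  by (induction F rule: finite_induct) (simp_all add: rexp_insert algebra_simps)

lemma rexp_nonneg: "0 \<le> p \<Longrightarrow> p \<le> 1 \<Longrightarrow> (\<And>A. A \<subseteq> F \<Longrightarrow> 0 \<le> g A) \<Longrightarrow> 0 \<le> rexp p F g"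
  unfolding rexp_def by (intro sum_nonneg mult_nonneg_nonneg) auto

lemma rexp_union:
  assumes "finite F" "finite H" "F \<inter> H = {}"
  shows "rexp p (F \<union> H) g = rexp p F (\<lambda>A. rexp p H (\<lambda>B. g (A \<union> B)))"
  using assms
  by (induction F arbitrary: g rule: finite_induct) (simp_all add: rexp_insert)

lemma rexp_product:
  assumes "finite F" "finite H" "F \<inter> H = {}"
  shows "rexp p (F \<union> H) (\<lambda>A. g (A \<inter> F) * h (A \<inter> H)) = rexp p F g * rexp p H h"
proof -
  have "rexp p (F \<union> H) (\<lambda>A. g (A \<inter> F) * h (A \<inter> H)) = rexp p F (\<lambda>A. rexp p H (\<lambda>B. g A * h B))"
    unfolding rexp_union[OF assms]
  proof (intro rexp_cong)
    fix A B assume "A \<subseteq> F" "B \<subseteq> H"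
    then have "(A \<union> B) \<inter> F = A" "(A \<union> B) \<inter> H = B" using assms by auto
    then show "g ((A \<union> B) \<inter> F) * h ((A \<union> B) \<inter> H) = g A * h B" by simp
  qed
  also have "\<dots> = rexp p F g * rexp p H h"
    by (simp add: rexp_cmult mult.commute[of _ "rexp p H h"])
  finally show ?thesis .
qed

lemma rexp_restrict:
  assumes "finite F" "H \<subseteq> F"
  shows "rexp p F (\<lambda>A. g (A \<inter> H)) = rexp p H g"
proof -
  have "rexp p (H \<union> (F - H)) (\<lambda>A. g (A \<inter> H) * 1) = rexp p H g * rexp p (F - H) (\<lambda>_. 1)"
    using assms finite_subset by (intro rexp_product[where h = "\<lambda>_. 1"]) auto
  moreover have "H \<union> (F - H) = F" using assms by auto
  ultimately show ?thesis using assms by simp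
qed

lemma rexp_mono_set:
  assumes "finite F" "H \<subseteq> F" "0 \<le> p" "p \<le> 1" "\<And>A B. A \<subseteq> B \<Longrightarrow> B \<subseteq> F \<Longrightarrow> g A \<le> g B"
  shows "rexp p H g \<le> rexp p F g"
  unfolding rexp_restrict[OF assms(1,2), symmetric] using assms by (intro rexp_mono) auto

text \<open>An induction over the indices in place of a coupling: raising \<open>p\<close> moves
  weight from \<open>g A\<close> to the larger \<open>g (insert i A)\<close>.\<close>

lemma rexp_mono_prob:
  assumes "finite F" "0 \<le> p" "p \<le> q" "q \<le> 1" "\<And>A B. A \<subseteq> B \<Longrightarrow> B \<subseteq> F \<Longrightarrow> g A \<le> g B"
  shows "rexp p F g \<le> rexp q F g"
  using assms(1,5)
proof (induction F arbitrary: g rule: finite_induct)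
  case (insert i F)
  let ?g1 = "\<lambda>A. g (insert i A)"
  have m: "rexp p F ?g1 \<le> rexp q F ?g1" "rexp p F g \<le> rexp q F g"
    by (rule insert.IH, rule insert.prems; blast)+
  have le: "rexp q F g \<le> rexp q F ?g1"
  proof (rule rexp_mono)
    show "g A \<le> g (insert i A)" if "A \<subseteq> F" for A using that by (intro insert.prems) auto
  qed (use assms in auto)
  have "p * rexp p F ?g1 + (1 - p) * rexp p F g \<le> p * rexp q F ?g1 + (1 - p) * rexp q F g"
    using m assms by (intro add_mono mult_left_mono) auto
  also have "\<dots> = rexp q F g + p * (rexp q F ?g1 - rexp q F g)" by (simp add: algebra_simps)
  also have "\<dots> \<le> rexp q F g + q * (rexp q F ?g1 - rexp q F g)"
    using le assms by (intro add_left_mono mult_right_mono) auto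
  finally show ?case using insert.hyps by (simp add: rexp_insert algebra_simps)
qed simp

lemma rexp_image:
  assumes "finite F" "inj_on f F"
  shows "rexp p (f ` F) g = rexp p F (\<lambda>A. g (f ` A))"
  using assms
  by (induction F arbitrary: g rule: finite_induct) (auto simp: rexp_insert)

lemma rprob_superset:
  assumes "finite F" "K \<subseteq> F"
  shows "rprob p F (\<lambda>A. K \<subseteq> A) = p ^ card K"
proof -
  have "rprob p K (\<lambda>A. K \<subseteq> A) = p ^ card K"
  proof -
    have "rprob p K (\<lambda>A. K \<subseteq> A) = (\<Sum>A\<in>Pow K. if A = K then p ^ card K else 0)"
      unfolding rexp_def by (intro sum.cong) auto
    then show ?thesis using assms finite_subset[of K F] by (simp add: sum.delta)
  qed
  moreover have "rprob p F (\<lambda>A. K \<subseteq> A) = rprob p F (\<lambda>A. K \<subseteq> A \<inter> K)"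
    by (intro rexp_cong) auto
  ultimately show ?thesis using rexp_restrict[OF assms, of p "\<lambda>A. of_bool (K \<subseteq> A)"] by simp
qed

lemma isCont_rexp: "finite F \<Longrightarrow> isCont (\<lambda>p. rexp p F g) x"
  unfolding rexp_def by (intro continuous_intros)

text \<open>The index of the random variable that decides whether a step from \<open>x\<close> to \<open>y\<close> is allowed:
  the edge in bond percolation, the target vertex (as a singleton) in site percolation.\<close>

definition step_ix :: "bool \<Rightarrow> 'a \<Rightarrow> 'a \<Rightarrow> 'a set" where
  "step_ix bond x y = (if bond then {x, y} else {y})"

lemma step_ix_target: "y \<in> step_ix b x y"
  and step_ix_eqD: "step_ix b x y = step_ix b x' y' \<Longrightarrow> y' \<in> {x, y}"
  and step_ix_image: "f ` step_ix b x y = step_ix b (f x) (f y)"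
  and finite_step_ix: "finite (step_ix b x y)"
  by (auto simp: step_ix_def split: if_splits)

section \<open>Clusters inside one coset\<close>

context involution_marked begin

definition open_step :: "bool \<Rightarrow> 'a set set \<Rightarrow> ('a \<times> 'a) set" where
  "open_step b A = {(x, x \<otimes> s) | x s. x \<in> carrier G \<and> s \<in> S \<and> step_ix b x (x \<otimes> s) \<in> A}"

text \<open>The starting points count as reached whatever the state of their own sites; whether the
  root is open is a separate condition.\<close>

definition reach :: "bool \<Rightarrow> 'a set \<Rightarrow> 'a set set \<Rightarrow> 'a set" where
  "reach b C A = (open_step b A)\<^sup>* `` C"

text \<open>The singleton of \<open>\<one>\<close> is left out because a walk from \<open>\<one>\<close> never needs it.\<close>

definition indices :: "bool \<Rightarrow> 'a set set" where
  "indices b = {step_ix b x (x \<otimes> s) | x s. x \<in> carrier G \<and> s \<in> S} - {{\<one>}}"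

lemma reach_mono: "A \<subseteq> B \<Longrightarrow> reach b C A \<subseteq> reach b C B"
proof -
  assume "A \<subseteq> B"
  then have "open_step b A \<subseteq> open_step b B" by (auto simp: open_step_def)
  then show ?thesis unfolding reach_def by (intro Image_mono rtrancl_mono) auto
qed

lemma reach_start: "C \<subseteq> reach b C A"
  by (auto simp: reach_def)

lemma reach_step: "x \<in> reach b C A \<Longrightarrow> x \<in> carrier G \<Longrightarrow> s \<in> S \<Longrightarrow> step_ix b x (x \<otimes> s) \<in> A \<Longrightarrow> x \<otimes> s \<in> reach b C A"
  unfolding reach_def open_step_def by (blast intro: rtrancl_into_rtrancl)

lemma reach_least:
  assumes "C \<subseteq> R" "\<And>x s. x \<in> R \<Longrightarrow> x \<in> carrier G \<Longrightarrow> s \<in> S \<Longrightarrow> step_ix b x (x \<otimes> s) \<in> A \<Longrightarrow> x \<otimes> s \<in> R"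
  shows "reach b C A \<subseteq> R"
proof
  fix y assume "y \<in> reach b C A"
  then obtain x where x: "x \<in> C" "(x, y) \<in> (open_step b A)\<^sup>*" by (auto simp: reach_def)
  from x(2) show "y \<in> R"
    by (induction rule: rtrancl_induct) (use x(1) assms in \<open>auto simp: open_step_def\<close>)
qed

lemma reach_closed: "C \<subseteq> carrier G \<Longrightarrow> reach b C A \<subseteq> carrier G"
  using S_closed by (intro reach_least) auto

lemma reach_subset: "reach b C A \<subseteq> C \<union> \<Union> A"
  by (intro reach_least) (auto intro: step_ix_target)

lemma finite_reach: assumes "finite C" "finite A" "\<And>a. a \<in> A \<Longrightarrow> finite a" shows "finite (reach b C A)"
  by (rule finite_subset[OF reach_subset]) (use assms in auto)

lemma finite_indices: "a \<in> indices b \<Longrightarrow> finite a"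
  by (auto simp: indices_def finite_step_ix)

lemma finite_reach_one: "finite J \<Longrightarrow> J \<subseteq> indices b \<Longrightarrow> A \<subseteq> J \<Longrightarrow> finite (reach b {\<one>} A)"
  using finite_indices by (intro finite_reach) (auto intro: finite_subset)

text \<open>The expected number of vertices other than the entry point when only indices in
  \<open>J\<close> can be open. The entry point is left out because its step to the other factor
  leads back out of the coset.\<close>

definition chi :: "bool \<Rightarrow> real \<Rightarrow> 'a set set \<Rightarrow> real" where
  "chi b p J = rexp p J (\<lambda>A. real (card (reach b {\<one>} A - {\<one>})))"

definition supercritical :: "bool \<Rightarrow> real \<Rightarrow> bool" where
  "supercritical b p \<longleftrightarrow> (\<exists>J. finite J \<and> J \<subseteq> indices b \<and> 1 < p * chi b p J)"

text \<open>This is not the negation of \<open>supercritical\<close>: the borderline value 1 belongs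
  to neither. The gap, uniform in \<open>J\<close>, gives the convergent geometric series in
  \<open>subcritical_cluster_bound\<close>.\<close>

definition subcritical :: "bool \<Rightarrow> real \<Rightarrow> bool" where
  "subcritical b p \<longleftrightarrow> (\<exists>c<1. \<forall>J. finite J \<longrightarrow> J \<subseteq> indices b \<longrightarrow> p * chi b p J \<le> c)"

lemma card_reach_mono:
  assumes "finite J" "J \<subseteq> indices b" "A \<subseteq> B" "B \<subseteq> J"
  shows "real (card (reach b {\<one>} A - {\<one>})) \<le> real (card (reach b {\<one>} B - {\<one>}))"
proof -
  have "reach b {\<one>} A - {\<one>} \<subseteq> reach b {\<one>} B - {\<one>}" using reach_mono[OF assms(3)] by auto
  then show ?thesis using assms finite_reach_one[of J b B] by (simp add: card_mono)
qed

lemma chi_mono_set: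
  assumes "finite J" "J \<subseteq> indices b" "H \<subseteq> J" "0 \<le> p" "p \<le> 1"
  shows "chi b p H \<le> chi b p J"
  unfolding chi_def using assms card_reach_mono[OF assms(1,2)] by (intro rexp_mono_set) auto

lemma chi_mono_prob:
  assumes "finite J" "J \<subseteq> indices b" "0 \<le> p" "p \<le> q" "q \<le> 1"
  shows "chi b p J \<le> chi b q J"
  unfolding chi_def using assms card_reach_mono[OF assms(1,2)] by (intro rexp_mono_prob) auto

lemma chi_nonneg: "0 \<le> p \<Longrightarrow> p \<le> 1 \<Longrightarrow> 0 \<le> chi b p J"
  unfolding chi_def by (intro rexp_nonneg) auto

lemma supercritical_mono:
  assumes "supercritical b p" "0 \<le> p" "p \<le> q" "q \<le> 1" shows "supercritical b q"
proof -
  obtain J where J: "finite J" "J \<subseteq> indices b" "1 < p * chi b p J"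
    using assms by (auto simp: supercritical_def)
  have "p * chi b p J \<le> q * chi b q J"
    using J assms chi_mono_prob[of J b p q] chi_nonneg by (intro mult_mono) auto
  then show ?thesis using J by (auto simp: supercritical_def)
qed

lemma chi_eq_sum:
  assumes J: "finite J" "J \<subseteq> indices b" and Y: "finite Y" "\<Union> J \<subseteq> Y"
  shows "chi b p J = (\<Sum>y\<in>Y - {\<one>}. rprob p J (\<lambda>A. y \<in> reach b {\<one>} A))"
proof -
  have "real (card (reach b {\<one>} A - {\<one>})) = (\<Sum>y\<in>Y - {\<one>}. of_bool (y \<in> reach b {\<one>} A))" if "A \<subseteq> J" for A
  proof -
    have "reach b {\<one>} A - {\<one>} = {y \<in> Y - {\<one>}. y \<in> reach b {\<one>} A}"
      using reach_subset[of b "{\<one>}" A] that Y by auto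
    then show ?thesis using Y by (simp add: sum.If_cases Int_def of_bool_def)
  qed
  then show ?thesis unfolding chi_def rexp_sum[symmetric] by (rule rexp_cong)
qed

section \<open>Open paths and self-avoiding walks\<close>

fun path_ix :: "bool \<Rightarrow> 'a \<Rightarrow> 'a list \<Rightarrow> 'a set list" where
  "path_ix b x [] = []"
| "path_ix b x (s # w) = step_ix b x (x \<otimes> s) # path_ix b (x \<otimes> s) w"

lemma length_path_ix [simp]: "length (path_ix b x w) = length w"
  by (induction w arbitrary: x) auto

lemma path_ix_append:
  "x \<in> carrier G \<Longrightarrow> set u \<subseteq> S \<Longrightarrow> path_ix b x (u @ v) = path_ix b x u @ path_ix b (x \<otimes> wprod G u) v"
proof (induction u arbitrary: x)
  case (Cons s u)
  then have "s \<in> carrier G" "wprod G u \<in> carrier G" using S_closed by auto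
  then show ?case using Cons by (simp add: m_assoc)
qed simp

lemma path_ix_nth:
  assumes "x \<in> carrier G" "set w \<subseteq> S" "i < length w"
  shows "path_ix b x w ! i = step_ix b (x \<otimes> wprod G (take i w)) (x \<otimes> wprod G (take (Suc i) w))"
  using assms
proof (induction w arbitrary: x i)
  case (Cons s w)
  have s: "s \<in> carrier G" "set w \<subseteq> carrier G" using Cons.prems S_closed by auto
  have t: "wprod G (take j w) \<in> carrier G" for j using s by (intro wprod_closed) (meson set_take_subset subset_trans)
  show ?case
  proof (cases i)
    case 0 then show ?thesis using s Cons.prems by simp
  next
    case (Suc j)
    then show ?thesis using Cons.IH[of "x \<otimes> s" j] Cons.prems s t by (simp add: m_assoc)
  qed
qed simp

text \<open>The index \<open>{\<one>}\<close> is tolerated on the path because a step back to the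
  origin reaches nothing new.\<close>

lemma reach_path:
  assumes "set w \<subseteq> S" "set (path_ix b x w) \<subseteq> insert {\<one>} A" "x \<in> carrier G" "x \<in> reach b {\<one>} A"
  shows "x \<otimes> wprod G w \<in> reach b {\<one>} A"
  using assms
proof (induction w arbitrary: x)
  case (Cons s w)
  have s: "s \<in> carrier G" "wprod G w \<in> carrier G" using Cons.prems S_closed by auto
  have "x \<otimes> s \<in> reach b {\<one>} A"
  proof (cases "x \<otimes> s = \<one>")
    case True then show ?thesis using reach_start[of "{\<one>}"] by auto
  next
    case False
    then have "step_ix b x (x \<otimes> s) \<noteq> {\<one>}" using step_ix_target[of "x \<otimes> s" b x] by auto
    then show ?thesis using Cons.prems by (intro reach_step) auto
  qed
  then show ?case using Cons s by (simp add: m_assoc[symmetric])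
qed simp

lemma reach_imp_path:
  assumes "y \<in> reach b {\<one>} A"
  shows "\<exists>w. set w \<subseteq> S \<and> set (path_ix b \<one> w) \<subseteq> A \<and> y = wprod G w"
proof -
  let ?R = "{y. \<exists>w. set w \<subseteq> S \<and> set (path_ix b \<one> w) \<subseteq> A \<and> y = wprod G w}"
  have "reach b {\<one>} A \<subseteq> ?R"
  proof (rule reach_least)
    show "{\<one>} \<subseteq> ?R" by (auto intro!: exI[of _ "[]"])
    fix x s assume "x \<in> ?R" and s: "s \<in> S" "step_ix b x (x \<otimes> s) \<in> A"
    then obtain w where w: "set w \<subseteq> S" "set (path_ix b \<one> w) \<subseteq> A" "x = wprod G w" by auto
    have c: "wprod G w \<in> carrier G" "s \<in> carrier G" using w s S_closed by auto
    have "path_ix b \<one> (w @ [s]) = path_ix b \<one> w @ [step_ix b x (x \<otimes> s)]"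
      using w c by (simp add: path_ix_append)
    moreover have "wprod G (w @ [s]) = x \<otimes> s"
      using w(1)[THEN subset_trans[OF _ S_closed]] w(3) c by (simp add: wprod_append)
    ultimately show "x \<otimes> s \<in> ?R" using w s by (intro CollectI exI[of _ "w @ [s]"]) auto
  qed
  then show ?thesis using assms by auto
qed

definition self_avoiding :: "'a list \<Rightarrow> bool" where
  "self_avoiding w \<longleftrightarrow> set w \<subseteq> S \<and> inj_on (\<lambda>i. wprod G (take i w)) {..length w}"

text \<open>A shortest open word visits no vertex twice, since a loop could be cut out.\<close>

lemma reach_imp_self_avoiding:
  assumes "y \<in> reach b {\<one>} A"
  obtains w where "self_avoiding w" "set (path_ix b \<one> w) \<subseteq> A" "y = wprod G w"
proof -
  let ?P = "\<lambda>w. set w \<subseteq> S \<and> set (path_ix b \<one> w) \<subseteq> A \<and> y = wprod G w"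
  obtain w where w: "?P w" and min: "\<And>v. ?P v \<Longrightarrow> length w \<le> length v"
    using ex_has_least_nat[of ?P _ length] reach_imp_path[OF assms] by blast
  have no: False if ij: "i < j" "j \<le> length w" and eq: "wprod G (take i w) = wprod G (take j w)" for i j
  proof -
    let ?v = "take i w @ drop j w"
    have sub: "set (take i w) \<subseteq> S" "set (take j w) \<subseteq> S" "set (drop j w) \<subseteq> S"
      using w set_take_subset set_drop_subset by (metis subset_trans)+
    have "path_ix b \<one> w = path_ix b \<one> (take j w @ drop j w)" by simp
    also have "\<dots> = path_ix b \<one> (take j w) @ path_ix b (wprod G (take j w)) (drop j w)"
      using sub S_closed wprod_closed by (subst path_ix_append) auto
    finally have p1: "path_ix b \<one> w = path_ix b \<one> (take j w) @ path_ix b (wprod G (take j w)) (drop j w)" .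
    have "path_ix b \<one> (take j w) = path_ix b \<one> (take i w @ drop i (take j w))"
      using ij by (metis append_take_drop_id min.absorb1 order.strict_implies_order take_take)
    then have p2: "set (path_ix b \<one> (take i w)) \<subseteq> set (path_ix b \<one> (take j w))"
      using sub by (simp add: path_ix_append)
    have "path_ix b \<one> ?v = path_ix b \<one> (take i w) @ path_ix b (wprod G (take j w)) (drop j w)"
      using sub S_closed wprod_closed eq by (subst path_ix_append) auto
    then have "set (path_ix b \<one> ?v) \<subseteq> A" using p1 p2 w by auto
    moreover have "wprod G ?v = wprod G (take j w @ drop j w)"
      using sub[THEN subset_trans[OF _ S_closed]] by (simp only: wprod_append eq)
    ultimately have "?P ?v" using w sub by auto
    from min[OF this] show False using ij by simp
  qed
  have "inj_on (\<lambda>i. wprod G (take i w)) {..length w}"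
    using no by (intro inj_onI) (metis atMost_iff linorder_neqE_nat)
  then show ?thesis using that[of w] w by (auto simp: self_avoiding_def)
qed

text \<open>Distinct indices make the probability that a self-avoiding path of length
  \<open>k\<close> inside \<open>J\<close> is open exactly \<open>p ^ k\<close>.\<close>

lemma self_avoiding_distinct_ix: assumes "self_avoiding w" shows "distinct (path_ix b \<one> w)"
proof -
  let ?v = "\<lambda>i. wprod G (take i w)"
  have inj: "inj_on ?v {..length w}" and S: "set w \<subseteq> S" using assms by (auto simp: self_avoiding_def)
  have c: "?v i \<in> carrier G" for i using S S_closed by (intro wprod_closed) (meson set_take_subset subset_trans)
  have "path_ix b \<one> w ! i \<noteq> path_ix b \<one> w ! j" if ij: "i < j" "j < length w" for i j
  proof
    assume "path_ix b \<one> w ! i = path_ix b \<one> w ! j"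
    then have "step_ix b (?v i) (?v (Suc i)) = step_ix b (?v j) (?v (Suc j))"
      using ij S c by (simp add: path_ix_nth)
    then have "?v (Suc j) \<in> {?v i, ?v (Suc i)}" by (rule step_ix_eqD)
    then show False using ij inj_onD[OF inj, of "Suc j" i] inj_onD[OF inj, of "Suc j" "Suc i"] by auto
  qed
  then show ?thesis unfolding distinct_conv_nth by (metis length_path_ix linorder_neqE_nat)
qed

lemma self_avoiding_distinct_adj: assumes "self_avoiding w" shows "distinct_adj w"
proof -
  have inj: "inj_on (\<lambda>i. wprod G (take i w)) {..length w}" and S: "set w \<subseteq> S"
    using assms by (auto simp: self_avoiding_def)
  have "w ! i \<noteq> w ! Suc i" if i: "Suc i < length w" for i
  proof
    assume eq: "w ! i = w ! Suc i"
    have "w ! i \<in> set w" using i by simp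
    then have wi: "w ! i \<in> S" "w ! i \<in> carrier G" using S S_closed by auto
    have tc: "set (take i w) \<subseteq> carrier G" using S S_closed by (meson set_take_subset subset_trans)
    have "take (Suc (Suc i)) w = take i w @ [w ! i, w ! i]"
      using i eq by (simp add: take_Suc_conv_app_nth)
    then have "wprod G (take (Suc (Suc i)) w) = wprod G (take i w)"
      using tc wi by (simp add: wprod_append S_involution)
    then show False using inj_onD[OF inj, of "Suc (Suc i)" i] i by auto
  qed
  then show ?thesis by (simp add: distinct_adj_def successively_conv_nth)
qed

lemma card_distinct_adj_words:
  assumes "card S = 3" shows "card {w \<in> words S (Suc k). distinct_adj w} \<le> 3 * 2 ^ k"
proof (induction k)
  case 0
  have "card {w \<in> words S (Suc 0). distinct_adj w} \<le> card (words S (Suc 0))" by (intro card_mono) auto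
  then show ?case using assms by (simp add: card_words[OF fin_S])
next
  case (Suc k)
  let ?N = "{w \<in> words S (Suc k). distinct_adj w}"
  have sub: "{w \<in> words S (Suc (Suc k)). distinct_adj w} \<subseteq> (\<Union>w\<in>?N. (\<lambda>s. s # w) ` (S - {hd w}))"
  proof
    fix v assume v: "v \<in> {w \<in> words S (Suc (Suc k)). distinct_adj w}"
    then obtain s w where sw: "v = s # w" "length w = Suc k" by (auto simp: words_def length_Suc_conv)
    moreover have "w \<noteq> []" using sw by auto
    ultimately show "v \<in> (\<Union>w\<in>?N. (\<lambda>s. s # w) ` (S - {hd w}))"
      using v by (auto simp: words_def distinct_adj_Cons intro!: bexI[of _ w])
  qed
  have fin: "finite ?N" by simp
  have "card {w \<in> words S (Suc (Suc k)). distinct_adj w} \<le> card (\<Union>w\<in>?N. (\<lambda>s. s # w) ` (S - {hd w}))"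
    using fin fin_S by (intro card_mono sub) auto
  also have "\<dots> \<le> (\<Sum>w\<in>?N. card ((\<lambda>s. s # w) ` (S - {hd w})))"
    using fin by (rule card_UN_le)
  also have "\<dots> \<le> (\<Sum>w\<in>?N. 2)"
  proof (intro sum_mono)
    fix w assume w: "w \<in> ?N"
    then have "hd w \<in> S" by (cases w) (auto simp: words_def)
    then have "card (S - {hd w}) = 2" using assms fin_S by simp
    then show "card ((\<lambda>s. s # w) ` (S - {hd w})) \<le> 2" using card_image_le[of "S - {hd w}" "\<lambda>s. s # w"] fin_S by simp
  qed
  also have "\<dots> \<le> 3 * 2 ^ Suc k" using Suc by simp
  finally show ?case .
qed

definition near_ix :: "bool \<Rightarrow> nat \<Rightarrow> 'a set set" where
  "near_ix b N = (\<Union>k\<le>N. \<Union>w\<in>words S k. set (path_ix b \<one> w)) \<inter> indices b"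

lemma finite_near_ix: "finite (near_ix b N)" and near_ix_subset: "near_ix b N \<subseteq> indices b"
  by (auto simp: near_ix_def)

text \<open>A vertex not reached through near indices is the end of an open self-avoiding path
  longer than \<open>N\<close>. At most \<open>3 * 2 ^ (k - 1)\<close> words of length
  \<open>k\<close> avoid backtracking, which sums to the geometric tail. The tail does not depend on
  \<open>J\<close>, and this is what controls \<open>chi\<close> beyond the threshold.\<close>

lemma chi_le_near:
  assumes S3: "card S = 3" and J: "finite J" "J \<subseteq> indices b" and p: "0 \<le> p" "p < 1/2"
  shows "chi b p J \<le> chi b p (near_ix b N) + 3/2 * (2 * p) ^ Suc N / (1 - 2 * p)"
proof -
  \<comment> \<open>A self-avoiding path uses distinct indices of \<open>J\<close>, so its length is
    at most \<open>card J\<close> and the tail is a finite sum.\<close>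
  let ?K = "card J"
  let ?V = "\<lambda>k. {w \<in> words S k. distinct_adj w \<and> distinct (path_ix b \<one> w) \<and> set (path_ix b \<one> w) \<subseteq> J}"
  have card_le: "real (card (reach b {\<one>} A - {\<one>})) \<le> real (card (reach b {\<one>} (A \<inter> near_ix b N) - {\<one>}))
      + (\<Sum>k\<in>{Suc N..?K}. \<Sum>w\<in>?V k. of_bool (set (path_ix b \<one> w) \<subseteq> A))" if A: "A \<subseteq> J" for A
  proof -
    let ?O = "\<lambda>k. {w \<in> ?V k. set (path_ix b \<one> w) \<subseteq> A}"
    have finA: "finite (reach b {\<one>} (A \<inter> near_ix b N) - {\<one>})"
      using finite_reach_one[OF J, of "A \<inter> near_ix b N"] A by auto
    have finO: "finite (?O k)" for k by simp
    have "reach b {\<one>} A - {\<one>} \<subseteq> (reach b {\<one>} (A \<inter> near_ix b N) - {\<one>}) \<union> (\<Union>k\<in>{Suc N..?K}. wprod G ` ?O k)"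
    proof
      fix y assume y: "y \<in> reach b {\<one>} A - {\<one>}"
      then obtain w where w: "self_avoiding w" "set (path_ix b \<one> w) \<subseteq> A" "y = wprod G w"
        using reach_imp_self_avoiding by blast
      have S: "w \<in> words S (length w)" "set w \<subseteq> S" using w by (auto simp: self_avoiding_def words_def)
      show "y \<in> (reach b {\<one>} (A \<inter> near_ix b N) - {\<one>}) \<union> (\<Union>k\<in>{Suc N..?K}. wprod G ` ?O k)"
      proof (cases "length w \<le> N")
        case True
        then have "set (path_ix b \<one> w) \<subseteq> A \<inter> near_ix b N"
          using w A J S by (auto simp: near_ix_def)
        then have "\<one> \<otimes> wprod G w \<in> reach b {\<one>} (A \<inter> near_ix b N)"
          using S reach_start[of "{\<one>}"] by (intro reach_path) auto
        then show ?thesis using y w S_closed S by auto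
      next
        case False
        have "length w = card (set (path_ix b \<one> w))"
          using self_avoiding_distinct_ix[OF w(1), of b] distinct_card by fastforce
        also have "\<dots> \<le> ?K" using w A J by (intro card_mono) auto
        finally have "length w \<in> {Suc N..?K}" using False by simp
        moreover have "w \<in> ?O (length w)"
          using S w A self_avoiding_distinct_ix[OF w(1), of b] self_avoiding_distinct_adj[OF w(1)] by auto
        ultimately show ?thesis using w(3) by blast
      qed
    qed
    then have "card (reach b {\<one>} A - {\<one>}) \<le> card ((reach b {\<one>} (A \<inter> near_ix b N) - {\<one>}) \<union> (\<Union>k\<in>{Suc N..?K}. wprod G ` ?O k))"
      using finA finO by (intro card_mono) auto
    also have "\<dots> \<le> card (reach b {\<one>} (A \<inter> near_ix b N) - {\<one>}) + card (\<Union>k\<in>{Suc N..?K}. wprod G ` ?O k)"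
      by (rule card_Un_le)
    also have "card (\<Union>k\<in>{Suc N..?K}. wprod G ` ?O k) \<le> (\<Sum>k\<in>{Suc N..?K}. card (wprod G ` ?O k))"
      by (intro card_UN_le) auto
    also have "\<dots> \<le> (\<Sum>k\<in>{Suc N..?K}. card (?O k))"
      using finO by (intro sum_mono card_image_le)
    finally have "card (reach b {\<one>} A - {\<one>}) \<le> card (reach b {\<one>} (A \<inter> near_ix b N) - {\<one>}) + (\<Sum>k\<in>{Suc N..?K}. card (?O k))"
      by simp
    moreover have "real (card (?O k)) = (\<Sum>w\<in>?V k. of_bool (set (path_ix b \<one> w) \<subseteq> A))" for k
      by (simp add: of_bool_def sum.If_cases Int_def conj_ac)
    ultimately show ?thesis by (simp only: of_nat_add of_nat_sum flip: of_nat_le_iff[where 'a = real])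
  qed
  have "chi b p J \<le> rexp p J (\<lambda>A. real (card (reach b {\<one>} (A \<inter> near_ix b N) - {\<one>}))
      + (\<Sum>k\<in>{Suc N..?K}. \<Sum>w\<in>?V k. of_bool (set (path_ix b \<one> w) \<subseteq> A)))"
    unfolding chi_def using p card_le by (intro rexp_mono) auto
  also have "\<dots> = rexp p J (\<lambda>A. real (card (reach b {\<one>} (A \<inter> near_ix b N) - {\<one>})))
      + (\<Sum>k\<in>{Suc N..?K}. \<Sum>w\<in>?V k. rprob p J (\<lambda>A. set (path_ix b \<one> w) \<subseteq> A))"
    by (simp only: rexp_add rexp_sum)
  also have "rexp p J (\<lambda>A. real (card (reach b {\<one>} (A \<inter> near_ix b N) - {\<one>}))) \<le> chi b p (near_ix b N)"
  proof -
    have "rexp p J (\<lambda>A. real (card (reach b {\<one>} (A \<inter> near_ix b N) - {\<one>})))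
        = rexp p J (\<lambda>A. real (card (reach b {\<one>} (A \<inter> (J \<inter> near_ix b N)) - {\<one>})))"
      by (intro rexp_cong) (simp add: Int_absorb2 flip: Int_assoc)
    also have "\<dots> = chi b p (J \<inter> near_ix b N)"
      unfolding chi_def using J by (intro rexp_restrict) auto
    also have "\<dots> \<le> chi b p (near_ix b N)"
      using p finite_near_ix near_ix_subset by (intro chi_mono_set) auto
    finally show ?thesis .
  qed
  also have "(\<Sum>k\<in>{Suc N..?K}. \<Sum>w\<in>?V k. rprob p J (\<lambda>A. set (path_ix b \<one> w) \<subseteq> A)) \<le> (\<Sum>k\<in>{Suc N..?K}. 3/2 * (2 * p) ^ k)"
  proof (intro sum_mono)
    fix k assume k: "k \<in> {Suc N..?K}"
    then obtain k' where k': "k = Suc k'" by (cases k) auto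
    have "(\<Sum>w\<in>?V k. rprob p J (\<lambda>A. set (path_ix b \<one> w) \<subseteq> A)) = (\<Sum>w\<in>?V k. p ^ k)"
    proof (intro sum.cong refl)
      fix w assume w: "w \<in> ?V k"
      then have "card (set (path_ix b \<one> w)) = k" by (auto simp: distinct_card words_def)
      then show "rprob p J (\<lambda>A. set (path_ix b \<one> w) \<subseteq> A) = p ^ k"
        using w J by (simp add: rprob_superset)
    qed
    also have "\<dots> = real (card (?V k)) * p ^ k" by simp
    also have "card (?V k) \<le> card {w \<in> words S k. distinct_adj w}" by (intro card_mono) auto
    also have "\<dots> \<le> 3 * 2 ^ k'" unfolding k' by (rule card_distinct_adj_words[OF S3])
    finally have "(\<Sum>w\<in>?V k. rprob p J (\<lambda>A. set (path_ix b \<one> w) \<subseteq> A)) \<le> real (3 * 2 ^ k') * p ^ k"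
      using p by (simp add: mult_right_mono)
    also have "\<dots> = 3/2 * (2 * p) ^ k" by (simp add: k' power_mult_distrib)
    finally show "(\<Sum>w\<in>?V k. rprob p J (\<lambda>A. set (path_ix b \<one> w) \<subseteq> A)) \<le> 3/2 * (2 * p) ^ k" .
  qed
  also have "(\<Sum>k\<in>{Suc N..?K}. 3/2 * (2 * p) ^ k) \<le> 3/2 * (2 * p) ^ Suc N / (1 - 2 * p)"
  proof (cases "Suc N \<le> ?K")
    case True
    have "(\<Sum>k\<in>{Suc N..?K}. 3/2 * (2 * p) ^ k) = 3/2 * (\<Sum>k\<in>{Suc N..?K}. (2 * p) ^ k)"
      by (simp add: sum_distrib_left)
    also have "(\<Sum>k\<in>{Suc N..?K}. (2 * p) ^ k) = ((2 * p) ^ Suc N - (2 * p) ^ Suc ?K) / (1 - 2 * p)"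
      using True p by (subst sum_gp) auto
    also have "\<dots> \<le> (2 * p) ^ Suc N / (1 - 2 * p)"
      using p by (intro divide_right_mono) auto
    finally show ?thesis by simp
  next
    case False
    then show ?thesis using p by simp
  qed
  finally show ?thesis by simp
qed

end

section \<open>Percolation and coverings\<close>

context involution_marked begin

text \<open>An inequality, because the path may use an index twice or pass through
  \<open>{\<one>}\<close>.\<close>

lemma rprob_superset_path:
  assumes "0 \<le> p" "p \<le> 1" "finite J" "J \<subseteq> indices b"
    and w: "w \<in> words S L" "set (path_ix b \<one> w) - {{\<one>}} \<subseteq> J"
  shows "p ^ L \<le> rprob p J (\<lambda>A. wprod G w \<in> reach b {\<one>} A)"
proof -
  let ?K = "set (path_ix b \<one> w) - {{\<one>}}"
  have S: "set w \<subseteq> S" "length w = L" using w by (auto simp: words_def)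
  have "card ?K \<le> card (set (path_ix b \<one> w))" by (intro card_mono) auto
  also have "\<dots> \<le> L" using card_length[of "path_ix b \<one> w"] S by simp
  finally have "p ^ L \<le> p ^ card ?K" using assms by (intro power_decreasing) auto
  also have "\<dots> = rprob p J (\<lambda>A. ?K \<subseteq> A)" using assms by (simp only: rprob_superset)
  also have "\<dots> \<le> rprob p J (\<lambda>A. wprod G w \<in> reach b {\<one>} A)"
  proof (intro rexp_mono)
    fix A assume "A \<subseteq> J"
    have "wprod G w \<in> reach b {\<one>} A" if "?K \<subseteq> A"
    proof -
      have "\<one> \<otimes> wprod G w \<in> reach b {\<one>} A"
        using S that reach_start[of "{\<one>}"] by (intro reach_path) auto
      then show ?thesis using w words_closed by auto
    qed
    then show "of_bool (?K \<subseteq> A) \<le> (of_bool (wprod G w \<in> reach b {\<one>} A) :: real)" by auto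
  qed (use assms in auto)
  finally show ?thesis .
qed

lemma path_ix_subset_indices:
  assumes "set w \<subseteq> S" "x \<in> carrier G" shows "set (path_ix b x w) - {{\<one>}} \<subseteq> indices b"
  using assms
proof (induction w arbitrary: x)
  case (Cons s w)
  then have "x \<otimes> s \<in> carrier G" using S_closed by auto
  from Cons.IH[OF _ this] show ?case using Cons.prems by (auto simp: indices_def)
qed simp

text \<open>By the hypotheses three vertices lie at distance one and six at distance two, so
  \<open>chi\<close> is at least \<open>3 * p + 6 * p ^ 2\<close>. At \<open>p = 9/20\<close> this
  puts \<open>p * chi\<close> above 1.15.\<close>

lemma supercritical_of_radius_two:
  assumes S3: "card S = 3" and one: "\<one> \<notin> S"
    and two: "inj_on (\<lambda>(s, t). s \<otimes> t) {(s, t). s \<in> S \<and> t \<in> S \<and> s \<noteq> t}"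
    and two_S: "\<And>s t. s \<in> S \<Longrightarrow> t \<in> S \<Longrightarrow> s \<noteq> t \<Longrightarrow> s \<otimes> t \<notin> insert \<one> S"
    and p: "9/20 \<le> p" "p \<le> 1"
  shows "supercritical b p"
proof -
  let ?P = "{(s, t). s \<in> S \<and> t \<in> S \<and> s \<noteq> t}"
  let ?D = "(\<lambda>(s, t). s \<otimes> t) ` ?P"
  let ?J = "near_ix b 2"
  have J: "finite ?J" "?J \<subseteq> indices b" by (simp_all add: finite_near_ix near_ix_subset)
  have "?P = S \<times> S - (\<lambda>s. (s, s)) ` S" by auto
  moreover have "card ((\<lambda>s. (s, s)) ` S) = 3" using S3 by (simp add: card_image inj_on_def)
  moreover have "(\<lambda>s. (s, s)) ` S \<subseteq> S \<times> S" by auto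
  ultimately have "card ?P = 6" "finite ?P"
    using fin_S S3 by (simp_all add: card_Diff_subset card_cartesian_product)
  then have cD: "card ?D = 6" "finite ?D" using two by (simp_all add: card_image)
  define Y where "Y = \<Union> ?J \<union> S \<union> ?D"
  have Y: "finite Y" "\<Union> ?J \<subseteq> Y" unfolding Y_def using J cD fin_S finite_indices by auto
  have ps: "p ^ length w \<le> rprob p ?J (\<lambda>A. wprod G w \<in> reach b {\<one>} A)" if "set w \<subseteq> S" "length w \<le> 2" for w
  proof (rule rprob_superset_path)
    show "set (path_ix b \<one> w) - {{\<one>}} \<subseteq> ?J"
      using path_ix_subset_indices[OF that(1) one_closed, of b] that
      by (auto simp: near_ix_def words_def intro!: bexI[of _ "length w"])
  qed (use p J that in \<open>auto simp: words_def\<close>)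
  have "3 * p + 6 * p ^ 2 = (\<Sum>y\<in>S. p) + (\<Sum>y\<in>?D. p ^ 2)" using S3 cD by simp
  also have "\<dots> \<le> (\<Sum>y\<in>S. rprob p ?J (\<lambda>A. y \<in> reach b {\<one>} A)) + (\<Sum>y\<in>?D. rprob p ?J (\<lambda>A. y \<in> reach b {\<one>} A))"
  proof (intro add_mono sum_mono)
    fix y assume "y \<in> S" then show "p \<le> rprob p ?J (\<lambda>A. y \<in> reach b {\<one>} A)"
      using ps[of "[y]"] S_closed by auto
  next
    fix y assume "y \<in> ?D"
    then obtain s t where st: "s \<in> S" "t \<in> S" "y = s \<otimes> t" by auto
    then have "s \<in> carrier G" "t \<in> carrier G" using S_closed by auto
    then show "p ^ 2 \<le> rprob p ?J (\<lambda>A. y \<in> reach b {\<one>} A)"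
      using ps[of "[s, t]"] st by (simp add: power2_eq_square)
  qed
  also have "\<dots> = (\<Sum>y\<in>S \<union> ?D. rprob p ?J (\<lambda>A. y \<in> reach b {\<one>} A))"
    using fin_S cD two_S by (intro sum.union_disjoint[symmetric]) auto
  also have "\<dots> \<le> (\<Sum>y\<in>Y - {\<one>}. rprob p ?J (\<lambda>A. y \<in> reach b {\<one>} A))"
    using Y one two_S p by (intro sum_mono2 rexp_nonneg) (auto simp: Y_def)
  also have "\<dots> = chi b p ?J" using J Y by (intro chi_eq_sum[symmetric]) auto
  finally have "3 * p + 6 * p ^ 2 \<le> chi b p ?J" .
  moreover have "3 * (9/20) + 6 * (9/20) ^ 2 \<le> 3 * p + 6 * p ^ 2"
    using p by (intro add_mono mult_left_mono power_mono) auto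
  ultimately have "3 * (9/20) + 6 * (9/20) ^ 2 \<le> chi b p ?J" by simp
  then have "9/20 * (3 * (9/20) + 6 * (9/20) ^ 2) \<le> p * chi b p ?J"
    using p by (intro mult_mono) auto
  then have "1 < p * chi b p ?J" by (simp add: power2_eq_square)
  then show ?thesis using J by (auto simp: supercritical_def)
qed

text \<open>There are no near indices for \<open>N = 0\<close>, so the tail alone bounds
  \<open>chi\<close>, by 3/8. The lemma keeps the thresholds positive.\<close>

lemma subcritical_small:
  assumes "card S = 3" shows "subcritical b (1/10)"
proof -
  have "near_ix b 0 = {}" by (simp add: near_ix_def)
  moreover have "reach b {\<one>} {} = {\<one>}" by (auto simp: reach_def open_step_def)
  ultimately have "chi b (1/10) (near_ix b 0) = 0" by (simp add: chi_def)
  then have "1/10 * chi b (1/10) J \<le> 1/2" if "finite J" "J \<subseteq> indices b" for J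
    using chi_le_near[OF assms that, of "1/10" 0] by simp
  then show ?thesis unfolding subcritical_def by (intro exI[of _ "1/2"]) auto
qed

end

section \<open>Lifting clusters from a quotient\<close>

context involution_covering begin

text \<open>The cluster in the quotient is explored index by index, and each queried index is lifted
  at a vertex already reached. No index of \<open>F'\<close> is queried twice, so the lifts are new;
  \<open>X\<close> records those in use, and disjointness from \<open>X\<close> makes the lifted
  states independent.\<close>

lemma exploration:
  assumes p: "0 \<le> p" "p \<le> 1"
  shows "finite F' \<Longrightarrow> C \<subseteq> carrier G \<Longrightarrow>
    (\<And>g s. g \<in> carrier G \<Longrightarrow> s \<in> S \<Longrightarrow> step_ix b (\<pi> g) (\<pi> (g \<otimes>\<^bsub>G\<^esub> s)) \<in> F' \<Longrightarrow> step_ix b g (g \<otimes>\<^bsub>G\<^esub> s) \<notin> X) \<Longrightarrow>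
    \<exists>F. finite F \<and> F \<subseteq> {step_ix b g (g \<otimes>\<^bsub>G\<^esub> s) | g s. g \<in> carrier G \<and> s \<in> S} \<and> F \<inter> X = {} \<and>
      rprob p F' (\<lambda>A. y \<in> G'.reach b (\<pi> ` C) A) \<le> rprob p F (\<lambda>A. y \<in> \<pi> ` G.reach b C A)"
proof (induction "card F'" arbitrary: F' C X)
  case 0
  then have F': "F' = {}" by simp
  have "G'.reach b (\<pi> ` C) {} \<subseteq> \<pi> ` C" by (rule G'.reach_least) auto
  then show ?case using G.reach_start[of C b "{}"] by (intro exI[of _ "{}"]) (auto simp: F')
next
  case (Suc n)
  let ?All = "{step_ix b g (g \<otimes>\<^bsub>G\<^esub> s) | g s. g \<in> carrier G \<and> s \<in> S}"
  show ?case
  proof (cases "\<exists>c\<in>C. \<exists>s\<in>S. step_ix b (\<pi> c) (\<pi> (c \<otimes>\<^bsub>G\<^esub> s)) \<in> F'")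
    \<comment> \<open>No index of \<open>F'\<close> is met by a step from the explored set, so the
      cluster in the quotient is complete.\<close>
    case False
    have "y \<in> \<pi> ` G.reach b C {}" if A: "A \<subseteq> F'" and y: "y \<in> G'.reach b (\<pi> ` C) A" for A
    proof -
      have "G'.reach b (\<pi> ` C) A \<subseteq> \<pi> ` C"
      proof (rule G'.reach_least)
        fix x s' assume x: "x \<in> \<pi> ` C" and s': "s' \<in> S'" "step_ix b x (x \<otimes>\<^bsub>G'\<^esub> s') \<in> A"
        obtain s where s: "s \<in> S" "s' = \<pi> s" using s' bij by (auto simp: bij_betw_def)
        obtain c where c: "c \<in> C" "x = \<pi> c" using x by auto
        have "s \<in> carrier G" "c \<in> carrier G" using s c G.S_closed Suc.prems by auto
        then have "step_ix b (\<pi> c) (\<pi> (c \<otimes>\<^bsub>G\<^esub> s)) \<in> F'" using s c A s' by auto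
        then show "x \<otimes>\<^bsub>G'\<^esub> s' \<in> \<pi> ` C" using False s c by blast
      qed simp
      then show ?thesis using y G.reach_start[of C b "{}"] by auto
    qed
    then have "rprob p F' (\<lambda>A. y \<in> G'.reach b (\<pi> ` C) A) \<le> rexp p F' (\<lambda>A. of_bool (y \<in> \<pi> ` G.reach b C {}))"
      using p by (intro rexp_mono) auto
    then show ?thesis using Suc.prems by (intro exI[of _ "{}"]) simp
  next
    case True
    then obtain c s where c: "c \<in> C" "s \<in> S" "step_ix b (\<pi> c) (\<pi> (c \<otimes>\<^bsub>G\<^esub> s)) \<in> F'" by auto
    define k' where "k' = step_ix b (\<pi> c) (\<pi> (c \<otimes>\<^bsub>G\<^esub> s))"
    define k where "k = step_ix b c (c \<otimes>\<^bsub>G\<^esub> s)"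
    define F1 where "F1 = F' - {k'}"
    have cc: "c \<in> carrier G" "s \<in> carrier G" "c \<otimes>\<^bsub>G\<^esub> s \<in> carrier G" using c Suc.prems G.S_closed by auto
    have F': "F' = insert k' F1" "k' \<notin> F1" "finite F1" "card F1 = n"
      using c Suc.prems Suc.hyps(2) by (auto simp: F1_def k'_def)
    have pk: "\<pi> ` k = k'" by (simp add: k_def k'_def step_ix_image)
    have inv: "step_ix b g (g \<otimes>\<^bsub>G\<^esub> t) \<notin> insert k X"
      if g: "g \<in> carrier G" "t \<in> S" "step_ix b (\<pi> g) (\<pi> (g \<otimes>\<^bsub>G\<^esub> t)) \<in> F1" for g t
    proof -
      have "step_ix b g (g \<otimes>\<^bsub>G\<^esub> t) \<noteq> k"
      proof
        assume "step_ix b g (g \<otimes>\<^bsub>G\<^esub> t) = k"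
        then have "step_ix b (\<pi> g) (\<pi> (g \<otimes>\<^bsub>G\<^esub> t)) = k'" using pk by (metis step_ix_image)
        then show False using g F' by simp
      qed
      moreover have "step_ix b g (g \<otimes>\<^bsub>G\<^esub> t) \<notin> X" using g Suc.prems F' by auto
      ultimately show ?thesis by simp
    qed
    obtain Fa where Fa: "finite Fa" "Fa \<subseteq> ?All" "Fa \<inter> insert k X = {}"
      "rprob p F1 (\<lambda>A. y \<in> G'.reach b (\<pi> ` C) A) \<le> rprob p Fa (\<lambda>A. y \<in> \<pi> ` G.reach b C A)"
      using Suc.hyps(1)[of F1 C "insert k X"] F' Suc.prems inv by auto
    obtain Fb where Fb: "finite Fb" "Fb \<subseteq> ?All" "Fb \<inter> insert k X = {}"
      "rprob p F1 (\<lambda>A. y \<in> G'.reach b (\<pi> ` insert (c \<otimes>\<^bsub>G\<^esub> s) C) A) \<le> rprob p Fb (\<lambda>A. y \<in> \<pi> ` G.reach b (insert (c \<otimes>\<^bsub>G\<^esub> s) C) A)"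
      using Suc.hyps(1)[of F1 "insert (c \<otimes>\<^bsub>G\<^esub> s) C" "insert k X"] F' Suc.prems inv cc by auto
    \<comment> \<open>The two states of \<open>k'\<close> can require different lifted indices
      afterwards. Both sets are kept, and monotonicity absorbs the surplus.\<close>
    let ?F = "Fa \<union> Fb"
    have F: "finite ?F" "k \<notin> ?F" using Fa Fb by auto
    have kX: "k \<notin> X" unfolding k_def using c cc Suc.prems by auto
    \<comment> \<open>Once \<open>k'\<close> is open its target counts as explored; in bond
      percolation the reverse step leads to \<open>\<pi> c\<close>, which is explored
      already.\<close>
    have up: "rprob p F1 (\<lambda>A. y \<in> G'.reach b (\<pi> ` C) (insert k' A)) \<le> rprob p F1 (\<lambda>A. y \<in> G'.reach b (\<pi> ` insert (c \<otimes>\<^bsub>G\<^esub> s) C) A)"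
    proof (intro rexp_mono p)
      fix A
      have "G'.reach b (\<pi> ` C) (insert k' A) \<subseteq> G'.reach b (\<pi> ` insert (c \<otimes>\<^bsub>G\<^esub> s) C) A"
      proof (rule G'.reach_least)
        show "\<pi> ` C \<subseteq> G'.reach b (\<pi> ` insert (c \<otimes>\<^bsub>G\<^esub> s) C) A"
          using G'.reach_start[of "\<pi> ` insert (c \<otimes>\<^bsub>G\<^esub> s) C"] by auto
        fix x t assume x: "x \<in> G'.reach b (\<pi> ` insert (c \<otimes>\<^bsub>G\<^esub> s) C) A" "x \<in> carrier G'" "t \<in> S'"
          "step_ix b x (x \<otimes>\<^bsub>G'\<^esub> t) \<in> insert k' A"
        show "x \<otimes>\<^bsub>G'\<^esub> t \<in> G'.reach b (\<pi> ` insert (c \<otimes>\<^bsub>G\<^esub> s) C) A"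
        proof (cases "step_ix b x (x \<otimes>\<^bsub>G'\<^esub> t) = k'")
          case True
          then have "x \<otimes>\<^bsub>G'\<^esub> t \<in> {\<pi> c, \<pi> (c \<otimes>\<^bsub>G\<^esub> s)}" unfolding k'_def by (metis step_ix_eqD)
          then have "x \<otimes>\<^bsub>G'\<^esub> t \<in> \<pi> ` insert (c \<otimes>\<^bsub>G\<^esub> s) C" using c by auto
          then show ?thesis by (rule subsetD[OF G'.reach_start])
        next
          case False
          then show ?thesis using x by (intro G'.reach_step) auto
        qed
      qed
      then show "of_bool (y \<in> G'.reach b (\<pi> ` C) (insert k' A)) \<le> (of_bool (y \<in> G'.reach b (\<pi> ` insert (c \<otimes>\<^bsub>G\<^esub> s) C) A) :: real)"
        by auto
    qed
    have low: "rprob p ?F (\<lambda>A. y \<in> \<pi> ` G.reach b (insert (c \<otimes>\<^bsub>G\<^esub> s) C) A) \<le> rprob p ?F (\<lambda>A. y \<in> \<pi> ` G.reach b C (insert k A))"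
    proof (intro rexp_mono p)
      fix A
      have "G.reach b (insert (c \<otimes>\<^bsub>G\<^esub> s) C) A \<subseteq> G.reach b C (insert k A)"
      proof (rule G.reach_least)
        have "c \<in> G.reach b C (insert k A)" using c by (intro subsetD[OF G.reach_start])
        then have "c \<otimes>\<^bsub>G\<^esub> s \<in> G.reach b C (insert k A)" using c cc by (intro G.reach_step) (simp_all add: k_def)
        then show "insert (c \<otimes>\<^bsub>G\<^esub> s) C \<subseteq> G.reach b C (insert k A)" using G.reach_start[of C b] by simp
        fix x t assume "x \<in> G.reach b C (insert k A)" "x \<in> carrier G" "t \<in> S" "step_ix b x (x \<otimes>\<^bsub>G\<^esub> t) \<in> A"
        then show "x \<otimes>\<^bsub>G\<^esub> t \<in> G.reach b C (insert k A)" by (intro G.reach_step) simp_all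
      qed
      then show "of_bool (y \<in> \<pi> ` G.reach b (insert (c \<otimes>\<^bsub>G\<^esub> s) C) A) \<le> (of_bool (y \<in> \<pi> ` G.reach b C (insert k A)) :: real)"
        by auto
    qed
    have mono: "rprob p H (\<lambda>A. y \<in> \<pi> ` G.reach b D A) \<le> rprob p ?F (\<lambda>A. y \<in> \<pi> ` G.reach b D A)" if "H \<subseteq> ?F" for H D
    proof (rule rexp_mono_set[OF F(1) that p])
      fix A B :: "'a set set" assume "A \<subseteq> B"
      from G.reach_mono[OF this, of b D]
      show "of_bool (y \<in> \<pi> ` G.reach b D A) \<le> (of_bool (y \<in> \<pi> ` G.reach b D B) :: real)" by auto
    qed
    have "rprob p F' (\<lambda>A. y \<in> G'.reach b (\<pi> ` C) A)
        = p * rprob p F1 (\<lambda>A. y \<in> G'.reach b (\<pi> ` C) (insert k' A)) + (1 - p) * rprob p F1 (\<lambda>A. y \<in> G'.reach b (\<pi> ` C) A)"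
      using F' by (simp add: rexp_insert)
    also have "\<dots> \<le> p * rprob p ?F (\<lambda>A. y \<in> \<pi> ` G.reach b C (insert k A)) + (1 - p) * rprob p ?F (\<lambda>A. y \<in> \<pi> ` G.reach b C A)"
    proof (intro add_mono mult_left_mono)
      show "rprob p F1 (\<lambda>A. y \<in> G'.reach b (\<pi> ` C) (insert k' A)) \<le> rprob p ?F (\<lambda>A. y \<in> \<pi> ` G.reach b C (insert k A))"
        using up Fb(4) mono[OF Un_upper2, of "insert (c \<otimes>\<^bsub>G\<^esub> s) C"] low by linarith
      show "rprob p F1 (\<lambda>A. y \<in> G'.reach b (\<pi> ` C) A) \<le> rprob p ?F (\<lambda>A. y \<in> \<pi> ` G.reach b C A)"
        using Fa(4) mono[OF Un_upper1, of C] by linarith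
    qed (use p in auto)
    also have "\<dots> = rprob p (insert k ?F) (\<lambda>A. y \<in> \<pi> ` G.reach b C A)"
      using F by (simp add: rexp_insert)
    finally show ?thesis
      using F Fa Fb kX c cc by (intro exI[of _ "insert k ?F"]) (auto simp: k_def)
  qed
qed

text \<open>Taking \<open>X = {{\<one>}}\<close> keeps the lifts away from the singleton that is
  left out of \<open>indices\<close>.\<close>

lemma reach_fibre:
  assumes p: "0 \<le> p" "p \<le> 1" and J': "finite J'" "J' \<subseteq> G'.indices b"
  shows "\<exists>J. finite J \<and> J \<subseteq> G.indices b \<and>
    rprob p J' (\<lambda>A. y \<in> G'.reach b {\<one>\<^bsub>G'\<^esub>} A) \<le> rprob p J (\<lambda>A. y \<in> \<pi> ` G.reach b {\<one>\<^bsub>G\<^esub>} A)"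
proof -
  have *: "step_ix b g (g \<otimes>\<^bsub>G\<^esub> s) \<notin> {{\<one>\<^bsub>G\<^esub>}}" if "step_ix b (\<pi> g) (\<pi> (g \<otimes>\<^bsub>G\<^esub> s)) \<in> J'" for g s
  proof
    assume "step_ix b g (g \<otimes>\<^bsub>G\<^esub> s) \<in> {{\<one>\<^bsub>G\<^esub>}}"
    then have "\<pi> ` step_ix b g (g \<otimes>\<^bsub>G\<^esub> s) = {\<one>\<^bsub>G'\<^esub>}" by simp
    then show False using that J' by (auto simp: step_ix_image G'.indices_def)
  qed
  obtain F where "finite F" "F \<subseteq> {step_ix b g (g \<otimes>\<^bsub>G\<^esub> s) | g s. g \<in> carrier G \<and> s \<in> S}" "F \<inter> {{\<one>\<^bsub>G\<^esub>}} = {}"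
      "rprob p J' (\<lambda>A. y \<in> G'.reach b (\<pi> ` {\<one>\<^bsub>G\<^esub>}) A) \<le> rprob p F (\<lambda>A. y \<in> \<pi> ` G.reach b {\<one>\<^bsub>G\<^esub>} A)"
    using exploration[OF p J'(1), of "{\<one>\<^bsub>G\<^esub>}" b "{{\<one>\<^bsub>G\<^esub>}}" y] * by auto
  then show ?thesis by (intro exI[of _ F]) (auto simp: G.indices_def)
qed

text \<open>Each vertex of the quotient cluster other than the identity has a lift in the cluster
  upstairs. The kernel element \<open>wprod G w\<close> lies over the identity, so it is counted
  upstairs only, and it is reached with probability at least \<open>p ^ L\<close>.\<close>

lemma chi_covering:
  assumes p: "0 \<le> p" "p \<le> 1" and J': "finite J'" "J' \<subseteq> G'.indices b"
    and w: "w \<in> words S L" "wprod G w \<noteq> \<one>\<^bsub>G\<^esub>" "\<pi> (wprod G w) = \<one>\<^bsub>G'\<^esub>"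
  shows "\<exists>J. finite J \<and> J \<subseteq> G.indices b \<and> G'.chi b p J' + p ^ L \<le> G.chi b p J"
proof -
  let ?z = "wprod G w"
  define Y where "Y = \<Union> J'"
  have Y: "finite Y" unfolding Y_def using J' G'.finite_indices by auto
  obtain F where F: "\<And>y. finite (F y) \<and> F y \<subseteq> G.indices b \<and>
    rprob p J' (\<lambda>A. y \<in> G'.reach b {\<one>\<^bsub>G'\<^esub>} A) \<le> rprob p (F y) (\<lambda>A. y \<in> \<pi> ` G.reach b {\<one>\<^bsub>G\<^esub>} A)"
    using reach_fibre[OF p J'] by metis
  define J where "J = (\<Union>y\<in>Y. F y) \<union> (set (G.path_ix b \<one>\<^bsub>G\<^esub> w) - {{\<one>\<^bsub>G\<^esub>}})"
  have J: "finite J" "J \<subseteq> G.indices b"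
    unfolding J_def using F Y G.path_ix_subset_indices[of w "\<one>\<^bsub>G\<^esub>" b] w by (auto simp: words_def)
  have le: "rprob p J' (\<lambda>A. y \<in> G'.reach b {\<one>\<^bsub>G'\<^esub>} A) \<le> rprob p J (\<lambda>A. y \<in> \<pi> ` G.reach b {\<one>\<^bsub>G\<^esub>} A)" if "y \<in> Y" for y
  proof -
    have "rprob p (F y) (\<lambda>A. y \<in> \<pi> ` G.reach b {\<one>\<^bsub>G\<^esub>} A) \<le> rprob p J (\<lambda>A. y \<in> \<pi> ` G.reach b {\<one>\<^bsub>G\<^esub>} A)"
    proof (rule rexp_mono_set[OF J(1) _ p])
      show "F y \<subseteq> J" using that by (auto simp: J_def)
      fix A B :: "'a set set" assume "A \<subseteq> B"
      from G.reach_mono[OF this, of b "{\<one>\<^bsub>G\<^esub>}"]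
      show "of_bool (y \<in> \<pi> ` G.reach b {\<one>\<^bsub>G\<^esub>} A) \<le> (of_bool (y \<in> \<pi> ` G.reach b {\<one>\<^bsub>G\<^esub>} B) :: real)" by auto
    qed
    then show ?thesis using F[of y] by simp
  qed
  have "G'.chi b p J' + p ^ L = (\<Sum>y\<in>Y - {\<one>\<^bsub>G'\<^esub>}. rprob p J' (\<lambda>A. y \<in> G'.reach b {\<one>\<^bsub>G'\<^esub>} A)) + p ^ L"
    using J' Y by (subst G'.chi_eq_sum[of _ _ Y]) (auto simp: Y_def)
  also have "\<dots> \<le> (\<Sum>y\<in>Y - {\<one>\<^bsub>G'\<^esub>}. rprob p J (\<lambda>A. y \<in> \<pi> ` G.reach b {\<one>\<^bsub>G\<^esub>} A)) + rprob p J (\<lambda>A. ?z \<in> G.reach b {\<one>\<^bsub>G\<^esub>} A)"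
    using p J w by (intro add_mono sum_mono le G.rprob_superset_path) (auto simp: J_def)
  also have "\<dots> = rexp p J (\<lambda>A. (\<Sum>y\<in>Y - {\<one>\<^bsub>G'\<^esub>}. of_bool (y \<in> \<pi> ` G.reach b {\<one>\<^bsub>G\<^esub>} A)) + of_bool (?z \<in> G.reach b {\<one>\<^bsub>G\<^esub>} A))"
    by (simp only: rexp_add rexp_sum)
  also have "\<dots> \<le> G.chi b p J"
    unfolding G.chi_def
  proof (intro rexp_mono p)
    fix A assume A: "A \<subseteq> J"
    let ?R = "G.reach b {\<one>\<^bsub>G\<^esub>} A"
    have finR: "finite (?R - {\<one>\<^bsub>G\<^esub>})" using G.finite_reach_one[OF J A] by simp
    let ?V = "{y \<in> Y - {\<one>\<^bsub>G'\<^esub>}. y \<in> \<pi> ` ?R}"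
    let ?U = "{x \<in> ?R. \<pi> x \<in> Y - {\<one>\<^bsub>G'\<^esub>}}"
    have U: "?U \<subseteq> ?R - {\<one>\<^bsub>G\<^esub>}" by auto
    then have finU: "finite ?U" using finR finite_subset by blast
    have "?V = \<pi> ` ?U" by auto
    then have "card ?V \<le> card ?U" using card_image_le[OF finU, of \<pi>] by (simp only:)
    moreover have "card ?U + of_bool (?z \<in> ?R) \<le> card (?R - {\<one>\<^bsub>G\<^esub>})"
    proof (cases "?z \<in> ?R")
      case True
      have "?z \<notin> ?U" using w by simp
      then have "card ?U + 1 = card (insert ?z ?U)" using finU by simp
      also have "\<dots> \<le> card (?R - {\<one>\<^bsub>G\<^esub>})" using finR U True w by (intro card_mono) auto
      finally show ?thesis using True by simp
    next
      case False
      then show ?thesis using card_mono[OF finR U] by simp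
    qed
    ultimately have "card ?V + of_bool (?z \<in> ?R) \<le> card (?R - {\<one>\<^bsub>G\<^esub>})" by linarith
    then have "real (card ?V) + of_bool (?z \<in> ?R) \<le> real (card (?R - {\<one>\<^bsub>G\<^esub>}))"
      by (simp only: of_nat_add of_nat_of_bool flip: of_nat_le_iff[where 'a = real])
    moreover have "(\<Sum>y\<in>Y - {\<one>\<^bsub>G'\<^esub>}. of_bool (y \<in> \<pi> ` ?R)) = real (card ?V)"
      using Y by (simp add: of_bool_def sum.If_cases Int_def)
    ultimately show "(\<Sum>y\<in>Y - {\<one>\<^bsub>G'\<^esub>}. of_bool (y \<in> \<pi> ` ?R)) + of_bool (?z \<in> ?R) \<le> real (card (?R - {\<one>\<^bsub>G\<^esub>}))"
      by simp
  qed
  finally show ?thesis using J by blast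
qed

text \<open>If \<open>G\<close> were supercritical nowhere below \<open>p1\<close>, then
  \<open>chi_covering\<close> would keep \<open>q * chi\<close> of the quotient below
  \<open>1 - q ^ (L + 1)\<close> there. Continuity of polynomials carries this gap to
  \<open>p1\<close>, and the uniform tail bound carries part of it to some \<open>q\<close> beyond
  \<open>p1\<close>, where \<open>G'\<close> would be subcritical, against
  \<open>nsub\<close>.\<close>

lemma supercritical_below_threshold:
  assumes S3: "card S = 3" and p1: "0 < p1" "p1 \<le> 9/20"
    and nsub: "\<And>q. p1 < q \<Longrightarrow> q \<le> 1 \<Longrightarrow> \<not> G'.subcritical b q"
    and w: "w \<in> words S L" "wprod G w \<noteq> \<one>\<^bsub>G\<^esub>" "\<pi> (wprod G w) = \<one>\<^bsub>G'\<^esub>"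
  shows "\<exists>q. 0 < q \<and> q < p1 \<and> G.supercritical b q"
proof (rule ccontr)
  assume no: "\<not> ?thesis"
  have le1: "q * G'.chi b q J' \<le> 1 - q ^ Suc L" if q: "0 < q" "q < p1" and J': "finite J'" "J' \<subseteq> G'.indices b" for q J'
  proof -
    obtain J where J: "finite J" "J \<subseteq> G.indices b" "G'.chi b q J' + q ^ L \<le> G.chi b q J"
      using chi_covering[OF _ _ J' w, of q] q p1 by auto
    have "\<not> G.supercritical b q" using no q by auto
    then have "q * G.chi b q J \<le> 1" using J by (auto simp: G.supercritical_def not_less)
    moreover have "q * (G'.chi b q J' + q ^ L) \<le> q * G.chi b q J" using J q by (intro mult_left_mono) auto
    ultimately show ?thesis by (simp add: algebra_simps)
  qed
  define e where "e = p1 ^ Suc L"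
  have e: "e > 0" using p1 by (simp add: e_def)
  have le: "p1 * G'.chi b p1 J' \<le> 1 - e" if J': "finite J'" "J' \<subseteq> G'.indices b" for J'
  proof (rule tendsto_le)
    show "at_left p1 \<noteq> bot" by simp
    show "((\<lambda>q. q * G'.chi b q J') \<longlongrightarrow> p1 * G'.chi b p1 J') (at_left p1)"
      using isCont_rexp[OF J'(1), where x = p1] unfolding G'.chi_def
      by (intro tendsto_intros) (auto simp: isCont_def intro: tendsto_within_subset)
    show "((\<lambda>q. 1 - q ^ Suc L) \<longlongrightarrow> 1 - e) (at_left p1)"
      unfolding e_def by (intro tendsto_intros)
    show "\<forall>\<^sub>F q in at_left p1. q * G'.chi b q J' \<le> 1 - q ^ Suc L"
      using eventually_at_left_real[OF p1(1)] by eventually_elim (use le1 J' in auto)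
  qed
  \<comment> \<open>For \<open>q < 12/25\<close>, a point between 9/20 and 1/2, the tail in
    \<open>chi_le_near\<close> has ratio at most 24/25 and the factor \<open>1 / (1 - 2 * q)\<close>
    is at most 25.\<close>
  have "(\<lambda>N. 3/2 * (24/25::real) ^ Suc N * 25) \<longlonglongrightarrow> 3/2 * 0 * 25"
    by (intro tendsto_intros LIMSEQ_power_zero[THEN LIMSEQ_Suc]) auto
  then have "\<forall>\<^sub>F N in sequentially. 3/2 * (24/25::real) ^ Suc N * 25 < e / 4"
    by (rule order_tendstoD) (use e in simp)
  then obtain N where N: "3/2 * (24/25::real) ^ Suc N * 25 < e / 4"
    by (auto simp: eventually_sequentially)
  let ?J = "G'.near_ix b N"
  have J: "finite ?J" "?J \<subseteq> G'.indices b" by (simp_all add: G'.finite_near_ix G'.near_ix_subset)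
  \<comment> \<open>Half of the gap \<open>e\<close> is spent on moving \<open>q\<close> past
    \<open>p1\<close>, a quarter on the tail.\<close>
  have "((\<lambda>q. q * G'.chi b q ?J) \<longlongrightarrow> p1 * G'.chi b p1 ?J) (at_right p1)"
    using isCont_rexp[OF J(1), where x = p1] unfolding G'.chi_def
    by (intro tendsto_intros) (auto simp: isCont_def intro: tendsto_within_subset)
  then have "\<forall>\<^sub>F q in at_right p1. q * G'.chi b q ?J < 1 - e / 2"
    using le[OF J] e by (intro order_tendstoD) auto
  moreover have "\<forall>\<^sub>F q in at_right p1. q \<in> {p1<..<12/25}"
    using p1 by (intro eventually_at_right_real) auto
  ultimately obtain q where q: "q * G'.chi b q ?J < 1 - e / 2" "p1 < q" "q < 12/25"
    using eventually_happens[OF eventually_conj, of _ "at_right p1"] by fastforce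
  have "q * G'.chi b q J' \<le> 1 - e / 4" if J': "finite J'" "J' \<subseteq> G'.indices b" for J'
  proof -
    have "G'.chi b q J' \<le> G'.chi b q ?J + 3/2 * (2 * q) ^ Suc N / (1 - 2 * q)"
      using q p1 S3 card_S' by (intro G'.chi_le_near J') auto
    also have "3/2 * (2 * q) ^ Suc N / (1 - 2 * q) \<le> 3/2 * (24/25) ^ Suc N / (1/25)"
      using q p1 by (intro frac_le mult_left_mono power_mono) auto
    finally have "G'.chi b q J' \<le> G'.chi b q ?J + e / 4" using N by simp
    then have "q * G'.chi b q J' \<le> q * G'.chi b q ?J + q * (e / 4)"
      unfolding distrib_left[symmetric] using q(2) p1 by (intro mult_left_mono) auto
    also have "q * (e / 4) \<le> 1 * (e / 4)" using q e by (intro mult_right_mono) auto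
    finally show ?thesis using q by simp
  qed
  then have "G'.subcritical b q"
    unfolding G'.subcritical_def using e by (intro exI[of _ "1 - e / 4"]) auto
  then show False using nsub[of q] q by auto
qed

end

section \<open>Percolation on a free product with a group of order two\<close>

lemma rexp_prod_disjoint:
  assumes "finite X" "\<And>x. x \<in> X \<Longrightarrow> finite (H x)" "disjoint_family_on H X"
  shows "rexp p (\<Union>x\<in>X. H x) (\<lambda>A. \<Prod>x\<in>X. g x (A \<inter> H x)) = (\<Prod>x\<in>X. rexp p (H x) (g x))"
  using assms
proof (induction X rule: finite_induct)
  case (insert y X)
  let ?U = "\<Union>x\<in>X. H x"
  have U: "finite ?U" "H y \<inter> ?U = {}"
    using insert.prems insert.hyps by (fastforce simp: disjoint_family_on_def)+
  have "rexp p (\<Union>x\<in>insert y X. H x) (\<lambda>A. \<Prod>x\<in>insert y X. g x (A \<inter> H x))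
      = rexp p (H y \<union> ?U) (\<lambda>A. g y (A \<inter> H y) * (\<Prod>x\<in>X. g x (A \<inter> ?U \<inter> H x)))"
  proof -
    have "A \<inter> ?U \<inter> H x = A \<inter> H x" if "x \<in> X" for A x using that by auto
    then show ?thesis using insert.hyps by simp
  qed
  also have "\<dots> = rexp p (H y) (g y) * rexp p ?U (\<lambda>A. \<Prod>x\<in>X. g x (A \<inter> H x))"
    using U insert.prems by (intro rexp_product[where h = "\<lambda>A. \<Prod>x\<in>X. g x (A \<inter> H x)"]) auto
  also have "rexp p ?U (\<lambda>A. \<Prod>x\<in>X. g x (A \<inter> H x)) = (\<Prod>x\<in>X. rexp p (H x) (g x))"
    using insert.prems by (intro insert.IH) (auto simp: disjoint_family_on_def)
  finally show ?case using insert.hyps by simp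
qed simp

lemma rprob_mem: assumes "finite F" shows "rprob p F (\<lambda>A. i \<in> A) = (if i \<in> F then p else 0)"
proof (cases "i \<in> F")
  case True
  then show ?thesis using rprob_superset[OF assms, of "{i}" p] by simp
next
  case False
  then have "rprob p F (\<lambda>A. i \<in> A) = rexp p F (\<lambda>A. 0)" by (intro rexp_cong) auto
  then show ?thesis using False assms by simp
qed

lemma rprob_le_1: assumes "finite F" "0 \<le> p" "p \<le> 1" shows "rprob p F Q \<le> 1"
proof -
  have "rprob p F Q \<le> rexp p F (\<lambda>_. 1)" using assms by (intro rexp_mono) auto
  then show ?thesis using assms by simp
qed

text \<open>A second-order bound for the probability that none of \<open>k\<close> children
  survives; near \<open>u = 0\<close> the linear term decides.\<close>

lemma one_minus_power_le:
  fixes u :: real assumes "0 \<le> u" "u \<le> 1"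
  shows "(1 - u) ^ k \<le> 1 - real k * u + (real k * u)\<^sup>2"
proof (induction k)
  case (Suc k)
  have "(1 - u) ^ Suc k \<le> (1 - u) * (1 - real k * u + (real k * u)\<^sup>2)"
    using Suc assms by (simp add: mult_left_mono)
  also have "\<dots> = 1 - real (Suc k) * u + (real (Suc k) * u)\<^sup>2 - ((real k * u)\<^sup>2 * u + (real k + 1) * u\<^sup>2)"
    by (simp add: power2_eq_square algebra_simps)
  also have "\<dots> \<le> 1 - real (Suc k) * u + (real (Suc k) * u)\<^sup>2"
  proof -
    have "0 \<le> (real k * u)\<^sup>2 * u" "0 \<le> (real k + 1) * u\<^sup>2" using assms by simp_all
    then show ?thesis by linarith
  qed
  finally show ?case .
qed simp

text \<open>Percolation on the free product of \<open>G\<close> with a group of order two. An element of the free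
  product is a list \<open>[a\<^sub>0, \<dots>, a\<^sub>k]\<close>, standing for \<open>a\<^sub>0 t a\<^sub>1 t \<dots> t a\<^sub>k\<close>. The index \<open>(l, Some j)\<close> is
  the copy of the index \<open>j\<close> in the coset of \<open>G\<close> entered from \<open>l\<close> by a step \<open>t\<close>, and \<open>(l, None)\<close>
  is the index of that step.\<close>

context involution_marked begin

lemma finite_Union_indices: "finite J \<Longrightarrow> J \<subseteq> indices b \<Longrightarrow> finite (\<Union> J)"
  using finite_indices by (intro finite_Union) auto

definition copy :: "('a list \<times> 'a set option) set \<Rightarrow> 'a list \<Rightarrow> 'a set set" where
  "copy A l = {j. (l, Some j) \<in> A}"

text \<open>A list of length at least two ending in \<open>\<one>\<close> is the entry point of its
  coset. The step \<open>t\<close> leads from it back to the parent, so it opens no further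
  coset.\<close>

inductive_set cluster :: "bool \<Rightarrow> ('a list \<times> 'a set option) set \<Rightarrow> 'a list set" for b A where
  start: "x \<in> reach b {\<one>} (copy A []) \<Longrightarrow> [x] \<in> cluster b A"
| extend: "l \<in> cluster b A \<Longrightarrow> length l \<le> 1 \<or> last l \<noteq> \<one> \<Longrightarrow> (l, None) \<in> A \<Longrightarrow>
    x \<in> reach b {\<one>} (copy A l) \<Longrightarrow> l @ [x] \<in> cluster b A"

definition entered :: "bool \<Rightarrow> ('a list \<times> 'a set option) set \<Rightarrow> 'a list \<Rightarrow> bool" where
  "entered b A l \<longleftrightarrow> l = [] \<or> (l \<in> cluster b A \<and> (length l \<le> 1 \<or> last l \<noteq> \<one>) \<and> (l, None) \<in> A)"

lemma Nil_notin_cluster [simp]: "[] \<notin> cluster b A"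
  by (auto elim: cluster.cases)

lemma snoc_in_cluster: "l @ [x] \<in> cluster b A \<longleftrightarrow> entered b A l \<and> x \<in> reach b {\<one>} (copy A l)"
proof
  assume "l @ [x] \<in> cluster b A"
  then show "entered b A l \<and> x \<in> reach b {\<one>} (copy A l)"
    by cases (auto simp: entered_def)
next
  assume "entered b A l \<and> x \<in> reach b {\<one>} (copy A l)"
  then show "l @ [x] \<in> cluster b A"
    by (auto simp: entered_def intro: cluster.start[of x, simplified] cluster.extend)
qed

text \<open>Membership of a list is decided in the cosets of its proper prefixes. This gives the
  independence between generations.\<close>

lemma cluster_depends:
  assumes "\<And>i. length (fst i) < length l \<Longrightarrow> i \<in> A \<longleftrightarrow> i \<in> B"
  shows "l \<in> cluster b A \<longleftrightarrow> l \<in> cluster b B"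
  using assms
proof (induction l rule: rev_induct)
  case (snoc x l)
  have "copy A l = copy B l" using snoc.prems by (auto simp: copy_def)
  moreover have "l \<in> cluster b A \<longleftrightarrow> l \<in> cluster b B" using snoc by auto
  moreover have "(l, None) \<in> A \<longleftrightarrow> (l, None) \<in> B" using snoc.prems[of "(l, None)"] by simp
  ultimately show ?case by (simp add: snoc_in_cluster entered_def)
qed simp

lemma cluster_mono: "l \<in> cluster b A \<Longrightarrow> A \<subseteq> B \<Longrightarrow> l \<in> cluster b B"
proof (induction rule: cluster.induct)
  case (start x)
  then have "copy A [] \<subseteq> copy B []" by (auto simp: copy_def)
  then show ?case using start reach_mono[of "copy A []" "copy B []" b "{\<one>}"] by (auto intro: cluster.start)
next
  case (extend l x)
  then have "copy A l \<subseteq> copy B l" by (auto simp: copy_def)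
  then show ?case using extend reach_mono[of "copy A l" "copy B l" b "{\<one>}"]
    by (intro cluster.extend) auto
qed

lemma rprob_copy_le:
  assumes "finite F" "0 \<le> p" "p \<le> 1" "finite J" "\<And>j. (l, Some j) \<in> F \<Longrightarrow> j \<in> J"
  shows "rprob p F (\<lambda>A. x \<in> reach b {\<one>} (copy A l)) \<le> rprob p J (\<lambda>A. x \<in> reach b {\<one>} A)"
proof -
  let ?H = "copy F l"
  let ?f = "\<lambda>j. (l, Some j)"
  have H: "?H \<subseteq> J" "?f ` ?H \<subseteq> F" using assms by (auto simp: copy_def)
  have finH: "finite ?H" using H(1) assms(4) by (rule finite_subset)
  have "rprob p F (\<lambda>A. x \<in> reach b {\<one>} (copy A l)) = rprob p F (\<lambda>A. x \<in> reach b {\<one>} (copy (A \<inter> ?f ` ?H) l))"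
  proof (rule rexp_cong)
    fix A assume "A \<subseteq> F"
    then have "copy (A \<inter> ?f ` ?H) l = copy A l" by (auto simp: copy_def)
    then show "(of_bool (x \<in> reach b {\<one>} (copy A l)) :: real) = of_bool (x \<in> reach b {\<one>} (copy (A \<inter> ?f ` ?H) l))"
      by simp
  qed
  also have "\<dots> = rprob p (?f ` ?H) (\<lambda>A. x \<in> reach b {\<one>} (copy A l))"
    using assms(1) H(2) by (rule rexp_restrict)
  also have "\<dots> = rprob p ?H (\<lambda>A. x \<in> reach b {\<one>} (copy (?f ` A) l))"
    using finH by (intro rexp_image) (auto simp: inj_on_def)
  also have "\<dots> = rprob p ?H (\<lambda>A. x \<in> reach b {\<one>} A)"
  proof -
    have "copy (?f ` A) l = A" for A by (auto simp: copy_def)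
    then show ?thesis by simp
  qed
  also have "\<dots> \<le> rprob p J (\<lambda>A. x \<in> reach b {\<one>} A)"
  proof (rule rexp_mono_set[OF assms(4) H(1) assms(2,3)])
    fix A B :: "'a set set" assume "A \<subseteq> B"
    from reach_mono[OF this, of b "{\<one>}"]
    show "of_bool (x \<in> reach b {\<one>} A) \<le> (of_bool (x \<in> reach b {\<one>} B) :: real)" by auto
  qed
  finally show ?thesis .
qed

text \<open>Entering the coset of \<open>l\<close> uses indices with shorter lists and
  \<open>(l, None)\<close>; reaching \<open>x\<close> inside it uses the copies at \<open>l\<close>.
  These sets are disjoint, so the probabilities multiply.\<close>

lemma rprob_snoc_le:
  assumes "finite F" "0 \<le> p" "p \<le> 1" "finite J" "\<And>j. (l, Some j) \<in> F \<Longrightarrow> j \<in> J"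
  shows "rprob p F (\<lambda>A. l @ [x] \<in> cluster b A) \<le> rprob p F (\<lambda>A. entered b A l) * rprob p J (\<lambda>A. x \<in> reach b {\<one>} A)"
proof -
  let ?F1 = "{i \<in> F. length (fst i) < length l \<or> i = (l, None)}"
  let ?F2 = "F - ?F1"
  have e1: "entered b (A \<inter> ?F1) l \<longleftrightarrow> entered b A l" if "A \<subseteq> F" for A
  proof -
    have "l \<in> cluster b (A \<inter> ?F1) \<longleftrightarrow> l \<in> cluster b A" using that by (intro cluster_depends) auto
    then show ?thesis using that by (auto simp: entered_def)
  qed
  have e2: "copy (A \<inter> ?F2) l = copy A l" if "A \<subseteq> F" for A using that by (auto simp: copy_def)
  have "rprob p F (\<lambda>A. l @ [x] \<in> cluster b A)
      = rexp p (?F1 \<union> ?F2) (\<lambda>A. of_bool (entered b (A \<inter> ?F1) l) * of_bool (x \<in> reach b {\<one>} (copy (A \<inter> ?F2) l)))"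
  proof -
    have *: "?F1 \<union> ?F2 = F" by auto
    show ?thesis unfolding * by (intro rexp_cong) (simp add: snoc_in_cluster e1 e2)
  qed
  also have "\<dots> = rprob p ?F1 (\<lambda>A. entered b A l) * rprob p ?F2 (\<lambda>A. x \<in> reach b {\<one>} (copy A l))"
    using assms(1) by (intro rexp_product[where g = "\<lambda>A. of_bool (entered b A l)" and h = "\<lambda>A. of_bool (x \<in> reach b {\<one>} (copy A l))"]) auto
  also have "rprob p ?F1 (\<lambda>A. entered b A l) = rprob p F (\<lambda>A. entered b A l)"
  proof -
    have "rprob p F (\<lambda>A. entered b A l) = rprob p F (\<lambda>A. entered b (A \<inter> ?F1) l)"
      using e1 by (intro rexp_cong) simp
    also have "\<dots> = rprob p ?F1 (\<lambda>A. entered b A l)"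
      using assms(1) by (intro rexp_restrict[where g = "\<lambda>A. of_bool (entered b A l)"]) auto
    finally show ?thesis by simp
  qed
  also have "rprob p F (\<lambda>A. entered b A l) * rprob p ?F2 (\<lambda>A. x \<in> reach b {\<one>} (copy A l))
      \<le> rprob p F (\<lambda>A. entered b A l) * rprob p J (\<lambda>A. x \<in> reach b {\<one>} A)"
    using assms by (intro mult_left_mono rprob_copy_le rexp_nonneg) auto
  finally show ?thesis .
qed

lemma rprob_entered_le:
  assumes F: "finite F" "0 \<le> p" "p \<le> 1" and l: "l \<noteq> []"
  shows "rprob p F (\<lambda>A. entered b A l) \<le> (if length l \<le> 1 \<or> last l \<noteq> \<one> then p * rprob p F (\<lambda>A. l \<in> cluster b A) else 0)"
proof (cases "length l \<le> 1 \<or> last l \<noteq> \<one>")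
  case False
  then have "rprob p F (\<lambda>A. entered b A l) = rexp p F (\<lambda>_. 0)"
    using l by (intro rexp_cong) (auto simp: entered_def)
  then show ?thesis using False F by simp
next
  case True
  let ?F1 = "{i \<in> F. length (fst i) < length l}"
  let ?F2 = "F - ?F1"
  have *: "?F1 \<union> ?F2 = F" by auto
  have e1: "l \<in> cluster b (A \<inter> ?F1) \<longleftrightarrow> l \<in> cluster b A" if "A \<subseteq> F" for A
    using that by (intro cluster_depends) auto
  have e2: "(l, None) \<in> A \<inter> ?F2 \<longleftrightarrow> (l, None) \<in> A" if "A \<subseteq> F" for A using that by auto
  have "rprob p F (\<lambda>A. entered b A l)
      = rexp p (?F1 \<union> ?F2) (\<lambda>A. of_bool (l \<in> cluster b (A \<inter> ?F1)) * of_bool ((l, None) \<in> A \<inter> ?F2))"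
    unfolding * using True l by (intro rexp_cong) (simp only: e1 e2, simp add: entered_def)
  also have "\<dots> = rprob p ?F1 (\<lambda>A. l \<in> cluster b A) * rprob p ?F2 (\<lambda>A. (l, None) \<in> A)"
    using F by (intro rexp_product[where g = "\<lambda>A. of_bool (l \<in> cluster b A)" and h = "\<lambda>A. of_bool ((l, None) \<in> A)"]) auto
  also have "rprob p ?F1 (\<lambda>A. l \<in> cluster b A) = rprob p F (\<lambda>A. l \<in> cluster b A)"
  proof -
    have "rprob p F (\<lambda>A. l \<in> cluster b A) = rprob p F (\<lambda>A. l \<in> cluster b (A \<inter> ?F1))"
      using e1 by (intro rexp_cong) simp
    also have "\<dots> = rprob p ?F1 (\<lambda>A. l \<in> cluster b A)"
      using F by (intro rexp_restrict[where g = "\<lambda>A. of_bool (l \<in> cluster b A)"]) auto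
    finally show ?thesis by simp
  qed
  also have "rprob p F (\<lambda>A. l \<in> cluster b A) * rprob p ?F2 (\<lambda>A. (l, None) \<in> A) \<le> rprob p F (\<lambda>A. l \<in> cluster b A) * p"
    using F by (intro mult_left_mono rexp_nonneg) (auto simp: rprob_mem)
  finally show ?thesis using True by (simp add: mult.commute)
qed

text \<open>The expected number of entered cosets shrinks by the factor \<open>c\<close> per
  generation: \<open>chi\<close> bounds the expected number of vertices of a coset other than its
  entry point, and each is followed by an open step \<open>t\<close> with probability
  \<open>p\<close>.\<close>

lemma subcritical_cluster_bound:
  assumes sub: "subcritical b p" and p: "0 < p" "p \<le> 1"
  obtains M where "\<And>F Q. finite F \<Longrightarrow> (\<And>l j. (l, Some j) \<in> F \<Longrightarrow> j \<in> indices b) \<Longrightarrow> finite Q \<Longrightarrow>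
    rexp p F (\<lambda>A. real (card (cluster b A \<inter> Q))) \<le> M"
proof -
  obtain c0 where c0: "c0 < 1" "\<And>J. finite J \<Longrightarrow> J \<subseteq> indices b \<Longrightarrow> p * chi b p J \<le> c0"
    using sub by (auto simp: subcritical_def)
  define c where "c = max c0 0"
  have c: "0 \<le> c" "c < 1" "\<And>J. finite J \<Longrightarrow> J \<subseteq> indices b \<Longrightarrow> p * chi b p J \<le> c"
    using c0 by (auto simp: c_def intro: order_trans[OF c0(2)])
  \<comment> \<open>Each entered coset contributes at most \<open>1 + c / p\<close> vertices in
    expectation, and the expected number of entered cosets is at most
    \<open>1 + (p + c) / (1 - c)\<close>.\<close>
  define M where "M = (1 + c / p) * (1 + (p + c) / (1 - c))"
  have "rexp p F (\<lambda>A. real (card (cluster b A \<inter> Q))) \<le> M"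
    if F: "finite F" "\<And>l j. (l, Some j) \<in> F \<Longrightarrow> j \<in> indices b" and Q: "finite Q" for F Q
  proof -
    define J where "J = (\<lambda>i. case snd i of None \<Rightarrow> {} | Some j \<Rightarrow> j) ` {i \<in> F. snd i \<noteq> None}"
    have J: "finite J" "J \<subseteq> indices b" "\<And>l j. (l, Some j) \<in> F \<Longrightarrow> j \<in> J"
      using F by (force simp: J_def)+
    define X where "X = insert \<one> (\<Union> J \<union> (\<Union> (set ` Q)))"
    have X: "finite X" "\<Union> J \<subseteq> X" using finite_Union_indices[OF J(1,2)] Q by (auto simp: X_def)
    define \<tau> where "\<tau> x = rprob p J (\<lambda>A. x \<in> reach b {\<one>} A)" for x
    have \<tau>0: "0 \<le> \<tau> x" "\<tau> x \<le> 1" for x using p J by (auto simp: \<tau>_def intro: rexp_nonneg rprob_le_1)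
    have chi_\<tau>: "(\<Sum>x\<in>X - {\<one>}. \<tau> x) = chi b p J"
      unfolding \<tau>_def using J X by (intro chi_eq_sum[symmetric])
    have p_chi: "p * chi b p J \<le> c" using J by (intro c)
    have sum_\<tau>: "(\<Sum>x\<in>X. \<tau> x) \<le> 1 + chi b p J"
    proof -
      have "\<one> \<in> X" by (simp add: X_def)
      then have "(\<Sum>x\<in>X. \<tau> x) = \<tau> \<one> + (\<Sum>x\<in>X - {\<one>}. \<tau> x)" using X by (intro sum.remove)
      then show ?thesis using \<tau>0[of \<one>] by (simp add: chi_\<tau>)
    qed
    let ?L = "words X"
    define en where "en l = rprob p F (\<lambda>A. entered b A l)" for l
    define cl where "cl l = rprob p F (\<lambda>A. l \<in> cluster b A)" for l
    have en0: "0 \<le> en l" and cl0: "0 \<le> cl l" for l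
      using p by (auto simp: en_def cl_def intro: rexp_nonneg)
    have cl_le: "cl (l @ [x]) \<le> en l * \<tau> x" for l x
      unfolding cl_def en_def \<tau>_def using F p J by (intro rprob_snoc_le) auto
    have sumL: "(\<Sum>l\<in>?L (Suc n). g l) = (\<Sum>l\<in>?L n. \<Sum>x\<in>X. g (l @ [x]))" for n and g :: "'a list \<Rightarrow> real"
      using sum_words_append[of g X n 1] by (simp add: sum_words_Suc[where n = 0, simplified])
    have step: "(\<Sum>l\<in>?L (Suc n). cl l) \<le> (\<Sum>l\<in>?L n. en l) * (1 + c / p)" for n
    proof -
      have "(\<Sum>l\<in>?L (Suc n). cl l) \<le> (\<Sum>l\<in>?L n. \<Sum>x\<in>X. en l * \<tau> x)"
        unfolding sumL by (intro sum_mono cl_le)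
      also have "\<dots> = (\<Sum>l\<in>?L n. en l) * (\<Sum>x\<in>X. \<tau> x)"
        by (simp add: sum_product)
      also have "\<dots> \<le> (\<Sum>l\<in>?L n. en l) * (1 + c / p)"
      proof (intro mult_left_mono sum_nonneg en0)
        have "chi b p J \<le> c / p" using p_chi p by (simp add: field_simps)
        then show "(\<Sum>x\<in>X. \<tau> x) \<le> 1 + c / p" using sum_\<tau> by simp
      qed
      finally show ?thesis .
    qed
    have e0: "(\<Sum>l\<in>?L 0. en l) = 1" using F by (simp add: en_def entered_def)
    \<comment> \<open>In the root coset the step \<open>t\<close> can also be taken from
      \<open>\<one>\<close>, which adds \<open>p\<close> to the factor \<open>c\<close>.\<close>
    have e1: "(\<Sum>l\<in>?L 1. en l) \<le> p + c"
    proof -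
      have "(\<Sum>l\<in>?L 1. en l) \<le> (\<Sum>l\<in>?L 1. p * cl l)"
      proof (rule sum_mono)
        fix l assume "l \<in> ?L 1"
        then have "l \<noteq> []" "length l \<le> 1" by (auto simp: words_def)
        then show "en l \<le> p * cl l" using rprob_entered_le[of F p l b] F p by (auto simp: en_def cl_def)
      qed
      also have "\<dots> = p * (\<Sum>l\<in>?L (Suc 0). cl l)" by (simp add: sum_distrib_left)
      also have "\<dots> \<le> p * (1 * (1 + c / p))" using step[of 0] e0 p by (intro mult_left_mono) auto
      also have "\<dots> = p + c" using p by (simp add: field_simps)
      finally show ?thesis .
    qed
    have e_step: "(\<Sum>l\<in>?L (Suc (Suc n)). en l) \<le> c * (\<Sum>l\<in>?L (Suc n). en l)" for n
    proof -
      have "(\<Sum>l\<in>?L (Suc (Suc n)). en l) = (\<Sum>l\<in>?L (Suc n). \<Sum>x\<in>X. en (l @ [x]))" by (rule sumL)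
      also have "\<dots> \<le> (\<Sum>l\<in>?L (Suc n). \<Sum>x\<in>X. if x = \<one> then 0 else p * (en l * \<tau> x))"
      proof (intro sum_mono)
        fix l x assume "l \<in> ?L (Suc n)"
        then have "l \<noteq> []" by (auto simp: words_def)
        then have "en (l @ [x]) \<le> (if x = \<one> then 0 else p * cl (l @ [x]))"
          using rprob_entered_le[of F p "l @ [x]" b] F p by (cases l) (auto simp: en_def cl_def)
        also have "\<dots> \<le> (if x = \<one> then 0 else p * (en l * \<tau> x))"
          using cl_le[of l x] p by (auto intro: mult_left_mono)
        finally show "en (l @ [x]) \<le> (if x = \<one> then 0 else p * (en l * \<tau> x))" .
      qed
      also have "\<dots> = (\<Sum>l\<in>?L (Suc n). \<Sum>x\<in>X - {\<one>}. p * (en l * \<tau> x))"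
        using X by (intro sum.cong refl sum.mono_neutral_cong_right) auto
      also have "\<dots> = p * chi b p J * (\<Sum>l\<in>?L (Suc n). en l)"
        unfolding chi_\<tau>[symmetric] by (simp add: sum_product sum_distrib_left mult_ac) (rule sum.swap)
      also have "\<dots> \<le> c * (\<Sum>l\<in>?L (Suc n). en l)"
        using p_chi by (intro mult_right_mono sum_nonneg en0)
      finally show ?thesis .
    qed
    have e_bound: "(\<Sum>l\<in>?L (Suc n). en l) \<le> (p + c) * c ^ n" for n
    proof (induction n)
      case 0 then show ?case using e1 by simp
    next
      case (Suc n)
      have "(\<Sum>l\<in>?L (Suc (Suc n)). en l) \<le> c * (\<Sum>l\<in>?L (Suc n). en l)" by (rule e_step)
      also have "\<dots> \<le> c * ((p + c) * c ^ n)" using Suc c by (intro mult_left_mono)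
      finally show ?case by (simp add: mult_ac)
    qed
    define N where "N = (\<Sum>l\<in>Q. length l)"
    have Qsub: "Q - {[]} \<subseteq> (\<Union>n\<le>N. ?L (Suc n))"
    proof
      fix l assume l: "l \<in> Q - {[]}"
      then have "length l \<le> N" unfolding N_def using Q by (intro member_le_sum) auto
      moreover have "set l \<subseteq> X" using l by (auto simp: X_def)
      moreover obtain m where "length l = Suc m" using l by (cases l) auto
      ultimately show "l \<in> (\<Union>n\<le>N. ?L (Suc n))" by (auto simp: words_def intro!: bexI[of _ m])
    qed
    have "rexp p F (\<lambda>A. real (card (cluster b A \<inter> Q))) = rexp p F (\<lambda>A. \<Sum>l\<in>Q. of_bool (l \<in> cluster b A))"
      using Q by (simp add: of_bool_def sum.If_cases Int_def conj_commute)
    also have "\<dots> = (\<Sum>l\<in>Q. cl l)" by (simp only: rexp_sum cl_def)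
    also have "\<dots> = (\<Sum>l\<in>Q - {[]}. cl l)"
      using Q F by (intro sum.mono_neutral_right) (auto simp: cl_def)
    also have "\<dots> \<le> (\<Sum>l\<in>(\<Union>n\<le>N. ?L (Suc n)). cl l)"
      using Qsub cl0 X by (intro sum_mono2) (auto intro!: finite_words)
    also have "\<dots> = (\<Sum>n\<le>N. \<Sum>l\<in>?L (Suc n). cl l)"
    proof (rule sum.UNION_disjoint)
      show "\<forall>n\<in>{..N}. finite (?L (Suc n))" using finite_words[OF X(1)] by simp
    qed (auto simp: words_def)
    also have "\<dots> \<le> (\<Sum>n\<le>N. (\<Sum>l\<in>?L n. en l) * (1 + c / p))"
      by (intro sum_mono step)
    also have "\<dots> = (1 + c / p) * (\<Sum>n\<le>N. \<Sum>l\<in>?L n. en l)"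
      by (simp add: sum_distrib_left mult.commute)
    also have "\<dots> \<le> (1 + c / p) * (1 + (p + c) / (1 - c))"
    proof (intro mult_left_mono)
      have "(\<Sum>n\<le>N. \<Sum>l\<in>?L n. en l) \<le> (\<Sum>n\<le>Suc N. \<Sum>l\<in>?L n. en l)"
        by (intro sum_mono2) (auto intro!: sum_nonneg en0)
      also have "\<dots> = 1 + (\<Sum>n\<le>N. \<Sum>l\<in>?L (Suc n). en l)"
        by (subst sum.atMost_Suc_shift) (simp only: e0)
      also have "(\<Sum>n\<le>N. \<Sum>l\<in>?L (Suc n). en l) \<le> (\<Sum>n\<le>N. (p + c) * c ^ n)"
        by (intro sum_mono e_bound)
      also have "\<dots> = (p + c) * ((1 - c ^ Suc N) / (1 - c))"
        using c by (simp add: sum_gp0 flip: sum_distrib_left)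
      also have "\<dots> \<le> (p + c) * (1 / (1 - c))"
        using c p by (intro mult_left_mono divide_right_mono) auto
      finally show "(\<Sum>n\<le>N. \<Sum>l\<in>?L n. en l) \<le> 1 + (p + c) / (1 - c)" by simp
    qed (use c p in auto)
    finally show ?thesis by (simp add: M_def)
  qed
  then show ?thesis using that by blast
qed

text \<open>Survival for \<open>n\<close> generations below \<open>l\<close> of a thinned process.
  The step \<open>t\<close> from \<open>\<one>\<close> is forbidden in the root coset too, so that
  all generations have the same offspring law.\<close>

primrec surv :: "bool \<Rightarrow> 'a set set \<Rightarrow> nat \<Rightarrow> 'a list \<Rightarrow> ('a list \<times> 'a set option) set \<Rightarrow> bool" where
  "surv b J 0 l A = True"
| "surv b J (Suc n) l A = (\<exists>x\<in>(\<Union> J \<inter> carrier G) - {\<one>}. x \<in> reach b {\<one>} (copy A l \<inter> J) \<and>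
     (l @ [x], None) \<in> A \<and> surv b J n (l @ [x]) A)"

primrec surv_ix :: "'a set set \<Rightarrow> nat \<Rightarrow> 'a list \<Rightarrow> ('a list \<times> 'a set option) set" where
  "surv_ix J 0 l = {}"
| "surv_ix J (Suc n) l = (\<lambda>j. (l, Some j)) ` J \<union>
     (\<Union>x\<in>(\<Union> J \<inter> carrier G) - {\<one>}. insert (l @ [x], None) (surv_ix J n (l @ [x])))"

lemma surv_ix_prefix: "i \<in> surv_ix J n l \<Longrightarrow> (\<exists>r. fst i = l @ r) \<and> i \<noteq> (l, None)"
proof (induction n arbitrary: l)
  case (Suc n)
  from Suc.prems consider (coset) j where "i = (l, Some j)" | (step) x where "i = (l @ [x], None)"
    | (rec) x where "i \<in> surv_ix J n (l @ [x])"
    by auto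
  then show ?case
  proof cases
    case rec
    from Suc.IH[OF this] show ?thesis by auto
  qed auto
qed simp

lemma surv_depends: "(\<And>i. i \<in> surv_ix J n l \<Longrightarrow> i \<in> A \<longleftrightarrow> i \<in> B) \<Longrightarrow> surv b J n l A \<longleftrightarrow> surv b J n l B"
proof (induction n arbitrary: l)
  case (Suc n)
  let ?X = "(\<Union> J \<inter> carrier G) - {\<one>}"
  have "copy A l \<inter> J = copy B l \<inter> J" using Suc.prems by (auto simp: copy_def)
  moreover have "surv b J n (l @ [x]) A \<longleftrightarrow> surv b J n (l @ [x]) B" if "x \<in> ?X" for x
    using that by (intro Suc.IH Suc.prems) auto
  moreover have "(l @ [x], None) \<in> A \<longleftrightarrow> (l @ [x], None) \<in> B" if "x \<in> ?X" for x
    using that by (intro Suc.prems) auto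
  ultimately show ?case by simp
qed simp

lemma finite_surv_ix: "finite J \<Longrightarrow> J \<subseteq> indices b \<Longrightarrow> finite (surv_ix J n l)"
  using finite_Union_indices by (induction n arbitrary: l) auto

text \<open>One generation of the branching process: \<open>s\<close> is the survival probability
  below a child, which is entered with probability \<open>p\<close>.\<close>

definition survival :: "bool \<Rightarrow> real \<Rightarrow> 'a set set \<Rightarrow> real \<Rightarrow> real" where
  "survival b p J s = rexp p J (\<lambda>A. 1 - (1 - p * s) ^ card (reach b {\<one>} A - {\<one>}))"

text \<open>Given the cluster in the coset of \<open>l\<close>, the subtrees of different children
  use disjoint index sets and survive independently.\<close>

lemma rprob_surv_Suc:
  assumes J: "finite J" "J \<subseteq> indices b" and s: "\<And>x. rprob p (surv_ix J n (l @ [x])) (surv b J n (l @ [x])) = s"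
  shows "rprob p (surv_ix J (Suc n) l) (surv b J (Suc n) l) = survival b p J s"
proof -
  let ?X = "(\<Union> J \<inter> carrier G) - {\<one>}"
  let ?f = "\<lambda>j. (l, Some j)"
  let ?H = "\<lambda>x. insert (l @ [x], None) (surv_ix J n (l @ [x]))"
  let ?U = "\<Union>x\<in>?X. ?H x"
  have X: "finite ?X" using finite_Union_indices[OF J] by auto
  have H: "finite (?H x)" for x using J by (simp add: finite_surv_ix)
  have pre: "\<exists>r. fst i = (l @ [x]) @ r" if "i \<in> ?H x" for i x
    using that surv_ix_prefix[of i J n "l @ [x]"] by auto
  have disjH: "disjoint_family_on ?H ?X"
    unfolding disjoint_family_on_def
  proof (intro ballI impI)
    fix x y :: 'a assume "x \<noteq> y"
    show "?H x \<inter> ?H y = {}"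
    proof (rule ccontr)
      assume "?H x \<inter> ?H y \<noteq> {}"
      then obtain i where "i \<in> ?H x" "i \<in> ?H y" by blast
      from pre[OF this(1)] pre[OF this(2)] \<open>x \<noteq> y\<close> show False by auto
    qed
  qed
  have dis: "?f ` J \<inter> ?U = {}"
  proof (rule ccontr)
    assume "?f ` J \<inter> ?U \<noteq> {}"
    then obtain j x where "(l, Some j) \<in> ?H x" by blast
    from pre[OF this] show False by simp
  qed
  have sH: "rprob p (?H x) (\<lambda>B. (l @ [x], None) \<in> B \<and> surv b J n (l @ [x]) B) = p * s" for x
  proof -
    have notin: "(l @ [x], None) \<notin> surv_ix J n (l @ [x])" using surv_ix_prefix by blast
    have "rprob p (?H x) (\<lambda>B. (l @ [x], None) \<in> B \<and> surv b J n (l @ [x]) B)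
       = p * rprob p (surv_ix J n (l @ [x])) (\<lambda>B. surv b J n (l @ [x]) (insert (l @ [x], None) B))
         + (1 - p) * rprob p (surv_ix J n (l @ [x])) (\<lambda>B. (l @ [x], None) \<in> B \<and> surv b J n (l @ [x]) B)"
      using notin J by (simp add: rexp_insert finite_surv_ix)
    also have "rprob p (surv_ix J n (l @ [x])) (\<lambda>B. (l @ [x], None) \<in> B \<and> surv b J n (l @ [x]) B) = rexp p (surv_ix J n (l @ [x])) (\<lambda>_. 0)"
      using notin by (intro rexp_cong) auto
    also have "rprob p (surv_ix J n (l @ [x])) (\<lambda>B. surv b J n (l @ [x]) (insert (l @ [x], None) B))
        = rprob p (surv_ix J n (l @ [x])) (surv b J n (l @ [x]))"
    proof (rule rexp_cong)
      fix B
      have "surv b J n (l @ [x]) (insert (l @ [x], None) B) = surv b J n (l @ [x]) B"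
        using notin by (intro surv_depends) auto
      then show "(of_bool (surv b J n (l @ [x]) (insert (l @ [x], None) B)) :: real) = of_bool (surv b J n (l @ [x]) B)" by simp
    qed
    finally show ?thesis using s J by (simp add: finite_surv_ix)
  qed
  have inner: "rprob p ?U (\<lambda>B. surv b J (Suc n) l (?f ` A \<union> B)) = 1 - (1 - p * s) ^ card (reach b {\<one>} A - {\<one>})"
    if A: "A \<subseteq> J" for A
  proof -
    let ?R = "reach b {\<one>} A"
    have RX: "?R - {\<one>} \<subseteq> ?X"
      using reach_subset[of b "{\<one>}" A] reach_closed[of "{\<one>}" b A] Union_mono[OF A] by auto
    let ?g = "\<lambda>x B. 1 - of_bool (x \<in> ?R) * of_bool ((l @ [x], None) \<in> B \<and> surv b J n (l @ [x]) B) :: real"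
    have "rprob p ?U (\<lambda>B. surv b J (Suc n) l (?f ` A \<union> B)) = rexp p ?U (\<lambda>B. 1 - (\<Prod>x\<in>?X. ?g x (B \<inter> ?H x)))"
    proof (rule rexp_cong)
      fix B assume B: "B \<subseteq> ?U"
      have nB: "(l, Some j) \<notin> B" for j
      proof
        assume "(l, Some j) \<in> B"
        then obtain x where "(l, Some j) \<in> ?H x" using B by auto
        from pre[OF this] show False by simp
      qed
      have c: "copy (?f ` A \<union> B) l \<inter> J = A" using A nB by (auto simp: copy_def)
      have sv: "surv b J n (l @ [x]) (?f ` A \<union> B) = surv b J n (l @ [x]) (B \<inter> ?H x)" if "x \<in> ?X" for x
      proof (rule surv_depends)
        fix i assume i: "i \<in> surv_ix J n (l @ [x])"
        then have "i \<notin> ?f ` A" using surv_ix_prefix[OF i] by auto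
        then show "i \<in> ?f ` A \<union> B \<longleftrightarrow> i \<in> B \<inter> ?H x" using i by auto
      qed
      have "surv b J (Suc n) l (?f ` A \<union> B) \<longleftrightarrow> (\<exists>x\<in>?X. x \<in> ?R \<and> (l @ [x], None) \<in> B \<inter> ?H x \<and> surv b J n (l @ [x]) (B \<inter> ?H x))"
        using sv c by auto
      moreover have "(\<Prod>x\<in>?X. ?g x (B \<inter> ?H x)) = (if \<exists>x\<in>?X. x \<in> ?R \<and> (l @ [x], None) \<in> B \<inter> ?H x \<and> surv b J n (l @ [x]) (B \<inter> ?H x) then 0 else 1)"
        using X by (auto intro!: prod.neutral simp: prod_zero_iff)
      ultimately show "(of_bool (surv b J (Suc n) l (?f ` A \<union> B)) :: real) = 1 - (\<Prod>x\<in>?X. ?g x (B \<inter> ?H x))"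
        by simp
    qed
    also have "\<dots> = 1 - rexp p ?U (\<lambda>B. \<Prod>x\<in>?X. ?g x (B \<inter> ?H x))"
      using X H by (subst rexp_diff) simp
    also have "rexp p ?U (\<lambda>B. \<Prod>x\<in>?X. ?g x (B \<inter> ?H x)) = (\<Prod>x\<in>?X. rexp p (?H x) (?g x))"
      using X H disjH by (intro rexp_prod_disjoint)
    also have "\<dots> = (\<Prod>x\<in>?X. 1 - of_bool (x \<in> ?R) * (p * s))"
      using H by (intro prod.cong refl) (simp only: rexp_diff rexp_cmult sH rexp_const)
    also have "\<dots> = (\<Prod>x\<in>?R - {\<one>}. 1 - p * s)"
      using X RX by (intro prod.mono_neutral_cong_right) auto
    finally show ?thesis by simp
  qed
  have "rprob p (surv_ix J (Suc n) l) (surv b J (Suc n) l) = rprob p (?f ` J \<union> ?U) (surv b J (Suc n) l)" by simp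
  also have "\<dots> = rexp p (?f ` J) (\<lambda>A. rprob p ?U (\<lambda>B. surv b J (Suc n) l (A \<union> B)))"
    using J X H dis by (intro rexp_union) auto
  also have "\<dots> = rexp p J (\<lambda>A. rprob p ?U (\<lambda>B. surv b J (Suc n) l (?f ` A \<union> B)))"
    using J by (intro rexp_image) (auto simp: inj_on_def)
  also have "\<dots> = survival b p J s"
    unfolding survival_def by (intro rexp_cong inner)
  finally show ?thesis .
qed

text \<open>The map \<open>survival\<close> has slope \<open>m > 1\<close> at 0 and a quadratic
  error, so for small \<open>e\<close> it maps the interval from \<open>e\<close> to 1 into itself,
  and the bound passes to all generations.\<close>

lemma supercritical_survival:
  assumes sup: "supercritical b p" and p: "0 < p" "p \<le> 1"
  obtains J e where "finite J" "J \<subseteq> indices b" "e > 0" "\<And>n l. e \<le> rprob p (surv_ix J n l) (surv b J n l)"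
proof -
  obtain J where J: "finite J" "J \<subseteq> indices b" "1 < p * chi b p J" using sup by (auto simp: supercritical_def)
  define K where "K = card (\<Union> J)"
  have finU: "finite (\<Union> J)" using finite_Union_indices[OF J(1,2)] .
  define m where "m = p * chi b p J"
  \<comment> \<open>Chosen so that the surplus \<open>(m - 1) * e\<close> outweighs the error
    \<open>(K * e)^2\<close>.\<close>
  define e where "e = min 1 ((m - 1) / (real K ^ 2 + 1))"
  have e: "0 < e" "e \<le> 1" "e * (real K)\<^sup>2 \<le> m - 1"
  proof -
    show "0 < e" "e \<le> 1" using J by (auto simp: e_def m_def add_nonneg_pos)
    have "e * (real K)\<^sup>2 \<le> e * ((real K)\<^sup>2 + 1)" using \<open>0 < e\<close> by (intro mult_left_mono) auto
    also have "\<dots> \<le> (m - 1) / (real K ^ 2 + 1) * ((real K)\<^sup>2 + 1)"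
      unfolding e_def by (intro mult_right_mono) auto
    also have "\<dots> = m - 1"
    proof -
      have "(real K)\<^sup>2 + 1 > 0" by (simp add: add_nonneg_pos)
      then show ?thesis by simp
    qed
    finally show "e * (real K)\<^sup>2 \<le> m - 1" .
  qed
  have card_le: "card (reach b {\<one>} A - {\<one>}) \<le> K" if "A \<subseteq> J" for A
    unfolding K_def using reach_subset[of b "{\<one>}" A] that finU by (intro card_mono) auto
  have step: "e \<le> survival b p J s" if s: "e \<le> s" "s \<le> 1" for s
  proof -
    have pe: "0 \<le> p * e" "p * e \<le> 1" using e p by (auto intro: mult_le_one)
    have "e \<le> m * e - e\<^sup>2 * (real K)\<^sup>2"
      using mult_left_mono[OF e(3), of e] e(1) by (simp add: power2_eq_square algebra_simps)
    also have "\<dots> = rexp p J (\<lambda>A. p * e * real (card (reach b {\<one>} A - {\<one>})) - e\<^sup>2 * (real K)\<^sup>2)"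
      using J by (simp add: rexp_diff rexp_cmult m_def chi_def mult_ac)
    also have "\<dots> \<le> survival b p J s"
      unfolding survival_def
    proof (intro rexp_mono)
      fix A assume A: "A \<subseteq> J"
      let ?k = "card (reach b {\<one>} A - {\<one>})"
      have "(1 - p * s) ^ ?k \<le> (1 - p * e) ^ ?k"
        using s p e by (intro power_mono) (auto intro: mult_left_mono mult_le_one)
      also have "\<dots> \<le> 1 - real ?k * (p * e) + (real ?k * (p * e))\<^sup>2"
        using pe by (rule one_minus_power_le)
      also have "(real ?k * (p * e))\<^sup>2 \<le> (real K * (1 * e))\<^sup>2"
        using card_le[OF A] p e by (intro power_mono mult_mono) auto
      finally show "p * e * real ?k - e\<^sup>2 * (real K)\<^sup>2 \<le> 1 - (1 - p * s) ^ ?k"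
        by (simp add: power_mult_distrib algebra_simps)
    qed (use p in auto)
    finally show ?thesis .
  qed
  have ex: "\<exists>s. e \<le> s \<and> s \<le> 1 \<and> (\<forall>l. rprob p (surv_ix J n l) (surv b J n l) = s)" for n
  proof (induction n)
    case 0 then show ?case using e by (intro exI[of _ 1]) simp
  next
    case (Suc n)
    then obtain s where s: "e \<le> s" "s \<le> 1" "\<And>l. rprob p (surv_ix J n l) (surv b J n l) = s" by auto
    have eq: "rprob p (surv_ix J (Suc n) l) (surv b J (Suc n) l) = survival b p J s" for l
      using J s by (intro rprob_surv_Suc) auto
    moreover have "survival b p J s \<le> 1"
      using eq[of "[]"] rprob_le_1[OF finite_surv_ix[OF J(1,2)], of p "Suc n" "[]" "surv b J (Suc n) []"] p by simp
    ultimately show ?case using step[OF s(1,2)] by blast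
  qed
  have "e \<le> rprob p (surv_ix J n l) (surv b J n l)" for n l using ex[of n] by auto
  then show ?thesis using that[of J e] J e by blast
qed

lemma surv_imp_cluster:
  assumes "surv b J n l A" "entered b A l"
  shows "\<exists>r. length r = n \<and> entered b A (l @ r)"
  using assms
proof (induction n arbitrary: l)
  case (Suc n)
  then obtain x where x: "x \<noteq> \<one>" "x \<in> reach b {\<one>} (copy A l \<inter> J)" "(l @ [x], None) \<in> A" "surv b J n (l @ [x]) A"
    by auto
  have "x \<in> reach b {\<one>} (copy A l)" using x reach_mono[of "copy A l \<inter> J" "copy A l" b "{\<one>}"] by auto
  then have "entered b A (l @ [x])" using x Suc.prems by (simp add: entered_def[of _ _ "l @ [x]"] snoc_in_cluster)
  from Suc.IH[OF x(4) this] obtain r where "length r = n" "entered b A ((l @ [x]) @ r)" by auto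
  then show ?case by (intro exI[of _ "x # r"]) simp
qed simp

lemma infinite_cluster_of_surv: assumes "\<And>n. surv b J n [] A" shows "infinite (cluster b A)"
proof
  assume fin: "finite (cluster b A)"
  obtain r where r: "length r = Suc (Max (length ` cluster b A))" "entered b A r"
    using surv_imp_cluster[OF assms, of "Suc (Max (length ` cluster b A))"] by (auto simp: entered_def)
  then have "r \<in> cluster b A" by (auto simp: entered_def)
  then have "length r \<le> Max (length ` cluster b A)" using fin by simp
  then show False using r by simp
qed

end

section \<open>Bernoulli configurations\<close>

lemma bernoulli_cylinder:
  fixes K :: "'i set"
  assumes p: "0 \<le> p" "p \<le> 1" and K: "finite K" "K \<subseteq> I"
  shows "{\<xi> \<in> space (bernoulli_config I p). Q {i \<in> K. \<xi> i}} \<in> sets (bernoulli_config I p)"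
    and "measure (bernoulli_config I p) {\<xi> \<in> space (bernoulli_config I p). Q {i \<in> K. \<xi> i}} = rprob p K Q"
proof -
  define N where "N = (\<lambda>_::'i. measure_pmf (bernoulli_pmf p))"
  interpret product_prob_space N I
    unfolding N_def by unfold_locales
  have M: "bernoulli_config I p = PiM I N" by (simp add: bernoulli_config_def N_def)
  define C where "C A = {\<xi> \<in> space (PiM I N). {i \<in> K. \<xi> i} = A}" for A
  have C_eq: "C A = prod_emb I N K (\<Pi>\<^sub>E i\<in>K. {i \<in> A})" if "A \<subseteq> K" for A
    using that K unfolding C_def by (auto simp: prod_emb_def space_PiM N_def PiE_iff extensional_def restrict_def)
  have C_sets: "C A \<in> sets (PiM I N)" if "A \<subseteq> K" for A
    unfolding C_eq[OF that] using K by (intro sets_PiM_I) (auto simp: N_def)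
  have C_measure: "measure (PiM I N) (C A) = p ^ card A * (1 - p) ^ card (K - A)" if A: "A \<subseteq> K" for A
  proof -
    have "measure (PiM I N) (C A) = (\<Prod>i\<in>K. measure (N i) {i \<in> A})"
      unfolding C_eq[OF A] using K by (intro measure_PiM_emb) (auto simp: N_def)
    also have "\<dots> = (\<Prod>i\<in>K. if i \<in> A then p else 1 - p)"
      using p by (intro prod.cong refl) (auto simp: measure_pmf_single N_def)
    also have "\<dots> = p ^ card A * (1 - p) ^ card (K - A)"
      using K A by (simp add: prod.If_cases Int_absorb1 Diff_eq)
    finally show ?thesis .
  qed
  let ?P = "{A \<in> Pow K. Q A}"
  have un: "{\<xi> \<in> space (PiM I N). Q {i \<in> K. \<xi> i}} = (\<Union>A\<in>?P. C A)" by (auto simp: C_def)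
  have finP: "finite ?P" using K by simp
  show "{\<xi> \<in> space (bernoulli_config I p). Q {i \<in> K. \<xi> i}} \<in> sets (bernoulli_config I p)"
    unfolding M un using finP C_sets by (intro sets.finite_UN) auto
  have "measure (PiM I N) (\<Union>A\<in>?P. C A) = (\<Sum>A\<in>?P. measure (PiM I N) (C A))"
    using finP C_sets by (intro P.finite_measure_finite_Union) (auto simp: disjoint_family_on_def C_def)
  also have "\<dots> = (\<Sum>A\<in>?P. p ^ card A * (1 - p) ^ card (K - A))"
    using C_measure by (intro sum.cong) auto
  also have "\<dots> = rprob p K Q"
    unfolding rexp_def using K by (intro sum.mono_neutral_cong_left) auto
  finally show "measure (bernoulli_config I p) {\<xi> \<in> space (bernoulli_config I p). Q {i \<in> K. \<xi> i}} = rprob p K Q"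
    unfolding M un .
qed

lemma prob_space_bernoulli_config: "prob_space (bernoulli_config I p)"
  unfolding bernoulli_config_def by (intro prob_space_PiM) (rule prob_space_measure_pmf)

text \<open>The map \<open>e\<close> sends an abstract index to the site or bond it stands for, so
  that the process on lists can be read off a configuration of the Cayley graph.\<close>

locale bernoulli_embedding =
  fixes I :: "'i set" and D :: "'d set" and e :: "'d \<Rightarrow> 'i" and p :: real
  assumes inj: "inj_on e D" and into: "e ` D \<subseteq> I" and countable_D: "countable D"
    and p: "0 < p" "p \<le> 1"
begin

abbreviation "M \<equiv> bernoulli_config I p"

definition pull :: "('i \<Rightarrow> bool) \<Rightarrow> 'd set" where
  "pull \<xi> = {d \<in> D. \<xi> (e d)}"

sublocale prob_space M by (rule prob_space_bernoulli_config)

text \<open>The set \<open>R\<close> holds coordinates that stand for no abstract index and are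
  required to be open. In site percolation this is the root.\<close>

lemma cylinder:
  assumes F: "finite F" "F \<subseteq> D" and R: "finite R" "R \<subseteq> I" "R \<inter> e ` D = {}"
  shows "{\<xi> \<in> space M. (\<forall>r\<in>R. \<xi> r) \<and> Q (pull \<xi> \<inter> F)} \<in> sets M"
    and "measure M {\<xi> \<in> space M. (\<forall>r\<in>R. \<xi> r) \<and> Q (pull \<xi> \<inter> F)} = p ^ card R * rprob p F Q"
proof -
  let ?K = "R \<union> e ` F"
  let ?Q = "\<lambda>B. R \<subseteq> B \<and> Q {d \<in> F. e d \<in> B}"
  have K: "finite ?K" "?K \<subseteq> I" using F R subset_trans[OF image_mono[OF F(2)] into] by auto
  have injF: "inj_on e F" using inj F inj_on_subset by blast
  have eq: "{\<xi> \<in> space M. (\<forall>r\<in>R. \<xi> r) \<and> Q (pull \<xi> \<inter> F)} = {\<xi> \<in> space M. ?Q {i \<in> ?K. \<xi> i}}"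
  proof -
    have "{d \<in> F. e d \<in> {i \<in> ?K. \<xi> i}} = pull \<xi> \<inter> F" for \<xi> using F by (auto simp: pull_def)
    moreover have "(R \<subseteq> {i \<in> ?K. \<xi> i}) = (\<forall>r\<in>R. \<xi> r)" for \<xi> by auto
    ultimately show ?thesis by simp
  qed
  show "{\<xi> \<in> space M. (\<forall>r\<in>R. \<xi> r) \<and> Q (pull \<xi> \<inter> F)} \<in> sets M"
    unfolding eq using p K by (intro bernoulli_cylinder) auto
  have "measure M {\<xi> \<in> space M. (\<forall>r\<in>R. \<xi> r) \<and> Q (pull \<xi> \<inter> F)} = rprob p ?K ?Q"
    unfolding eq using p K by (intro bernoulli_cylinder) auto
  also have "\<dots> = rexp p ?K (\<lambda>B. of_bool (R \<subseteq> B \<inter> R) * of_bool (Q {d \<in> F. e d \<in> B \<inter> e ` F}))"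
  proof (intro rexp_cong)
    fix B
    have "{d \<in> F. e d \<in> B \<inter> e ` F} = {d \<in> F. e d \<in> B}" by auto
    then show "of_bool (?Q B) = (of_bool (R \<subseteq> B \<inter> R) * of_bool (Q {d \<in> F. e d \<in> B \<inter> e ` F}) :: real)" by auto
  qed
  also have "\<dots> = rprob p R (\<lambda>B. R \<subseteq> B) * rprob p (e ` F) (\<lambda>B. Q {d \<in> F. e d \<in> B})"
    using F R by (intro rexp_product[where g = "\<lambda>B. of_bool (R \<subseteq> B)" and h = "\<lambda>B. of_bool (Q {d \<in> F. e d \<in> B})"]) auto
  also have "rprob p R (\<lambda>B. R \<subseteq> B) = p ^ card R" using R by (simp add: rprob_superset)
  also have "rprob p (e ` F) (\<lambda>B. Q {d \<in> F. e d \<in> B}) = rprob p F (\<lambda>A. Q {d \<in> F. e d \<in> e ` A})"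
    using F injF by (intro rexp_image)
  also have "\<dots> = rprob p F Q"
  proof (rule rexp_cong)
    fix A assume "A \<subseteq> F"
    then have "{d \<in> F. e d \<in> e ` A} = A" using injF by (auto dest: inj_onD)
    then show "(of_bool (Q {d \<in> F. e d \<in> e ` A}) :: real) = of_bool (Q A)" by simp
  qed
  finally show "measure M {\<xi> \<in> space M. (\<forall>r\<in>R. \<xi> r) \<and> Q (pull \<xi> \<inter> F)} = p ^ card R * rprob p F Q" .
qed

definition exhaust :: "nat \<Rightarrow> 'd set" where
  "exhaust n = {d \<in> D. to_nat_on D d \<le> n}"

lemma exhaust: "finite (exhaust n)" "exhaust n \<subseteq> D" "m \<le> n \<Longrightarrow> exhaust m \<subseteq> exhaust n"
proof -
  show "finite (exhaust n)"
  proof (rule inj_on_finite)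
    show "inj_on (to_nat_on D) (exhaust n)"
      using inj_on_to_nat_on[OF countable_D] by (rule inj_on_subset) (auto simp: exhaust_def)
    show "to_nat_on D ` exhaust n \<subseteq> {..n}" by (auto simp: exhaust_def)
  qed simp
qed (auto simp: exhaust_def)

lemma finite_subset_exhaust: assumes "finite B" "B \<subseteq> D" shows "\<exists>n. B \<subseteq> exhaust n"
proof (intro exI subsetI)
  fix d assume "d \<in> B"
  then have "to_nat_on D d \<le> Max (to_nat_on D ` B)" using assms by simp
  then show "d \<in> exhaust (Max (to_nat_on D ` B))" using assms \<open>d \<in> B\<close> by (auto simp: exhaust_def)
qed

end

section \<open>Infinite clusters as limits of finite events\<close>

context involution_marked begin

lemma reach_finitary:
  assumes "x \<in> reach b {\<one>} A" shows "\<exists>B. finite B \<and> B \<subseteq> A \<and> x \<in> reach b {\<one>} B"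
proof -
  obtain w where w: "set w \<subseteq> S" "set (path_ix b \<one> w) \<subseteq> A" "x = wprod G w"
    using reach_imp_path[OF assms] by blast
  have "\<one> \<otimes> wprod G w \<in> reach b {\<one>} (set (path_ix b \<one> w))"
    using w reach_start[of "{\<one>}"] by (intro reach_path) auto
  then show ?thesis using w S_closed by (intro exI[of _ "set (path_ix b \<one> w)"]) auto
qed

lemma cluster_finitary:
  assumes "l \<in> cluster b A" shows "\<exists>B. finite B \<and> B \<subseteq> A \<and> l \<in> cluster b B"
  using assms
proof induction
  case (start x)
  obtain B where B: "finite B" "B \<subseteq> copy A []" "x \<in> reach b {\<one>} B"
    using reach_finitary[OF start] by auto
  let ?B = "(\<lambda>j. ([], Some j)) ` B"
  have "copy ?B [] = B" by (auto simp: copy_def)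
  then have "[x] \<in> cluster b ?B" using B by (intro cluster.start) simp
  then show ?case using B by (intro exI[of _ ?B]) (auto simp: copy_def)
next
  case (extend l x)
  then obtain B1 where B1: "finite B1" "B1 \<subseteq> A" "l \<in> cluster b B1" by blast
  obtain B where B: "finite B" "B \<subseteq> copy A l" "x \<in> reach b {\<one>} B"
    using reach_finitary[OF extend(4)] by auto
  let ?B = "insert (l, None) ((\<lambda>j. (l, Some j)) ` B \<union> B1)"
  have "B \<subseteq> copy ?B l" by (auto simp: copy_def)
  then have "x \<in> reach b {\<one>} (copy ?B l)" by (rule subsetD[OF reach_mono B(3)])
  moreover have "l \<in> cluster b ?B" using B1 cluster_mono[of l b B1 ?B] by auto
  ultimately have "l @ [x] \<in> cluster b ?B" using extend by (intro cluster.extend) auto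
  then show ?case using B B1 extend by (intro exI[of _ ?B]) (auto simp: copy_def)
qed

text \<open>Having at least \<open>K\<close> elements is witnessed by finitely many open indices,
  unlike being infinite, which is the conjunction over all \<open>K\<close>.\<close>

definition large :: "bool \<Rightarrow> nat \<Rightarrow> ('a list \<times> 'a set option) set \<Rightarrow> bool" where
  "large b K A \<longleftrightarrow> (\<exists>Q\<subseteq>cluster b A. finite Q \<and> card Q = K)"

lemma infinite_cluster_iff: "infinite (cluster b A) \<longleftrightarrow> (\<forall>K. large b K A)"
proof
  assume "infinite (cluster b A)"
  then show "\<forall>K. large b K A" unfolding large_def using infinite_arbitrarily_large by metis
next
  assume *: "\<forall>K. large b K A"
  show "infinite (cluster b A)"
  proof
    assume fin: "finite (cluster b A)"
    obtain Q where "Q \<subseteq> cluster b A" "card Q = Suc (card (cluster b A))"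
      using *[rule_format, of "Suc (card (cluster b A))"] by (auto simp: large_def)
    then show False using card_mono[OF fin, of Q] by simp
  qed
qed

lemma large_mono: assumes "large b K A" "A \<subseteq> B" shows "large b K B"
proof -
  obtain Q where Q: "Q \<subseteq> cluster b A" "finite Q" "card Q = K" using assms by (auto simp: large_def)
  have "Q \<subseteq> cluster b B" using cluster_mono[OF _ assms(2)] Q(1) by auto
  then show ?thesis using Q unfolding large_def by auto
qed

lemma large_finitary: assumes "large b K A" shows "\<exists>B. finite B \<and> B \<subseteq> A \<and> large b K B"
proof -
  obtain Q where Q: "Q \<subseteq> cluster b A" "finite Q" "card Q = K" using assms by (auto simp: large_def)
  have "\<forall>l\<in>Q. \<exists>B. finite B \<and> B \<subseteq> A \<and> l \<in> cluster b B"
  proof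
    fix l assume "l \<in> Q"
    then have "l \<in> cluster b A" using Q by auto
    then show "\<exists>B. finite B \<and> B \<subseteq> A \<and> l \<in> cluster b B" by (rule cluster_finitary)
  qed
  from bchoice[OF this] obtain B where B: "\<And>l. l \<in> Q \<Longrightarrow> finite (B l) \<and> B l \<subseteq> A \<and> l \<in> cluster b (B l)" by auto
  have "l \<in> cluster b (\<Union>l\<in>Q. B l)" if "l \<in> Q" for l
    using B[OF that] that by (rule_tac cluster_mono[of l b "B l"]) auto
  then have "Q \<subseteq> cluster b (\<Union>l\<in>Q. B l)" by auto
  then have "large b K (\<Union>l\<in>Q. B l)" unfolding large_def using Q by auto
  then show ?thesis using B Q by (intro exI[of _ "\<Union>l\<in>Q. B l"]) auto
qed

text \<open>Markov's inequality for the cluster size. The set \<open>Q\<close> collects one witness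
  of size \<open>K\<close> for each configuration, since the expectation bound concerns the cluster
  inside a finite set.\<close>

lemma rprob_large_le:
  assumes F: "finite F" "0 \<le> p" "p \<le> 1" and K: "K > 0"
    and M: "\<And>Q. finite Q \<Longrightarrow> rexp p F (\<lambda>A. real (card (cluster b A \<inter> Q))) \<le> M"
  shows "rprob p F (large b K) \<le> M / real K"
proof -
  define W where "W A = (SOME Q. Q \<subseteq> cluster b A \<and> finite Q \<and> card Q = K)" for A
  have W: "W A \<subseteq> cluster b A \<and> finite (W A) \<and> card (W A) = K" if "large b K A" for A
    unfolding W_def by (rule someI_ex) (use that in \<open>auto simp: large_def\<close>)
  define Q where "Q = (\<Union>A\<in>{A \<in> Pow F. large b K A}. W A)"
  have Q: "finite Q" unfolding Q_def using F W by auto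
  have "real K * rprob p F (large b K) = rexp p F (\<lambda>A. real K * of_bool (large b K A))"
    by (simp only: rexp_cmult)
  also have "\<dots> \<le> rexp p F (\<lambda>A. real (card (cluster b A \<inter> Q)))"
  proof (intro rexp_mono F)
    fix A assume A: "A \<subseteq> F"
    show "real K * of_bool (large b K A) \<le> real (card (cluster b A \<inter> Q))"
    proof (cases "large b K A")
      case True
      have "W A \<subseteq> cluster b A \<inter> Q" using W[OF True] True A by (auto simp: Q_def)
      then have "card (W A) \<le> card (cluster b A \<inter> Q)" using Q by (intro card_mono) auto
      then show ?thesis using True W[OF True] by simp
    qed simp
  qed
  also have "\<dots> \<le> M" using Q by (rule M)
  finally show ?thesis using K by (simp add: field_simps)
qed

end

locale cluster_embedding = involution_marked G S + bernoulli_embedding I D e p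
  for G :: "('a, 'b) monoid_scheme" (structure) and S
    and I :: "'i set" and D :: "('a list \<times> 'a set option) set" and e and p +
  fixes b :: bool
  assumes D_indices: "\<And>l j. (l, Some j) \<in> D \<Longrightarrow> j \<in> indices b"
begin

lemma large_iff_exhaust: "large b K (pull \<xi>) \<longleftrightarrow> (\<exists>n. large b K (pull \<xi> \<inter> exhaust n))"
proof
  assume l: "large b K (pull \<xi>)"
  obtain B where B: "finite B" "B \<subseteq> pull \<xi>" "large b K B" using large_finitary[OF l] by auto
  then have "B \<subseteq> D" by (auto simp: pull_def)
  then obtain n where "B \<subseteq> exhaust n" using finite_subset_exhaust[OF B(1)] by auto
  then have "large b K (pull \<xi> \<inter> exhaust n)" using B by (intro large_mono[OF B(3)]) auto
  then show "\<exists>n. large b K (pull \<xi> \<inter> exhaust n)" ..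
next
  assume "\<exists>n. large b K (pull \<xi> \<inter> exhaust n)"
  then show "large b K (pull \<xi>)" by (auto elim: large_mono)
qed

lemma subcritical_measure:
  assumes sub: "subcritical b p" and E: "\<And>\<xi>. \<xi> \<in> E \<Longrightarrow> \<xi> \<in> space M \<and> infinite (cluster b (pull \<xi>))"
  shows "measure M E = 0"
proof (cases "E \<in> sets M")
  \<comment> \<open>\<open>measure\<close> is 0 on sets that are not measurable.\<close>
  case False then show ?thesis by (rule measure_notin_sets)
next
  case True
  obtain C where C: "\<And>F Q. finite F \<Longrightarrow> (\<And>l j. (l, Some j) \<in> F \<Longrightarrow> j \<in> indices b) \<Longrightarrow> finite Q \<Longrightarrow>
    rexp p F (\<lambda>A. real (card (cluster b A \<inter> Q))) \<le> C"
    by (rule subcritical_cluster_bound[OF sub p]) (rule that, blast)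
  have "measure M E \<le> C / real K" if K: "K > 0" for K
  proof -
    define V where "V n = {\<xi> \<in> space M. (\<forall>r\<in>{}. \<xi> r) \<and> large b K (pull \<xi> \<inter> exhaust n)}" for n
    have V: "V n \<in> sets M" "measure M (V n) = rprob p (exhaust n) (large b K)" for n
      unfolding V_def using cylinder[of "exhaust n" "{}"] exhaust by auto
    have "rprob p (exhaust n) (large b K) \<le> C / real K" for n
      using exhaust[of n] p K D_indices by (intro rprob_large_le C) auto
    then have bound: "measure M (V n) \<le> C / real K" for n using V by simp
    have inc: "incseq V"
      unfolding V_def by (intro monoI) (auto elim!: large_mono dest: subsetD[OF exhaust(3)])
    have "E \<subseteq> (\<Union>n. V n)"
    proof
      fix \<xi> assume x: "\<xi> \<in> E"
      then have "large b K (pull \<xi>)" using E[OF x] by (simp add: infinite_cluster_iff)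
      then show "\<xi> \<in> (\<Union>n. V n)" using E[OF x] large_iff_exhaust by (auto simp: V_def)
    qed
    then have "measure M E \<le> measure M (\<Union>n. V n)"
      using V by (intro finite_measure_mono) auto
    also have "\<dots> \<le> C / real K"
    proof (rule LIMSEQ_le_const2)
      show "(\<lambda>n. measure M (V n)) \<longlonglongrightarrow> measure M (\<Union>n. V n)"
        using V inc by (intro finite_Lim_measure_incseq) auto
    qed (use bound in auto)
    finally show ?thesis .
  qed
  then have "measure M E \<le> 0"
  proof (intro LIMSEQ_le_const[where X = "\<lambda>n. C / real n" and x = 0])
    show "(\<lambda>n. C / real n) \<longlonglongrightarrow> 0" by (rule lim_const_over_n)
  qed (auto intro!: exI[of _ 1])
  then show ?thesis by (simp add: measure_le_0_iff)
qed

text \<open>The events of survival to generation \<open>n\<close> decrease with \<open>n\<close> and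
  have probability at least \<open>p ^ card R * c\<close>; on their intersection the cluster is
  infinite.\<close>

lemma supercritical_measure:
  assumes sup: "supercritical b p" and R: "finite R" "R \<subseteq> I" "R \<inter> e ` D = {}"
    and D: "\<And>J n. J \<subseteq> indices b \<Longrightarrow> surv_ix J n [] \<subseteq> D"
  shows "measure M {\<xi> \<in> space M. (\<forall>r\<in>R. \<xi> r) \<and> infinite (cluster b (pull \<xi>))} > 0"
proof -
  let ?E = "{\<xi> \<in> space M. (\<forall>r\<in>R. \<xi> r) \<and> infinite (cluster b (pull \<xi>))}"
  \<comment> \<open>Positivity needs a measurable event: this is a countable intersection over
    \<open>K\<close> of countable unions of cylinders.\<close>
  have "?E = (\<Inter>K. \<Union>n. {\<xi> \<in> space M. (\<forall>r\<in>R. \<xi> r) \<and> large b K (pull \<xi> \<inter> exhaust n)})"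
    using large_iff_exhaust by (auto simp: infinite_cluster_iff)
  also have "\<dots> \<in> sets M"
    using cylinder(1)[OF exhaust(1,2) R] by (intro sets.countable_INT' sets.countable_UN) auto
  finally have E: "?E \<in> sets M" .
  obtain J c where J: "finite J" "J \<subseteq> indices b" and c: "c > 0" "\<And>n l. c \<le> rprob p (surv_ix J n l) (surv b J n l)"
    by (rule supercritical_survival[OF sup p]) (rule that)
  define W where "W n = {\<xi> \<in> space M. (\<forall>r\<in>R. \<xi> r) \<and> surv b J n [] (pull \<xi> \<inter> surv_ix J n [])}" for n
  have W: "W n \<in> sets M" "measure M (W n) = p ^ card R * rprob p (surv_ix J n []) (surv b J n [])" for n
    unfolding W_def using cylinder[OF finite_surv_ix[OF J] D[OF J(2)] R] by auto
  have W_eq: "W n = {\<xi> \<in> space M. (\<forall>r\<in>R. \<xi> r) \<and> surv b J n [] (pull \<xi>)}" for n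
    unfolding W_def using surv_depends[of J n "[]" "_ \<inter> surv_ix J n []"] by auto
  have surv_Suc: "surv b J (Suc n) l A \<Longrightarrow> surv b J n l A" for n l A
  proof (induction n arbitrary: l)
    case (Suc n)
    from Suc.prems obtain x where x: "x \<in> (\<Union> J \<inter> carrier G) - {\<one>}" "x \<in> reach b {\<one>} (copy A l \<inter> J)"
      "(l @ [x], None) \<in> A" "surv b J (Suc n) (l @ [x]) A"
      by (subst (asm) surv.simps(2)) blast
    from Suc.IH[OF x(4)] x(1-3) show ?case by (subst surv.simps(2)) blast
  qed simp
  have dec: "decseq W"
    unfolding W_eq using surv_Suc by (intro decseq_SucI) blast
  have "p ^ card R * c \<le> measure M (\<Inter>n. W n)"
  proof (rule LIMSEQ_le_const)
    show "(\<lambda>n. measure M (W n)) \<longlonglongrightarrow> measure M (\<Inter>n. W n)"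
      using W dec by (intro finite_Lim_measure_decseq) auto
    show "\<exists>N. \<forall>n\<ge>N. p ^ card R * c \<le> measure M (W n)"
      using W c p by (auto intro!: mult_left_mono)
  qed
  also have "\<dots> \<le> measure M ?E"
  proof (rule finite_measure_mono[OF _ E])
    show "(\<Inter>n. W n) \<subseteq> ?E"
      unfolding W_eq using infinite_cluster_of_surv[of b J] by blast
  qed
  finally show ?thesis using c p by (smt (verit) mult_pos_pos zero_less_power)
qed

end

section \<open>The free product as a group\<close>

context involution_covering begin

lemma spectral_radius_iso: assumes "inj_on \<pi> (carrier G)" shows "spectral_radius G' S' = spectral_radius G S"
proof -
  have "G'.count n = G.count n" for n
  proof -
    have "real (G'.count n) = (\<Sum>w\<in>words S' n. if wprod G' w = \<one>\<^bsub>G'\<^esub> then 1 else 0)"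
      unfolding G'.returning_words_eq by (subst sum.inter_filter[symmetric]) auto
    also have "\<dots> = (\<Sum>w\<in>words S n. if wprod G' (map \<pi> w) = \<one>\<^bsub>G'\<^esub> then 1 else 0)"
      by (rule sum_words_covering)
    also have "\<dots> = (\<Sum>w\<in>words S n. if wprod G w = \<one>\<^bsub>G\<^esub> then 1 else 0)"
    proof (intro sum.cong refl)
      fix w assume w: "w \<in> words S n"
      have "wprod G' (map \<pi> w) = \<one>\<^bsub>G'\<^esub> \<longleftrightarrow> \<pi> (wprod G w) = \<pi> \<one>\<^bsub>G\<^esub>" using w by (simp add: hom_wprod)
      also have "\<dots> \<longleftrightarrow> wprod G w = \<one>\<^bsub>G\<^esub>"
        by (rule inj_on_eq_iff[OF assms G.words_closed[OF w] G.one_closed])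
      finally show "(if wprod G' (map \<pi> w) = \<one>\<^bsub>G'\<^esub> then 1 else 0) = (if wprod G w = \<one>\<^bsub>G\<^esub> then 1 else (0::real))" by simp
    qed
    also have "\<dots> = real (G.count n)"
      unfolding G.returning_words_eq by (subst sum.inter_filter[symmetric]) auto
    finally show ?thesis by simp
  qed
  then show ?thesis by (simp add: spectral_radius_def card_S')
qed

text \<open>An injective covering has one-point fibres, so the conditional entropy
  \<open>gain\<close> vanishes.\<close>

lemma asymptotic_entropy_iso: assumes inj: "inj_on \<pi> (carrier G)" shows "asymptotic_entropy G' S' = asymptotic_entropy G S"
proof -
  have "gain (G.mass n) = 0" for n
    unfolding gain_def
  proof (rule sum.neutral, rule ballI)
    fix x assume x: "x \<in> G.supp (G.mass n)"
    then have "{y \<in> G.supp (G.mass n). \<pi> y = \<pi> x} = {x}"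
      using inj by (auto simp: G.supp_def dest: inj_onD)
    then show "G.mass n x * ln (push (G.mass n) (\<pi> x) / G.mass n x) = 0"
      using x by (simp add: push_def G.supp_def)
  qed
  then have "G'.ent (G'.mass n) = G.ent (G.mass n)" for n by (simp add: gain_mass)
  then show ?thesis
    using G.asymptotic_entropy_LIMSEQ G'.asymptotic_entropy_LIMSEQ LIMSEQ_unique by fastforce
qed

end

text \<open>The reduced lists are those with nontrivial interior entries. The parents are the lists that
  stay reduced whatever entry is appended.\<close>

definition fp_lists :: "('a, 'b) monoid_scheme \<Rightarrow> 'a list set" where
  "fp_lists G = {l. l \<noteq> [] \<and> set l \<subseteq> carrier G \<and> \<one>\<^bsub>G\<^esub> \<notin> set (butlast (tl l))}"

definition fp_parents :: "('a, 'b) monoid_scheme \<Rightarrow> 'a list set" where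
  "fp_parents G = {l. set l \<subseteq> carrier G \<and> \<one>\<^bsub>G\<^esub> \<notin> set (tl l)}"

definition rmul :: "('a, 'b) monoid_scheme \<Rightarrow> 'a list \<Rightarrow> 'a \<Rightarrow> 'a list" where
  "rmul G l a = butlast l @ [last l \<otimes>\<^bsub>G\<^esub> a]"

text \<open>Right multiplication by \<open>t\<close>. A final \<open>\<one>\<close> after a
  \<open>t\<close> is an empty syllable, and then the two letters \<open>t\<close> cancel; in the
  list \<open>[\<one>]\<close> no \<open>t\<close> precedes it.\<close>

definition tmul :: "('a, 'b) monoid_scheme \<Rightarrow> 'a list \<Rightarrow> 'a list" where
  "tmul G l = (if 2 \<le> length l \<and> last l = \<one>\<^bsub>G\<^esub> then butlast l else l @ [\<one>\<^bsub>G\<^esub>])"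

text \<open>Evaluates \<open>a\<^sub>0 t a\<^sub>1 ... a\<^sub>k\<close> in a right action
  \<open>r\<close> with an involution \<open>t\<close>. The multiplication of the free product and
  the homomorphism \<open>fp_map\<close> are both instances.\<close>

definition act :: "('q \<Rightarrow> 'a \<Rightarrow> 'q) \<Rightarrow> ('q \<Rightarrow> 'q) \<Rightarrow> 'a list \<Rightarrow> 'q \<Rightarrow> 'q" where
  "act r t l q = fold (\<lambda>a q. r (t q) a) (tl l) (r q (hd l))"

lemma act_single [simp]: "act r t [a] q = r q a"
  by (simp add: act_def)

lemma act_snoc: "l \<noteq> [] \<Longrightarrow> act r t (l @ [a]) q = r (t (act r t l q)) a"
  by (cases l) (simp_all add: act_def)

definition free_product :: "('a, 'b) monoid_scheme \<Rightarrow> 'a list monoid" where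
  "free_product G = \<lparr>carrier = fp_lists G, mult = (\<lambda>l m. act (rmul G) (tmul G) m l), one = [\<one>\<^bsub>G\<^esub>]\<rparr>"

definition fp_gens :: "('a, 'b) monoid_scheme \<Rightarrow> 'a set \<Rightarrow> 'a list set" where
  "fp_gens G S = insert [\<one>\<^bsub>G\<^esub>, \<one>\<^bsub>G\<^esub>] ((\<lambda>s. [s]) ` S)"

lemma fp_parents_snoc: "l @ [x] \<in> fp_lists G \<longleftrightarrow> l \<in> fp_parents G \<and> x \<in> carrier G"
  by (cases l) (auto simp: fp_lists_def fp_parents_def)

lemma fp_parents_iff: "l \<in> fp_lists G \<Longrightarrow> l \<in> fp_parents G \<longleftrightarrow> length l \<le> 1 \<or> last l \<noteq> \<one>\<^bsub>G\<^esub>"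
  by (cases l rule: rev_cases; cases "butlast l") (auto simp: fp_lists_def fp_parents_def)

lemma fp_parents_subset: "fp_parents G \<subseteq> insert [] (fp_lists G)"
  by (auto simp: fp_lists_def fp_parents_def dest: in_set_butlastD)

lemma snoc_of_last: "2 \<le> length l \<and> last l = c \<Longrightarrow> \<exists>m. l = m @ [c] \<and> m \<noteq> []"
  by (cases l rule: rev_cases) auto

text \<open>The universal property in the form of actions, after van der Waerden: letting reduced
  lists act on reduced lists avoids the case distinctions about cancellation in a direct proof of
  associativity.\<close>

locale fp_action = group G for G :: "('a, 'b) monoid_scheme" (structure) +
  fixes Q :: "'q set" and r t
  assumes r_closed: "q \<in> Q \<Longrightarrow> a \<in> carrier G \<Longrightarrow> r q a \<in> Q"
    and t_closed: "q \<in> Q \<Longrightarrow> t q \<in> Q"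
    and r_mult: "q \<in> Q \<Longrightarrow> a \<in> carrier G \<Longrightarrow> c \<in> carrier G \<Longrightarrow> r q (a \<otimes> c) = r (r q a) c"
    and r_one: "q \<in> Q \<Longrightarrow> r q \<one> = q"
    and t_t: "q \<in> Q \<Longrightarrow> t (t q) = q"
begin

lemma act_closed: "l \<noteq> [] \<Longrightarrow> set l \<subseteq> carrier G \<Longrightarrow> q \<in> Q \<Longrightarrow> act r t l q \<in> Q"
proof (induction l rule: rev_induct)
  case (snoc x l)
  then show ?case by (cases "l = []") (auto simp: act_snoc r_closed t_closed)
qed simp

lemma act_rmul: assumes "l \<in> fp_lists G" "a \<in> carrier G" "q \<in> Q"
  shows "act r t (rmul G l a) q = r (act r t l q) a"
proof (cases l rule: rev_cases)
  case (snoc m x)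
  have x: "set m \<subseteq> carrier G" "x \<in> carrier G" using assms snoc by (auto simp: fp_lists_def)
  show ?thesis
  proof (cases "m = []")
    case True then show ?thesis using snoc x assms by (simp add: rmul_def r_mult)
  next
    case False
    then show ?thesis using snoc x assms by (simp add: rmul_def act_snoc r_mult t_closed act_closed)
  qed
qed (use assms in \<open>simp add: fp_lists_def\<close>)

lemma act_tmul: assumes "l \<in> fp_lists G" "q \<in> Q"
  shows "act r t (tmul G l) q = t (act r t l q)"
proof -
  have l: "l \<noteq> []" "set l \<subseteq> carrier G" using assms by (auto simp: fp_lists_def)
  show ?thesis
  proof (cases "2 \<le> length l \<and> last l = \<one>")
    case True
    obtain m where m: "l = m @ [\<one>]" "m \<noteq> []" using snoc_of_last[OF True] by auto
    then have "set m \<subseteq> carrier G" using l by auto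
    note m = m this
    have "tmul G l = m" using True m by (simp add: tmul_def)
    then show ?thesis using m assms by (simp add: act_snoc r_one t_t t_closed act_closed)
  next
    case False
    then have "tmul G l = l @ [\<one>]" unfolding tmul_def by (rule if_not_P)
    then show ?thesis using l assms by (simp add: act_snoc r_one t_closed act_closed)
  qed
qed

end

context group begin

lemma rmul_closed: "l \<in> fp_lists G \<Longrightarrow> a \<in> carrier G \<Longrightarrow> rmul G l a \<in> fp_lists G"
  by (cases l rule: rev_cases) (auto simp: rmul_def fp_parents_snoc, auto simp: fp_lists_def)

lemma tmul_closed: assumes "l \<in> fp_lists G" shows "tmul G l \<in> fp_lists G"
proof (cases "2 \<le> length l \<and> last l = \<one>")
  case True
  obtain m where "l = m @ [\<one>]" "m \<noteq> []" using snoc_of_last[OF True] by auto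
  then have "butlast l \<in> fp_parents G" "butlast l \<noteq> []"
    using assms by (auto simp: fp_parents_snoc)
  then show ?thesis using True fp_parents_subset by (auto simp: tmul_def)
next
  case False
  then have "l \<in> fp_parents G" using assms by (auto simp: fp_parents_iff)
  then have "l @ [\<one>] \<in> fp_lists G" by (simp add: fp_parents_snoc)
  then show ?thesis using False by (simp only: tmul_def if_False)
qed

lemma tmul_parent: "l \<in> fp_parents G \<Longrightarrow> l \<noteq> [] \<Longrightarrow> tmul G l = l @ [\<one>]"
  by (cases l rule: rev_cases; cases "butlast l") (auto simp: tmul_def fp_parents_def)

lemma tmul_snoc_one: "l \<noteq> [] \<Longrightarrow> tmul G (l @ [\<one>]) = l"
  by (cases l) (auto simp: tmul_def)

lemma tmul_tmul: assumes "l \<in> fp_lists G" shows "tmul G (tmul G l) = l"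
proof (cases "l \<in> fp_parents G")
  case True
  then show ?thesis using assms by (auto simp: tmul_parent tmul_snoc_one fp_lists_def)
next
  case False
  then have l: "2 \<le> length l" "last l = \<one>" using assms fp_parents_iff[OF assms] by auto
  obtain m where m: "l = m @ [\<one>]" "m \<noteq> []" using snoc_of_last[OF conjI[OF l]] by auto
  then have "m \<in> fp_parents G" using assms by (simp add: fp_parents_snoc)
  then show ?thesis using m by (simp add: tmul_parent tmul_snoc_one)
qed

sublocale fp: fp_action G "fp_lists G" "rmul G" "tmul G"
proof
  fix q a c assume "q \<in> fp_lists G" "a \<in> carrier G" "c \<in> carrier G"
  then show "rmul G q (a \<otimes> c) = rmul G (rmul G q a) c"
    by (cases q rule: rev_cases) (auto simp: rmul_def fp_lists_def m_assoc)
next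
  fix q assume "q \<in> fp_lists G" then show "rmul G q \<one> = q"
    by (cases q rule: rev_cases) (auto simp: rmul_def fp_lists_def)
qed (auto simp: rmul_closed tmul_closed tmul_tmul)

text \<open>Every reduced list is reached from \<open>[\<one>]\<close> by single multiplications, so
  identities such as associativity come down to the rules for \<open>rmul\<close> and
  \<open>tmul\<close>.\<close>

lemma fp_induct [consumes 1, case_names one rmul tmul]:
  assumes "l \<in> fp_lists G" "P [\<one>]" "\<And>l a. l \<in> fp_lists G \<Longrightarrow> a \<in> carrier G \<Longrightarrow> P l \<Longrightarrow> P (rmul G l a)"
    "\<And>l. l \<in> fp_lists G \<Longrightarrow> P l \<Longrightarrow> P (tmul G l)"
  shows "P l"
  using assms(1)
proof (induction l rule: rev_induct)
  case Nil then show ?case by (simp add: fp_lists_def)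
next
  case (snoc x l)
  then have l: "l \<in> fp_parents G" "x \<in> carrier G" by (auto simp: fp_parents_snoc)
  show ?case
  proof (cases "l = []")
    case True
    have "P (rmul G [\<one>] x)" using assms l by (intro assms) (auto simp: fp_lists_def)
    then show ?thesis using True l by (simp add: rmul_def)
  next
    case False
    then have lV: "l \<in> fp_lists G" using l fp_parents_subset by auto
    have "P (rmul G (tmul G l) x)" using snoc.IH[OF lV] lV l by (intro assms tmul_closed)
    then show ?thesis using tmul_parent[OF l(1) False] l by (simp add: rmul_def)
  qed
qed

abbreviation "FP \<equiv> free_product G"

lemma FP_simps: "carrier FP = fp_lists G" "l \<otimes>\<^bsub>FP\<^esub> m = act (rmul G) (tmul G) m l" "\<one>\<^bsub>FP\<^esub> = [\<one>]"
  by (simp_all add: free_product_def)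

lemma one_fp [simp]: "[\<one>] \<in> fp_lists G" and single_fp: "a \<in> carrier G \<Longrightarrow> [a] \<in> fp_lists G"
  and t_fp [simp]: "[\<one>, \<one>] \<in> fp_lists G"
  by (simp_all add: fp_lists_def)

lemma FP_closed: "l \<in> fp_lists G \<Longrightarrow> m \<in> fp_lists G \<Longrightarrow> l \<otimes>\<^bsub>FP\<^esub> m \<in> fp_lists G"
  unfolding FP_simps by (rule fp.act_closed) (auto simp: fp_lists_def)

lemma FP_single: "l \<otimes>\<^bsub>FP\<^esub> [a] = rmul G l a"
  by (simp add: FP_simps)

lemma FP_t: "l \<in> fp_lists G \<Longrightarrow> l \<otimes>\<^bsub>FP\<^esub> [\<one>, \<one>] = tmul G l"
  using act_snoc[of "[\<one>]" "rmul G" "tmul G" "\<one>" l]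
  by (simp add: FP_simps fp.r_one fp.t_closed)

lemma FP_rmul: "l \<in> fp_lists G \<Longrightarrow> m \<in> fp_lists G \<Longrightarrow> a \<in> carrier G \<Longrightarrow> l \<otimes>\<^bsub>FP\<^esub> rmul G m a = rmul G (l \<otimes>\<^bsub>FP\<^esub> m) a"
  by (simp add: FP_simps fp.act_rmul)

lemma FP_tmul: "l \<in> fp_lists G \<Longrightarrow> m \<in> fp_lists G \<Longrightarrow> l \<otimes>\<^bsub>FP\<^esub> tmul G m = tmul G (l \<otimes>\<^bsub>FP\<^esub> m)"
  by (simp add: FP_simps fp.act_tmul)

lemma FP_one_right: "l \<in> fp_lists G \<Longrightarrow> l \<otimes>\<^bsub>FP\<^esub> [\<one>] = l"
  by (simp add: FP_single fp.r_one)

lemma FP_assoc: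
  assumes "l \<in> fp_lists G" "m \<in> fp_lists G" "n \<in> fp_lists G"
  shows "l \<otimes>\<^bsub>FP\<^esub> m \<otimes>\<^bsub>FP\<^esub> n = l \<otimes>\<^bsub>FP\<^esub> (m \<otimes>\<^bsub>FP\<^esub> n)"
  using assms(3)
  by (induction n rule: fp_induct)
     (use assms(1,2) in \<open>simp_all add: FP_one_right FP_rmul FP_tmul FP_closed\<close>)

lemma FP_one_left: "l \<in> fp_lists G \<Longrightarrow> [\<one>] \<otimes>\<^bsub>FP\<^esub> l = l"
  by (induction l rule: fp_induct) (simp_all add: FP_one_right FP_rmul FP_tmul)

lemma group_free_product: "group FP"
proof (rule groupI)
  fix l assume "l \<in> carrier FP"
  then have "l \<in> fp_lists G" by (simp add: FP_simps)
  then have "\<exists>y\<in>fp_lists G. y \<otimes>\<^bsub>FP\<^esub> l = [\<one>]"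
  proof (induction l rule: fp_induct)
    case one then show ?case by (intro bexI[of _ "[\<one>]"]) (simp_all add: FP_one_right)
  next
    case (rmul l a)
    then obtain y where y: "y \<in> fp_lists G" "y \<otimes>\<^bsub>FP\<^esub> l = [\<one>]" by auto
    have "[inv a] \<otimes>\<^bsub>FP\<^esub> y \<otimes>\<^bsub>FP\<^esub> rmul G l a = rmul G ([inv a] \<otimes>\<^bsub>FP\<^esub> (y \<otimes>\<^bsub>FP\<^esub> l)) a"
      using y rmul by (simp add: FP_rmul FP_closed FP_assoc single_fp)
    also have "\<dots> = [\<one>]" using y rmul by (simp add: FP_one_right single_fp) (simp add: rmul_def)
    finally show ?case using y rmul by (intro bexI[of _ "[inv a] \<otimes>\<^bsub>FP\<^esub> y"]) (simp_all add: FP_closed single_fp)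
  next
    case (tmul l)
    then obtain y where y: "y \<in> fp_lists G" "y \<otimes>\<^bsub>FP\<^esub> l = [\<one>]" by auto
    have "[\<one>, \<one>] \<otimes>\<^bsub>FP\<^esub> y \<otimes>\<^bsub>FP\<^esub> tmul G l = tmul G ([\<one>, \<one>] \<otimes>\<^bsub>FP\<^esub> (y \<otimes>\<^bsub>FP\<^esub> l))"
      using y tmul by (simp add: FP_tmul FP_closed FP_assoc)
    also have "\<dots> = [\<one>]" using y tmul by (simp add: FP_one_right) (simp add: tmul_def)
    finally show ?case using y tmul by (intro bexI[of _ "[\<one>, \<one>] \<otimes>\<^bsub>FP\<^esub> y"]) (simp_all add: FP_closed)
  qed
  then show "\<exists>y\<in>carrier FP. y \<otimes>\<^bsub>FP\<^esub> l = \<one>\<^bsub>FP\<^esub>" by (simp add: FP_simps)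
qed (simp_all only: FP_simps(1,3) FP_closed FP_assoc FP_one_left one_fp)

end

context involution_marked begin

lemma fp_gens_closed: "fp_gens G S \<subseteq> fp_lists G"
  using S_closed by (auto simp: fp_gens_def single_fp)

lemma involution_marked_free_product: "involution_marked FP (fp_gens G S)"
proof (intro involution_marked.intro involution_marked_axioms.intro group_free_product)
  fix s assume "s \<in> fp_gens G S"
  then consider "s = [\<one>, \<one>]" | u where "u \<in> S" "s = [u]" by (auto simp: fp_gens_def)
  then show "s \<otimes>\<^bsub>FP\<^esub> s = \<one>\<^bsub>FP\<^esub>"
  proof cases
    case 1 then show ?thesis by (simp add: FP_t) (simp add: tmul_def FP_simps)
  next
    case 2 then show ?thesis by (simp add: FP_single) (simp add: rmul_def FP_simps S_involution)
  qed
qed (use fin_S fp_gens_closed in \<open>auto simp: fp_gens_def FP_simps\<close>)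

lemma card_fp_gens: "card (fp_gens G S) = Suc (card S)"
proof -
  have "[\<one>, \<one>] \<notin> (\<lambda>s. [s]) ` S" by auto
  then show ?thesis using fin_S by (simp add: fp_gens_def card_image inj_on_def)
qed

lemma wprod_single: "set w \<subseteq> carrier G \<Longrightarrow> wprod FP (map (\<lambda>s. [s]) w) = [wprod G w]"
proof (induction w)
  case (Cons s w)
  then show ?case by (simp add: FP_single) (simp add: rmul_def)
qed (simp add: FP_simps)

lemma generate_free_product:
  assumes "\<And>a. a \<in> carrier G \<Longrightarrow> \<exists>w. set w \<subseteq> S \<and> a = wprod G w"
  shows "generate FP (fp_gens G S) = carrier FP"
proof
  interpret FPg: group FP by (rule group_free_product)
  show "generate FP (fp_gens G S) \<subseteq> carrier FP"
    using fp_gens_closed by (intro FPg.generate_incl) (simp add: FP_simps)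
  have single: "[a] \<in> generate FP (fp_gens G S)" if a: "a \<in> carrier G" for a
  proof -
    obtain w where w: "set w \<subseteq> S" "a = wprod G w" using assms[OF a] by auto
    from w(1) have "wprod FP (map (\<lambda>s. [s]) w) \<in> generate FP (fp_gens G S)"
    proof (induction w)
      case Nil then show ?case by (simp add: generate.one)
    next
      case (Cons s w)
      then have "[s] \<in> generate FP (fp_gens G S)" by (intro generate.incl) (simp add: fp_gens_def)
      then show ?case using Cons by (simp add: generate.eng)
    qed
    then show ?thesis using w S_closed by (simp add: wprod_single subset_trans)
  qed
  show "carrier FP \<subseteq> generate FP (fp_gens G S)"
  proof
    fix l assume "l \<in> carrier FP"
    then have "l \<in> fp_lists G" by (simp add: FP_simps)
    then show "l \<in> generate FP (fp_gens G S)"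
    proof (induction l rule: fp_induct)
      case one then show ?case using generate.one[of FP] by (simp add: FP_simps)
    next
      case (rmul l a)
      then show ?case using generate.eng[OF rmul(3) single[OF rmul(2)]] by (simp add: FP_single)
    next
      case (tmul l)
      have "[\<one>, \<one>] \<in> generate FP (fp_gens G S)" by (rule generate.incl) (simp add: fp_gens_def)
      then show ?case using generate.eng[OF tmul(2)] tmul by (metis FP_t)
    qed
  qed
qed

end

context involution_covering begin

text \<open>The list acts on the identity of the target, with \<open>G\<close> acting through
  \<open>\<pi>\<close>. An interior syllable in the kernel lets the neighbouring letters
  \<open>t\<close> cancel there, which mapping the entries would miss.\<close>

definition fp_map :: "'a list \<Rightarrow> 'c list" where
  "fp_map l = act (\<lambda>q a. rmul G' q (\<pi> a)) (tmul G') l [\<one>\<^bsub>G'\<^esub>]"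

lemma fp_action_map: "fp_action G (fp_lists G') (\<lambda>q a. rmul G' q (\<pi> a)) (tmul G')"
  by unfold_locales (auto simp: G'.rmul_closed G'.tmul_closed G'.fp.r_mult G'.fp.r_one G'.tmul_tmul)

lemma fp_map_closed: "l \<in> fp_lists G \<Longrightarrow> fp_map l \<in> fp_lists G'"
  unfolding fp_map_def by (rule fp_action.act_closed[OF fp_action_map]) (auto simp: fp_lists_def)

lemma fp_map_rmul: "l \<in> fp_lists G \<Longrightarrow> a \<in> carrier G \<Longrightarrow> fp_map (rmul G l a) = rmul G' (fp_map l) (\<pi> a)"
  unfolding fp_map_def by (rule fp_action.act_rmul[OF fp_action_map]) auto

lemma fp_map_tmul: "l \<in> fp_lists G \<Longrightarrow> fp_map (tmul G l) = tmul G' (fp_map l)"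
  unfolding fp_map_def by (rule fp_action.act_tmul[OF fp_action_map]) auto

lemma fp_map_single: "a \<in> carrier G \<Longrightarrow> fp_map [a] = [\<pi> a]"
  by (simp add: fp_map_def) (simp add: rmul_def)

lemma fp_map_t: "fp_map [\<one>\<^bsub>G\<^esub>, \<one>\<^bsub>G\<^esub>] = [\<one>\<^bsub>G'\<^esub>, \<one>\<^bsub>G'\<^esub>]"
  by (simp add: fp_map_def act_def rmul_def tmul_def)

lemma fp_map_mult: assumes l: "l \<in> fp_lists G" and m: "m \<in> fp_lists G"
  shows "fp_map (l \<otimes>\<^bsub>free_product G\<^esub> m) = fp_map l \<otimes>\<^bsub>free_product G'\<^esub> fp_map m"
  using m
proof (induction m rule: G.fp_induct)
  case one
  then show ?case using l by (simp add: G.FP_one_right fp_map_single G'.FP_one_right fp_map_closed)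
next
  case (rmul m a)
  then show ?case using l by (simp add: G.FP_rmul fp_map_rmul G.FP_closed G'.FP_rmul fp_map_closed)
next
  case (tmul m)
  then show ?case using l by (simp add: G.FP_tmul fp_map_tmul G.FP_closed G'.FP_tmul fp_map_closed)
qed

lemma involution_covering_free_product:
  "involution_covering (free_product G) (fp_gens G S) (free_product G') (fp_gens G' S') fp_map"
proof (intro involution_covering.intro involution_covering_axioms.intro
    G.involution_marked_free_product G'.involution_marked_free_product)
  show "fp_map \<in> hom (free_product G) (free_product G')"
    by (auto simp: hom_def G.FP_simps(1) G'.FP_simps(1) fp_map_closed fp_map_mult)
  have "inj_on fp_map (fp_gens G S)"
    using bij G.S_closed
    by (auto simp: inj_on_def fp_gens_def fp_map_t fp_map_single bij_betw_def subset_eq)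
  moreover have "fp_map ` fp_gens G S = fp_gens G' S'"
  proof -
    have "(\<lambda>s. fp_map [s]) ` S = (\<lambda>s. [\<pi> s]) ` S" using G.S_closed by (intro image_cong) (auto simp: fp_map_single)
    moreover have "S' = \<pi> ` S" using bij by (simp add: bij_betw_def)
    ultimately show ?thesis by (simp add: fp_gens_def fp_map_t image_image)
  qed
  ultimately show "bij_betw fp_map (fp_gens G S) (fp_gens G' S')" by (simp add: bij_betw_def)
qed

lemma free_product_strict:
  assumes S3: "card S = 3"
    and w: "w \<in> words S (2 * n)" "wprod G w \<noteq> \<one>\<^bsub>G\<^esub>" "\<pi> (wprod G w) = \<one>\<^bsub>G'\<^esub>"
  shows "spectral_radius (free_product G) (fp_gens G S) < spectral_radius (free_product G') (fp_gens G' S')"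
    and "asymptotic_entropy (free_product G') (fp_gens G' S') < asymptotic_entropy (free_product G) (fp_gens G S)"
proof -
  interpret F: involution_covering "free_product G" "fp_gens G S" "free_product G'" "fp_gens G' S'" fp_map
    by (rule involution_covering_free_product)
  let ?t = "[\<one>\<^bsub>G\<^esub>, \<one>\<^bsub>G\<^esub>]"
  let ?z = "wprod G w"
  \<comment> \<open>The word \<open>s t z t s\<close> of length \<open>2 * n + 4\<close>, one for
    each of the three generators; the first letter tells them apart.\<close>
  define zw where "zw s = [[s], ?t] @ map (\<lambda>s. [s]) w @ [?t, [s]]" for s
  define Z where "Z = zw ` S"
  \<comment> \<open>The lists that contain a \<open>t\<close> and end in the syllable
    \<open>s\<close>.\<close>
  define E where "E z = {l :: 'a list. 2 \<le> length l \<and> [last l] = hd z}" for z :: "'a list list"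
  have wc: "set w \<subseteq> carrier G" "?z \<in> carrier G" using w G.S_closed by (auto simp: words_def)
  have Z: "Z \<subseteq> words (fp_gens G S) ((n + 2) + (n + 2))"
  proof -
    have "set w \<subseteq> S" "length w = 2 * n" using w by (auto simp: words_def)
    then show ?thesis unfolding Z_def zw_def words_def fp_gens_def by (auto simp: image_iff subset_eq)
  qed
  have "inj_on zw S" by (auto simp: inj_on_def zw_def)
  then have cZ: "card Z = 3" using S3 by (simp add: Z_def card_image)
  have disj: "disjoint_family_on E Z"
    by (auto simp: disjoint_family_on_def E_def Z_def zw_def)
  have prod: "wprod (free_product G) (zw s) = [s] \<otimes>\<^bsub>free_product G\<^esub> (?t \<otimes>\<^bsub>free_product G\<^esub> ([?z] \<otimes>\<^bsub>free_product G\<^esub> (?t \<otimes>\<^bsub>free_product G\<^esub> [s])))"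
    if s: "s \<in> S" for s
  proof -
    have sc: "s \<in> carrier G" using s G.S_closed by auto
    have "set (map (\<lambda>s. [s]) w) \<subseteq> carrier (free_product G)" "set [?t, [s]] \<subseteq> carrier (free_product G)"
      using wc sc by (auto simp: G.FP_simps(1) G.single_fp)
    then have "wprod (free_product G) (map (\<lambda>s. [s]) w @ [?t, [s]])
       = [?z] \<otimes>\<^bsub>free_product G\<^esub> wprod (free_product G) [?t, [s]]"
      using wc by (simp only: F.G.wprod_append G.wprod_single)
    moreover have "wprod (free_product G) [?t, [s]] = ?t \<otimes>\<^bsub>free_product G\<^esub> [s]"
      using sc by (simp add: G.FP_simps(3) G.FP_one_right G.single_fp)
    ultimately show ?thesis by (simp add: zw_def)
  qed
  have ker: "fp_map (wprod (free_product G) z) = \<one>\<^bsub>free_product G'\<^esub>" if z: "z \<in> Z" for z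
  proof -
    obtain s where s: "s \<in> S" "z = zw s" using z by (auto simp: Z_def)
    have sc: "s \<in> carrier G" using s G.S_closed by auto
    let ?t' = "[\<one>\<^bsub>G'\<^esub>, \<one>\<^bsub>G'\<^esub>]"
    have "fp_map (wprod (free_product G) z) = [\<pi> s] \<otimes>\<^bsub>free_product G'\<^esub> (?t' \<otimes>\<^bsub>free_product G'\<^esub> ([\<one>\<^bsub>G'\<^esub>] \<otimes>\<^bsub>free_product G'\<^esub> (?t' \<otimes>\<^bsub>free_product G'\<^esub> [\<pi> s])))"
      unfolding s(2) prod[OF s(1)] using sc wc w(3)
      by (simp add: fp_map_mult G.FP_closed G.single_fp fp_map_single fp_map_t)
    also have "\<dots> = [\<pi> s] \<otimes>\<^bsub>free_product G'\<^esub> (?t' \<otimes>\<^bsub>free_product G'\<^esub> (?t' \<otimes>\<^bsub>free_product G'\<^esub> [\<pi> s]))"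
      using sc by (simp add: G'.FP_one_left G'.FP_closed G'.single_fp)
    also have "\<dots> = [\<pi> s] \<otimes>\<^bsub>free_product G'\<^esub> ((?t' \<otimes>\<^bsub>free_product G'\<^esub> ?t') \<otimes>\<^bsub>free_product G'\<^esub> [\<pi> s])"
      using sc by (simp add: G'.FP_assoc G'.single_fp)
    also have "?t' \<otimes>\<^bsub>free_product G'\<^esub> ?t' = \<one>\<^bsub>free_product G'\<^esub>"
      by (rule F.G'.S_involution) (simp add: fp_gens_def)
    also have "[\<pi> s] \<otimes>\<^bsub>free_product G'\<^esub> (\<one>\<^bsub>free_product G'\<^esub> \<otimes>\<^bsub>free_product G'\<^esub> [\<pi> s]) = [\<pi> s] \<otimes>\<^bsub>free_product G'\<^esub> [\<pi> s]"
      using sc by (simp add: G'.FP_simps(3) G'.FP_one_left G'.single_fp)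
    also have "\<dots> = \<one>\<^bsub>free_product G'\<^esub>"
      using s bij by (intro F.G'.S_involution) (auto simp: fp_gens_def bij_betw_def)
    finally show ?thesis .
  qed
  have pp: "g \<otimes>\<^bsub>free_product G\<^esub> wprod (free_product G) z \<in> E z"
    if z: "z \<in> Z" and g: "g \<in> carrier (free_product G)" "g \<notin> E z" for z g
  proof -
    obtain s where s: "s \<in> S" "z = zw s" using z by (auto simp: Z_def)
    have sc: "s \<in> carrier G" using s G.S_closed by auto
    have gV: "g \<in> fp_lists G" using g by (simp add: G.FP_simps)
    have "g \<otimes>\<^bsub>free_product G\<^esub> wprod (free_product G) z = rmul G (tmul G (rmul G (tmul G (rmul G g s)) ?z)) s"
      unfolding s(2) prod[OF s(1)] using sc wc gV
      by (simp add: G.FP_assoc[symmetric] G.FP_closed G.single_fp) (simp add: G.FP_single G.FP_t G.rmul_closed G.tmul_closed)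
    also have "\<dots> = rmul G g s @ [?z, s]"
    proof -
      obtain m x where m: "g = m @ [x]" using gV by (cases g rule: rev_cases) (auto simp: fp_lists_def)
      have x: "x \<in> carrier G" using gV m by (auto simp: fp_lists_def)
      \<comment> \<open>Cancellation between \<open>g\<close> and the first letter \<open>s\<close>
        would need \<open>g\<close> to end in \<open>s\<close> after a \<open>t\<close>, that is, to
        lie in \<open>E z\<close>. Later nothing cancels because \<open>?z\<close> is not
        \<open>\<one>\<close>.\<close>
      have "m = [] \<or> x \<otimes>\<^bsub>G\<^esub> s \<noteq> \<one>\<^bsub>G\<^esub>"
      proof (rule ccontr)
        assume *: "\<not> ?thesis"
        then have "x = s" using x sc G.inv_equality[of x s] G.inv_gen[OF s(1)] by auto
        then show False using * g m s by (cases m) (auto simp: E_def zw_def)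
      qed
      then have 1: "tmul G (rmul G g s) = rmul G g s @ [\<one>\<^bsub>G\<^esub>]"
        using m by (cases m) (auto simp: tmul_def rmul_def)
      have 2: "rmul G (rmul G g s @ [\<one>\<^bsub>G\<^esub>]) ?z = rmul G g s @ [?z]" using wc by (simp add: rmul_def butlast_append)
      have 3: "tmul G (rmul G g s @ [?z]) = rmul G g s @ [?z, \<one>\<^bsub>G\<^esub>]" using w by (simp add: tmul_def)
      have 4: "rmul G (rmul G g s @ [?z, \<one>\<^bsub>G\<^esub>]) s = rmul G g s @ [?z, s]"
        using sc by (simp add: rmul_def butlast_append)
      show ?thesis by (simp only: 1 2 3 4)
    qed
    also have "\<dots> \<in> E z" by (simp add: E_def s zw_def)
    finally show ?thesis .
  qed
  show "spectral_radius (free_product G) (fp_gens G S) < spectral_radius (free_product G') (fp_gens G' S')"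
    using Z cZ disj ker pp by (intro F.spectral_radius_strict[of Z "n + 2" E]) auto
  show "asymptotic_entropy (free_product G') (fp_gens G' S') < asymptotic_entropy (free_product G) (fp_gens G S)"
    using Z cZ disj ker pp by (intro F.asymptotic_entropy_strict[of Z "(n + 2) + (n + 2)" E]) auto
qed

end

section \<open>Critical probabilities of the free product\<close>

definition theta :: "bool \<Rightarrow> ('a, 'b) monoid_scheme \<Rightarrow> 'a set \<Rightarrow> real \<Rightarrow> real" where
  "theta b G S p = (if b then theta_bond G S p else theta_site G S p)"

text \<open>A copy of the free product on a countable type: the family in the theorem has to live on
  one type, and the percolation events need countably many indices.\<close>

locale fp_marked = involution_marked G S for G :: "('a, 'b) monoid_scheme" (structure) and S +
  fixes H :: "('n :: countable) monoid" and \<phi> :: "'a list \<Rightarrow> 'n"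
  assumes group_H: "group H" and iso: "\<phi> \<in> iso (free_product G) H"
begin

abbreviation "T \<equiv> \<phi> ` fp_gens G S"

lemma inj_phi: "inj_on \<phi> (fp_lists G)" and phi_image: "\<phi> ` fp_lists G = carrier H"
  and phi_mult: "l \<in> fp_lists G \<Longrightarrow> m \<in> fp_lists G \<Longrightarrow> \<phi> (l \<otimes>\<^bsub>free_product G\<^esub> m) = \<phi> l \<otimes>\<^bsub>H\<^esub> \<phi> m"
  using iso by (auto simp: iso_def bij_betw_def hom_def FP_simps(1))

lemma phi_closed: "l \<in> fp_lists G \<Longrightarrow> \<phi> l \<in> carrier H"
  using phi_image by auto

sublocale H: group H by (rule group_H)

lemma phi_one: "\<phi> [\<one>] = \<one>\<^bsub>H\<^esub>"
  using phi_mult[of "[\<one>]" "[\<one>]"] phi_closed[of "[\<one>]"] by (simp add: FP_one_right)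

lemma involution_covering_phi: "involution_covering (free_product G) (fp_gens G S) H T \<phi>"
proof (intro involution_covering.intro involution_covering_axioms.intro involution_marked_free_product
    involution_marked.intro involution_marked_axioms.intro group_H)
  show "\<phi> \<in> hom (free_product G) H" using iso by (simp add: iso_def)
  show "bij_betw \<phi> (fp_gens G S) T"
    using inj_on_subset[OF inj_phi fp_gens_closed] by (simp add: bij_betw_def)
  interpret F: involution_marked "free_product G" "fp_gens G S" by (rule involution_marked_free_product)
  fix s assume "s \<in> T"
  then obtain l where l: "l \<in> fp_gens G S" "s = \<phi> l" by auto
  then have "l \<in> fp_lists G" using fp_gens_closed by auto
  then show "s \<otimes>\<^bsub>H\<^esub> s = \<one>\<^bsub>H\<^esub>"
    using F.S_involution[OF l(1)] l phi_one by (simp add: phi_mult[symmetric] FP_simps(3))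
next
  show "finite T" using fin_S by (simp add: fp_gens_def)
  show "T \<subseteq> carrier H" using fp_gens_closed phi_closed by auto
  show "T \<noteq> {}" by (simp add: fp_gens_def)
qed

sublocale cov: involution_covering "free_product G" "fp_gens G S" H T \<phi>
  by (rule involution_covering_phi)

definition edge :: "'n \<Rightarrow> 'n \<Rightarrow> bool" where
  "edge u v \<longleftrightarrow> {u, v} \<in> cayley_edges H T"

lemma edge_phi: assumes "l \<in> fp_lists G"
  shows "edge (\<phi> l) v \<longleftrightarrow> v = \<phi> (tmul G l) \<or> (\<exists>s\<in>S. v = \<phi> (rmul G l s))"
proof -
  have "{v. edge (\<phi> l) v} = (\<lambda>s. \<phi> l \<otimes>\<^bsub>H\<^esub> s) ` T"
    unfolding edge_def by (rule cov.G'.neighbours[OF phi_closed[OF assms]])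
  also have "\<dots> = \<phi> ` (\<lambda>s. l \<otimes>\<^bsub>free_product G\<^esub> s) ` fp_gens G S"
    unfolding image_image using assms fp_gens_closed by (intro image_cong) (auto simp: phi_mult)
  also have "(\<lambda>s. l \<otimes>\<^bsub>free_product G\<^esub> s) ` fp_gens G S = insert (tmul G l) (rmul G l ` S)"
    using assms by (simp add: fp_gens_def FP_t FP_single image_image)
  finally have "v \<in> {v. edge (\<phi> l) v} \<longleftrightarrow> v \<in> \<phi> ` insert (tmul G l) (rmul G l ` S)" by simp
  then show ?thesis by auto
qed

lemma edge_closed: "edge u v \<Longrightarrow> u \<in> carrier H \<and> v \<in> carrier H"
  using cov.G'.S_closed by (auto simp: edge_def cayley_edges_def doubleton_eq_iff)

text \<open>The indices at reduced positions; the root coset \<open>[]\<close> is entered by no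
  step.\<close>

definition coords :: "bool \<Rightarrow> ('a list \<times> 'a set option) set" where
  "coords b = {(l, Some j) | l j. l \<in> fp_parents G \<and> j \<in> indices b} \<union> {(l, None) | l. l \<in> fp_parents G \<and> l \<noteq> []}"

text \<open>The edge or site of the free product that an index stands for. The entry site
  \<open>l @ [\<one>]\<close> belongs to \<open>(l, None)\<close> and is absent among the copies at
  \<open>l\<close>, because \<open>indices\<close> leaves out \<open>{\<one>}\<close>; so no site
  has two indices.\<close>

fun place :: "bool \<Rightarrow> ('a list \<times> 'a set option) \<Rightarrow> 'a list set" where
  "place b (l, Some j) = (\<lambda>x. l @ [x]) ` j"
| "place b (l, None) = step_ix b l (l @ [\<one>])"

lemma indices_nonempty: "j \<in> indices b \<Longrightarrow> j \<noteq> {} \<and> j \<noteq> {\<one>} \<and> j \<subseteq> carrier G"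
  using S_closed by (auto simp: indices_def step_ix_def split: if_splits)

lemma parent_snoc_one: "l \<in> fp_parents G \<Longrightarrow> l @ [\<one>] \<in> fp_lists G"
  by (simp add: fp_parents_snoc)

lemma parent_closed: "l \<in> fp_parents G \<Longrightarrow> l \<noteq> [] \<Longrightarrow> l \<in> fp_lists G"
  using fp_parents_subset by auto

lemma place_closed: "d \<in> coords b \<Longrightarrow> place b d \<subseteq> fp_lists G"
  using indices_nonempty parent_closed
  by (auto simp: coords_def fp_parents_snoc step_ix_def subset_eq split: if_splits)

lemma place_Some_None: assumes "j \<in> indices b" shows "place b (l, Some j) \<noteq> place b (m, None)"
proof
  assume eq: "place b (l, Some j) = place b (m, None)"
  have "m @ [\<one>] \<in> place b (l, Some j)" unfolding eq by (simp add: step_ix_target)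
  then have lm: "l = m" by auto
  show False
  proof (cases b)
    case True
    then have "m \<in> place b (l, Some j)" unfolding eq by (simp add: step_ix_def)
    then show False using lm by auto
  next
    case False
    then have "(\<lambda>x. m @ [x]) ` j = (\<lambda>x. m @ [x]) ` {\<one>}" using eq lm by (simp add: step_ix_def)
    then have "j = {\<one>}" by (subst (asm) inj_image_eq_iff) (auto simp: inj_on_def)
    then show False using indices_nonempty[OF assms] by simp
  qed
qed

lemma inj_place: "inj_on (place b) (coords b)"
proof (rule inj_onI)
  fix d d' assume d: "d \<in> coords b" "d' \<in> coords b" and eq: "place b d = place b d'"
  obtain l o1 m o2 where dd: "d = (l, o1)" "d' = (m, o2)" by (cases d, cases d') auto
  show "d = d'"
  proof (cases o1; cases o2)
    fix j j' assume o: "o1 = Some j" "o2 = Some j'"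
    have j: "j \<in> indices b" using d dd o by (auto simp: coords_def)
    then obtain x where "x \<in> j" using indices_nonempty by blast
    then have "l @ [x] \<in> place b d'" using eq dd o by auto
    then have lm: "l = m" using dd o by auto
    have "(\<lambda>x. m @ [x]) ` j = (\<lambda>x. m @ [x]) ` j'" using eq dd o lm by simp
    then have "j = j'" by (subst (asm) inj_image_eq_iff) (auto simp: inj_on_def)
    then show ?thesis using dd o lm by simp
  next
    fix j assume o: "o1 = Some j" "o2 = None"
    then show ?thesis using place_Some_None[of j b l m] eq dd d by (auto simp: coords_def)
  next
    fix j assume o: "o1 = None" "o2 = Some j"
    then show ?thesis using place_Some_None[of j b m l] eq dd d by (auto simp: coords_def)
  next
    assume o: "o1 = None" "o2 = None"
    then have *: "step_ix b l (l @ [\<one>]) = step_ix b m (m @ [\<one>])" using eq dd by simp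
    have "m @ [\<one>] \<in> {l, l @ [\<one>]}" "l @ [\<one>] \<in> {m, m @ [\<one>]}"
      using step_ix_eqD[OF *] step_ix_eqD[OF *[symmetric]] by simp_all
    then show ?thesis using dd o by auto
  qed
qed

definition site_bond :: "bool \<Rightarrow> ('a list \<times> 'a set option) \<Rightarrow> 'n set" where
  "site_bond b d = \<phi> ` place b d"

lemma inj_site_bond: "inj_on (site_bond b) (coords b)"
proof (rule inj_onI)
  fix d d' assume d: "d \<in> coords b" "d' \<in> coords b" and eq: "site_bond b d = site_bond b d'"
  have "place b d = place b d'"
    using eq inj_on_image_eq_iff[OF inj_phi place_closed[OF d(1)] place_closed[OF d(2)]]
    by (simp add: site_bond_def)
  then show "d = d'" using inj_place d by (auto dest: inj_onD)
qed

lemma site_bond_Some: "site_bond b (l, Some (step_ix b x y)) = step_ix b (\<phi> (l @ [x])) (\<phi> (l @ [y]))"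
  by (simp add: site_bond_def step_ix_image image_image)

lemma site_bond_None: "site_bond b (l, None) = step_ix b (\<phi> l) (\<phi> (l @ [\<one>]))"
  by (simp add: site_bond_def step_ix_image)

lemma finite_site_bond: "d \<in> coords b \<Longrightarrow> finite (site_bond b d)"
  using finite_indices by (auto simp: coords_def site_bond_def finite_step_ix)

lemma countable_coords: "countable (coords b)"
proof (rule countable_image_inj_on[OF _ inj_site_bond])
  show "countable (site_bond b ` coords b)"
    by (rule countable_subset[OF _ countable_Collect_finite]) (auto simp: finite_site_bond)
qed

lemma coords_cases:
  assumes "d \<in> coords b"
  obtains (coset) l x s where "d = (l, Some (step_ix b x (x \<otimes> s)))" "l \<in> fp_parents G" "x \<in> carrier G" "s \<in> S"
    | (enter) l where "d = (l, None)" "l \<in> fp_parents G" "l \<noteq> []"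
  using assms by (auto simp: coords_def indices_def)

lemma edge_coset: "l \<in> fp_parents G \<Longrightarrow> x \<in> carrier G \<Longrightarrow> s \<in> S \<Longrightarrow> edge (\<phi> (l @ [x])) (\<phi> (l @ [x \<otimes> s]))"
  by (subst edge_phi) (auto simp: fp_parents_snoc rmul_def)

lemma edge_enter: "l \<in> fp_parents G \<Longrightarrow> l \<noteq> [] \<Longrightarrow> edge (\<phi> l) (\<phi> (l @ [\<one>]))"
  by (subst edge_phi) (auto simp: parent_closed tmul_parent)

lemma surv_ix_subset: "J \<subseteq> indices b \<Longrightarrow> l \<in> fp_parents G \<Longrightarrow> surv_ix J n l \<subseteq> coords b"
proof (induction n arbitrary: l)
  case (Suc n)
  have "l @ [x] \<in> fp_parents G" if "x \<in> carrier G" "x \<noteq> \<one>" for x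
    using that Suc.prems by (cases l) (auto simp: fp_parents_def)
  then show ?case using Suc by (auto simp: coords_def subset_eq)
qed simp

lemma cluster_closed: assumes "A \<subseteq> coords b" "l \<in> cluster b A" shows "l \<in> fp_lists G"
  using assms(2)
proof induction
  case (start x)
  then have "x \<in> carrier G" using reach_closed[of "{\<one>}"] by auto
  then show ?case by (rule single_fp)
next
  case (extend l x)
  then have "x \<in> carrier G" using reach_closed[of "{\<one>}"] by auto
  then show ?case using extend by (simp add: fp_parents_snoc fp_parents_iff)
qed

definition connect :: "bool \<Rightarrow> 'n set set \<Rightarrow> ('n \<times> 'n) set" where
  "connect b Q = {(u, v). edge u v \<and> step_ix b u v \<in> Q}"

text \<open>A step in the Cayley graph stays in its coset, enters a new one or returns to the
  parent. The last case needs no rule in \<open>cluster\<close>, because the parent was in the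
  cluster before the coset was entered.\<close>

lemma connect_cluster:
  "(connect b Q)\<^sup>* `` {\<phi> [\<one>]} = \<phi> ` cluster b {d \<in> coords b. site_bond b d \<in> Q}"
proof -
  let ?A = "{d \<in> coords b. site_bond b d \<in> Q}"
  let ?C = "(connect b Q)\<^sup>* `` {\<phi> [\<one>]}"
  have cl: "l \<in> fp_lists G" if "l \<in> cluster b ?A" for l using cluster_closed[of ?A b l] that by auto
  have sub: "v \<in> \<phi> ` cluster b ?A" if "(\<phi> [\<one>], v) \<in> (connect b Q)\<^sup>*" for v
    using that
  proof (induction rule: rtrancl_induct)
    case base
    have "\<one> \<in> reach b {\<one>} (copy ?A [])" using reach_start[of "{\<one>}"] by auto
    then show ?case by (auto intro: cluster.start)
  next
    case (step u v)
    then obtain l where l: "l \<in> cluster b ?A" "u = \<phi> l" by auto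
    have lV: "l \<in> fp_lists G" using cl[OF l(1)] .
    have uv: "edge (\<phi> l) v" "step_ix b (\<phi> l) v \<in> Q" using step l by (auto simp: connect_def)
    obtain m x where m: "l = m @ [x]" using lV by (cases l rule: rev_cases) (auto simp: fp_lists_def)
    have mx: "m \<in> fp_parents G" "x \<in> carrier G" using lV m by (auto simp: fp_parents_snoc)
    have ent: "entered b ?A m" "x \<in> reach b {\<one>} (copy ?A m)" using l(1) m by (auto simp: snoc_in_cluster)
    from uv(1) consider (t) "v = \<phi> (tmul G l)" | (s) s where "s \<in> S" "v = \<phi> (m @ [x \<otimes> s])"
      unfolding edge_phi[OF lV] using m by (auto simp: rmul_def)
    then show ?case
    proof cases
      case s
      have "m @ [x \<otimes> s] \<in> cluster b ?A"
      proof (cases "step_ix b x (x \<otimes> s) = {\<one>}")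
        \<comment> \<open>This index is left out of \<open>indices\<close>, but its target is the
          entry point, which belongs to the cluster as soon as the coset is entered.\<close>
        case True
        then have "x \<otimes> s = \<one>" using step_ix_target[of "x \<otimes> s" b x] by auto
        then show ?thesis using ent reach_start[of "{\<one>}"] by (auto simp: snoc_in_cluster)
      next
        case False
        then have "step_ix b x (x \<otimes> s) \<in> indices b" using mx s by (auto simp: indices_def)
        then have "(m, Some (step_ix b x (x \<otimes> s))) \<in> ?A"
          using mx uv s m by (simp add: coords_def site_bond_Some)
        then have "x \<otimes> s \<in> reach b {\<one>} (copy ?A m)"
          using ent mx s by (intro reach_step) (auto simp: copy_def)
        then show ?thesis using ent by (simp add: snoc_in_cluster)
      qed
      then show ?thesis using s by auto
    next
      case t
      show ?thesis
      proof (cases "l \<in> fp_parents G")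
        case True
        have ln: "l \<noteq> []" using m by simp
        have v: "v = \<phi> (l @ [\<one>])" using t tmul_parent[OF True ln] by simp
        have "(l, None) \<in> ?A" using True ln uv v by (simp add: coords_def site_bond_None)
        then have "entered b ?A l" using l(1) True fp_parents_iff[OF lV] by (auto simp: entered_def)
        then have "l @ [\<one>] \<in> cluster b ?A" using reach_start[of "{\<one>}"] by (auto simp: snoc_in_cluster)
        then show ?thesis using v by auto
      next
        \<comment> \<open>Here \<open>l\<close> is an entry point, so \<open>t\<close> leads back to
          the parent \<open>m\<close>.\<close>
        case False
        then have "2 \<le> length l" "last l = \<one>" using fp_parents_iff[OF lV] by auto
        then have "m \<noteq> []" "tmul G l = m" using m by (auto simp: tmul_def)
        then have "m \<in> cluster b ?A" using ent by (simp add: entered_def)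
        then show ?thesis using t \<open>tmul G l = m\<close> by auto
      qed
    qed
  qed
  have C_step: "v \<in> ?C" if "u \<in> ?C" "edge u v" "step_ix b u v \<in> Q" for u v
    using that by (auto simp: connect_def intro: rtrancl_into_rtrancl)
  have coset: "\<phi> (m @ [x]) \<in> ?C" if m: "m \<in> fp_parents G" "\<phi> (m @ [\<one>]) \<in> ?C" and x: "x \<in> reach b {\<one>} (copy ?A m)" for m x
  proof -
    have "reach b {\<one>} (copy ?A m) \<subseteq> {x. \<phi> (m @ [x]) \<in> ?C}"
    proof (rule reach_least)
      show "{\<one>} \<subseteq> {x. \<phi> (m @ [x]) \<in> ?C}" using m by simp
      fix y s assume y: "y \<in> {x. \<phi> (m @ [x]) \<in> ?C}" "y \<in> carrier G" "s \<in> S" "step_ix b y (y \<otimes> s) \<in> copy ?A m"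
      then have "step_ix b (\<phi> (m @ [y])) (\<phi> (m @ [y \<otimes> s])) \<in> Q"
        by (simp add: copy_def site_bond_Some)
      then show "y \<otimes> s \<in> {x. \<phi> (m @ [x]) \<in> ?C}"
        using y m edge_coset[of m y s] C_step by blast
    qed
    then show ?thesis using x by auto
  qed
  have sup: "\<phi> l \<in> ?C" if "l \<in> cluster b ?A" for l
    using that
  proof induction
    case (start x)
    then show ?case using coset[of "[]" x] by (simp add: fp_parents_def)
  next
    case (extend l x)
    have l: "l \<in> fp_parents G" "l \<noteq> []" "step_ix b (\<phi> l) (\<phi> (l @ [\<one>])) \<in> Q"
      using extend(3) by (auto simp: coords_def site_bond_None)
    have "\<phi> (l @ [\<one>]) \<in> ?C" using C_step[OF extend.IH edge_enter[OF l(1,2)] l(3)] .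
    then show ?case using coset[OF l(1) _ extend(4)] by simp
  qed
  show ?thesis using sub sup by auto
qed

lemma infinite_image_cluster:
  assumes "A \<subseteq> coords b" shows "infinite (\<phi> ` cluster b A) \<longleftrightarrow> infinite (cluster b A)"
proof -
  have "cluster b A \<subseteq> fp_lists G" using cluster_closed[OF assms] by auto
  then show ?thesis by (simp add: finite_image_iff inj_on_subset[OF inj_phi])
qed

lemma cluster_embedding_bond:
  assumes "0 < p" "p \<le> 1"
  shows "cluster_embedding G S (cayley_edges H T) (coords True) (site_bond True) p True"
proof (intro cluster_embedding.intro bernoulli_embedding.intro cluster_embedding_axioms.intro
    inj_site_bond countable_coords assms involution_marked_axioms)
  show "site_bond True ` coords True \<subseteq> cayley_edges H T"
  proof
    fix a assume "a \<in> site_bond True ` coords True"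
    then obtain d where d: "d \<in> coords True" "a = site_bond True d" by auto
    from d(1) show "a \<in> cayley_edges H T"
    proof (cases rule: coords_cases)
      case (coset l x s)
      then show ?thesis using edge_coset[of l x s] d by (simp add: site_bond_Some) (simp add: edge_def step_ix_def)
    next
      case (enter l)
      then show ?thesis using edge_enter[of l] d by (simp add: site_bond_None) (simp add: edge_def step_ix_def)
    qed
  qed
qed (auto simp: coords_def)

lemma component_bond:
  "component_of (carrier H) {a \<in> cayley_edges H T. \<xi> a} \<one>\<^bsub>H\<^esub> = \<phi> ` cluster True {d \<in> coords True. \<xi> (site_bond True d)}"
proof -
  let ?Q = "{a \<in> cayley_edges H T. \<xi> a}"
  have sub: "site_bond True d \<in> cayley_edges H T" if "d \<in> coords True" for d
  proof -
    interpret cluster_embedding G S "cayley_edges H T" "coords True" "site_bond True" 1 True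
      by (rule cluster_embedding_bond) auto
    show ?thesis using into that by auto
  qed
  have "{(x, y). x \<in> carrier H \<and> y \<in> carrier H \<and> {x, y} \<in> ?Q} = connect True ?Q"
    using edge_closed by (auto simp: connect_def step_ix_def edge_def)
  then have "component_of (carrier H) ?Q \<one>\<^bsub>H\<^esub> = (connect True ?Q)\<^sup>* `` {\<phi> [\<one>]}"
    by (auto simp: component_of_def phi_one)
  also have "{d \<in> coords True. site_bond True d \<in> ?Q} = {d \<in> coords True. \<xi> (site_bond True d)}"
    using sub by auto
  then have "(connect True ?Q)\<^sup>* `` {\<phi> [\<one>]} = \<phi> ` cluster True {d \<in> coords True. \<xi> (site_bond True d)}"
    by (simp only: connect_cluster)
  finally show ?thesis .
qed

text \<open>Site configurations are indexed by vertices, so the singleton is unwrapped.\<close>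

definition site_of :: "('a list \<times> 'a set option) \<Rightarrow> 'n" where
  "site_of d = the_elem (site_bond False d)"

lemma site_of: assumes "d \<in> coords False" shows "site_bond False d = {site_of d}" "site_of d \<in> carrier H" "site_of d \<noteq> \<phi> [\<one>]"
proof -
  from assms have "\<exists>l. l \<in> fp_lists G \<and> l \<noteq> [\<one>] \<and> site_bond False d = {\<phi> l}"
  proof (cases rule: coords_cases)
    case (coset l x s)
    have "l @ [x \<otimes> s] \<noteq> [\<one>]"
    proof
      assume "l @ [x \<otimes> s] = [\<one>]"
      then have "step_ix False x (x \<otimes> s) = {\<one>}" by (simp add: step_ix_def)
      then show False using assms coset by (auto simp: coords_def indices_def)
    qed
    then show ?thesis using coset S_closed
      by (intro exI[of _ "l @ [x \<otimes> s]"]) (auto simp: site_bond_Some fp_parents_snoc, auto simp: step_ix_def)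
  next
    case (enter l)
    then show ?thesis
      by (intro exI[of _ "l @ [\<one>]"]) (auto simp: site_bond_None parent_snoc_one, auto simp: step_ix_def)
  qed
  then obtain l where l: "l \<in> fp_lists G" "l \<noteq> [\<one>]" "site_bond False d = {\<phi> l}" by auto
  then have s: "site_of d = \<phi> l" by (simp add: site_of_def)
  show "site_bond False d = {site_of d}" using l s by simp
  show "site_of d \<in> carrier H" using l s phi_closed by simp
  show "site_of d \<noteq> \<phi> [\<one>]" using l s inj_phi by (auto dest: inj_onD)
qed

lemma cluster_embedding_site:
  assumes "0 < p" "p \<le> 1"
  shows "cluster_embedding G S (carrier H) (coords False) site_of p False"
proof (intro cluster_embedding.intro bernoulli_embedding.intro cluster_embedding_axioms.intro
    countable_coords assms involution_marked_axioms)
  show "inj_on site_of (coords False)"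
  proof (rule inj_onI)
    fix d d' assume d: "d \<in> coords False" "d' \<in> coords False" "site_of d = site_of d'"
    then have "site_bond False d = site_bond False d'" by (simp add: site_of)
    then show "d = d'" using inj_site_bond d by (auto dest: inj_onD)
  qed
  show "site_of ` coords False \<subseteq> carrier H" using site_of by auto
qed (auto simp: coords_def)

text \<open>The relation \<open>connect\<close> checks the target of each step and never its start,
  so the state of the root has to be added; if the root is closed, the component is empty by
  definition.\<close>

lemma component_site:
  "component_of {v \<in> carrier H. \<xi> v} (cayley_edges H T) \<one>\<^bsub>H\<^esub>
    = (if \<xi> (\<phi> [\<one>]) then \<phi> ` cluster False {d \<in> coords False. \<xi> (site_of d)} else {})"
proof (cases "\<xi> (\<phi> [\<one>])")
  case True
  let ?Q = "{{v} | v. v \<in> carrier H \<and> \<xi> v}"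
  let ?R = "{(x, y). x \<in> {v \<in> carrier H. \<xi> v} \<and> y \<in> {v \<in> carrier H. \<xi> v} \<and> {x, y} \<in> cayley_edges H T}"
  have root: "\<phi> [\<one>] \<in> {v \<in> carrier H. \<xi> v}" using True phi_closed by auto
  have sub: "?R \<subseteq> connect False ?Q" by (auto simp: connect_def step_ix_def edge_def)
  have "(\<phi> [\<one>], v) \<in> ?R\<^sup>* \<and> v \<in> {v \<in> carrier H. \<xi> v}" if "(\<phi> [\<one>], v) \<in> (connect False ?Q)\<^sup>*" for v
    using that
  proof (induction rule: rtrancl_induct)
    case base then show ?case using root by simp
  next
    case (step u v)
    then have "(u, v) \<in> ?R" by (auto simp: connect_def step_ix_def edge_def)
    moreover from this have "v \<in> {v \<in> carrier H. \<xi> v}" by auto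
    ultimately show ?case using step.IH by (meson rtrancl.rtrancl_into_rtrancl)
  qed
  then have "(connect False ?Q)\<^sup>* `` {\<phi> [\<one>]} \<subseteq> ?R\<^sup>* `` {\<phi> [\<one>]}" by blast
  moreover have "?R\<^sup>* `` {\<phi> [\<one>]} \<subseteq> (connect False ?Q)\<^sup>* `` {\<phi> [\<one>]}"
    by (rule Image_mono[OF rtrancl_mono[OF sub] order_refl])
  ultimately have "?R\<^sup>* `` {\<phi> [\<one>]} = (connect False ?Q)\<^sup>* `` {\<phi> [\<one>]}" by (rule equalityI[rotated])
  moreover have "component_of {v \<in> carrier H. \<xi> v} (cayley_edges H T) \<one>\<^bsub>H\<^esub> = ?R\<^sup>* `` {\<phi> [\<one>]}"
    using root unfolding component_of_def phi_one[symmetric] by (simp add: Image_singleton)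
  ultimately have "component_of {v \<in> carrier H. \<xi> v} (cayley_edges H T) \<one>\<^bsub>H\<^esub> = (connect False ?Q)\<^sup>* `` {\<phi> [\<one>]}"
    by (simp only:)
  also have "{d \<in> coords False. site_bond False d \<in> ?Q} = {d \<in> coords False. \<xi> (site_of d)}"
    using site_of by auto
  then have "(connect False ?Q)\<^sup>* `` {\<phi> [\<one>]} = \<phi> ` cluster False {d \<in> coords False. \<xi> (site_of d)}"
    by (simp only: connect_cluster)
  finally show ?thesis using True by simp
next
  case False
  then show ?thesis by (auto simp: component_of_def phi_one)
qed

lemma theta_subcritical:
  assumes sub: "subcritical b p" and p: "0 < p" "p \<le> 1" shows "theta b H T p = 0"
proof (cases b)
  case True
  interpret cluster_embedding G S "cayley_edges H T" "coords True" "site_bond True" p True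
    by (rule cluster_embedding_bond[OF p])
  have "theta_bond H T p = measure M {\<xi> \<in> space M. infinite (cluster True (pull \<xi>))}"
    unfolding theta_bond_def Let_def component_bond pull_def
    by (subst infinite_image_cluster) auto
  also have "\<dots> = 0" using sub True by (intro subcritical_measure) auto
  finally show ?thesis using True by (simp add: theta_def)
next
  case False
  interpret cluster_embedding G S "carrier H" "coords False" site_of p False
    by (rule cluster_embedding_site[OF p])
  have "theta_site H T p = measure M {\<xi> \<in> space M. infinite (component_of {v \<in> carrier H. \<xi> v} (cayley_edges H T) \<one>\<^bsub>H\<^esub>)}"
    unfolding theta_site_def Let_def ..
  also have "\<dots> = 0"
  proof (rule subcritical_measure)
    fix \<xi> assume x: "\<xi> \<in> {\<xi> \<in> space M. infinite (component_of {v \<in> carrier H. \<xi> v} (cayley_edges H T) \<one>\<^bsub>H\<^esub>)}"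
    then have "infinite (\<phi> ` cluster False (pull \<xi>))"
      by (auto simp: component_site pull_def split: if_splits)
    then show "\<xi> \<in> space M \<and> infinite (cluster False (pull \<xi>))" using x by auto
  qed (use sub False in simp)
  finally show ?thesis using False by (simp add: theta_def)
qed

lemma theta_supercritical:
  assumes sup: "supercritical b p" and p: "0 < p" "p \<le> 1" shows "theta b H T p > 0"
proof (cases b)
  case True
  interpret cluster_embedding G S "cayley_edges H T" "coords True" "site_bond True" p True
    by (rule cluster_embedding_bond[OF p])
  have "theta_bond H T p = measure M {\<xi> \<in> space M. (\<forall>r\<in>{}. \<xi> r) \<and> infinite (cluster True (pull \<xi>))}"
    unfolding theta_bond_def Let_def component_bond pull_def
    by (subst infinite_image_cluster) auto
  also have "\<dots> > 0"
    using sup True by (intro supercritical_measure surv_ix_subset) (auto simp: fp_parents_def)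
  finally show ?thesis using True by (simp add: theta_def)
next
  case False
  interpret cluster_embedding G S "carrier H" "coords False" site_of p False
    by (rule cluster_embedding_site[OF p])
  \<comment> \<open>The root stands for no index in \<open>coords\<close>, so its openness enters as
    the separate condition \<open>R\<close> of \<open>supercritical_measure\<close>.\<close>
  have "theta_site H T p = measure M {\<xi> \<in> space M. (\<forall>r\<in>{\<phi> [\<one>]}. \<xi> r) \<and> infinite (cluster False (pull \<xi>))}"
    unfolding theta_site_def Let_def component_site pull_def
    by (intro arg_cong[where f = "measure M"]) (auto simp: infinite_image_cluster split: if_splits)
  also have "\<dots> > 0"
  proof (rule supercritical_measure)
    show "{\<phi> [\<one>]} \<inter> site_of ` coords False = {}" using site_of(3) by force
    show "surv_ix J n [] \<subseteq> coords False" if "J \<subseteq> indices False" for J n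
      using that by (intro surv_ix_subset) (auto simp: fp_parents_def)
  qed (use sup False phi_closed in auto)
  finally show ?thesis using False by (simp add: theta_def)
qed

end

definition pc :: "bool \<Rightarrow> ('a, 'b) monoid_scheme \<Rightarrow> 'a set \<Rightarrow> real" where
  "pc b G S = Sup {p \<in> {0..1}. theta b G S p = 0}"

lemma pc_simps: "pc True = pc_bond" "pc False = pc_site"
  by (auto simp: fun_eq_iff pc_def pc_bond_def pc_site_def theta_def)

text \<open>The hypotheses on \<open>S'\<close> describe the ball of radius two in the quotient and
  put its threshold \<open>p1\<close> at most at 9/20, where the path count applies. Nothing above
  \<open>p1\<close> is subcritical for the quotient, so \<open>G\<close> is supercritical at some
  \<open>q\<close> below \<open>p1\<close>, and this \<open>q\<close> bounds its threshold.\<close>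

lemma pc_strict:
  assumes cov: "involution_covering G S G' S' \<pi>" and fp: "fp_marked G S H \<phi>" and fp': "fp_marked G' S' H' \<phi>'"
    and S3: "card S = 3" and one: "\<one>\<^bsub>G'\<^esub> \<notin> S'"
    and two: "inj_on (\<lambda>(s, t). s \<otimes>\<^bsub>G'\<^esub> t) {(s, t). s \<in> S' \<and> t \<in> S' \<and> s \<noteq> t}"
    and two_S: "\<And>s t. s \<in> S' \<Longrightarrow> t \<in> S' \<Longrightarrow> s \<noteq> t \<Longrightarrow> s \<otimes>\<^bsub>G'\<^esub> t \<notin> insert \<one>\<^bsub>G'\<^esub> S'"
    and w: "w \<in> words S L" "wprod G w \<noteq> \<one>\<^bsub>G\<^esub>" "\<pi> (wprod G w) = \<one>\<^bsub>G'\<^esub>"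
  shows "pc b H (\<phi> ` fp_gens G S) < pc b H' (\<phi>' ` fp_gens G' S')"
proof -
  interpret involution_covering G S G' S' \<pi> by (rule cov)
  interpret A: fp_marked G S H \<phi> by (rule fp)
  interpret A': fp_marked G' S' H' \<phi>' by (rule fp')
  have S3': "card S' = 3" using S3 card_S' by simp
  let ?T = "{p \<in> {0..1}. theta b H A.T p = 0}"
  let ?T' = "{p \<in> {0..1}. theta b H' A'.T p = 0}"
  define p1 where "p1 = Sup ?T'"
  have in_T: "1/10 \<in> ?T"
    using A.theta_subcritical[OF G.subcritical_small[OF S3]] by simp
  have in_T': "1/10 \<in> ?T'"
    using A'.theta_subcritical[OF G'.subcritical_small[OF S3']] by simp
  have T'_le: "p \<le> 9/20" if "p \<in> ?T'" for p
  proof (rule ccontr)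
    assume "\<not> ?thesis"
    then have "theta b H' A'.T p > 0"
      using that by (intro A'.theta_supercritical G'.supercritical_of_radius_two[OF S3' one two two_S]) auto
    then show False using that by simp
  qed
  have bdd: "bdd_above ?T'" using T'_le by (rule bdd_aboveI)
  have p1: "0 < p1" "p1 \<le> 9/20"
  proof -
    have "1/10 \<le> p1" unfolding p1_def using in_T' bdd by (rule cSup_upper)
    then show "0 < p1" by simp
    have "?T' \<noteq> {}" using in_T' by blast
    then show "p1 \<le> 9/20" unfolding p1_def using T'_le by (rule cSup_least)
  qed
  have nsub: "\<not> G'.subcritical b q" if q: "p1 < q" "q \<le> 1" for q
  proof
    assume "G'.subcritical b q"
    then have "theta b H' A'.T q = 0" using q p1 by (intro A'.theta_subcritical) auto
    then have "q \<in> ?T'" using q p1 by auto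
    then have "q \<le> p1" unfolding p1_def using bdd by (rule cSup_upper)
    then show False using q by simp
  qed
  obtain q where q: "0 < q" "q < p1" "G.supercritical b q"
    using supercritical_below_threshold[OF S3 p1 nsub w] by auto
  have "Sup ?T \<le> q"
  proof (rule cSup_least)
    show "?T \<noteq> {}" using in_T by blast
    fix p assume p: "p \<in> ?T"
    show "p \<le> q"
    proof (rule ccontr)
      assume "\<not> p \<le> q"
      then have "G.supercritical b p" using q p by (intro G.supercritical_mono[OF q(3)]) auto
      then have "theta b H A.T p > 0" using p q \<open>\<not> p \<le> q\<close> by (intro A.theta_supercritical) auto
      then show False using p by simp
    qed
  qed
  then show ?thesis using q by (simp add: pc_def p1_def)
qed

section \<open>A chain of groups indexed by the reals\<close>

context fp_marked begin

lemma inj_gens: "inj_on \<phi> (fp_gens G S)"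
  by (rule inj_on_subset[OF inj_phi fp_gens_closed])

lemma card_T: "card T = Suc (card S)"
  by (simp add: card_image inj_gens card_fp_gens)

lemma one_notin_T: assumes "\<one> \<notin> S" shows "\<one>\<^bsub>H\<^esub> \<notin> T"
proof
  assume "\<one>\<^bsub>H\<^esub> \<in> T"
  then obtain l where l: "l \<in> fp_gens G S" "\<phi> l = \<phi> [\<one>]" by (auto simp: phi_one)
  then have "l = [\<one>]" using inj_phi fp_gens_closed by (auto dest: inj_onD)
  then show False using l assms by (auto simp: fp_gens_def)
qed

lemma symmetric_generating_T:
  assumes "\<And>a. a \<in> carrier G \<Longrightarrow> \<exists>w. set w \<subseteq> S \<and> a = wprod G w"
  shows "symmetric_generating_set H T"
proof -
  interpret group_hom "free_product G" H \<phi>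
    using iso by unfold_locales (simp add: iso_def)
  have "generate H T = \<phi> ` generate (free_product G) (fp_gens G S)"
    using fp_gens_closed by (intro generate_img) (simp add: FP_simps(1))
  also have "\<dots> = carrier H" using phi_image by (simp add: generate_free_product[OF assms] FP_simps(1))
  finally show ?thesis
    using cov.G'.fin_S cov.G'.S_closed by (simp add: symmetric_generating_set_def cov.G'.inv_gen)
qed

lemma regular_T: assumes "\<one> \<notin> S" shows "regular_simple_graph (Suc (card S)) (carrier H) (cayley_edges H T)"
  unfolding regular_simple_graph_def
proof (intro conjI ballI)
  fix a assume "a \<in> cayley_edges H T"
  then obtain g s where a: "a = {g, g \<otimes>\<^bsub>H\<^esub> s}" "g \<in> carrier H" "s \<in> T" by (auto simp: cayley_edges_def)
  have s: "s \<in> carrier H" using a cov.G'.S_closed by auto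
  then show "a \<subseteq> carrier H" using a by simp
  have "s \<noteq> \<one>\<^bsub>H\<^esub>" using a(3) one_notin_T[OF assms] by metis
  then have "g \<otimes>\<^bsub>H\<^esub> s \<noteq> g" using a(2) s by simp
  then show "card a = 2" unfolding card_2_iff a(1) by (intro exI[of _ g] exI[of _ "g \<otimes>\<^bsub>H\<^esub> s"]) (metis (no_types))
next
  fix v assume v: "v \<in> carrier H"
  have "{a \<in> cayley_edges H T. v \<in> a} = (\<lambda>h. {v, h}) ` {h. {v, h} \<in> cayley_edges H T}"
    by (auto simp: cayley_edges_def insert_commute image_iff)
  also have "\<dots> = (\<lambda>h. {v, h}) ` (\<lambda>s. v \<otimes>\<^bsub>H\<^esub> s) ` T"
    by (simp only: cov.G'.neighbours[OF v])
  also have "card \<dots> = card ((\<lambda>s. v \<otimes>\<^bsub>H\<^esub> s) ` T)"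
    by (intro card_image) (auto simp: inj_on_def doubleton_eq_iff)
  also have "\<dots> = Suc (card S)" using cov.G'.inj_mult[OF v] by (simp only: card_image card_T)
  finally show "card {a \<in> cayley_edges H T. v \<in> a} = Suc (card S)" .
qed

end

section \<open>Transport of structure, and permutation groups generated by involutions\<close>

definition transport :: "('a \<Rightarrow> 'c) \<Rightarrow> ('a, 'b) monoid_scheme \<Rightarrow> 'c monoid" where
  "transport h K = \<lparr>carrier = h ` carrier K,
     mult = (\<lambda>x y. h (inv_into (carrier K) h x \<otimes>\<^bsub>K\<^esub> inv_into (carrier K) h y)), one = h \<one>\<^bsub>K\<^esub>\<rparr>"

lemma transport_iso: assumes "inj_on h (carrier K)" shows "h \<in> iso K (transport h K)"
  using assms by (auto simp: iso_def hom_def transport_def bij_betw_def)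

lemma group_transport: assumes "group K" "inj_on h (carrier K)" shows "group (transport h K)"
proof -
  have "group ((transport h K)\<lparr>one := h \<one>\<^bsub>K\<^esub>\<rparr>)"
    using group.iso_imp_img_group[OF assms(1) transport_iso[OF assms(2)]] .
  then show ?thesis by (simp add: transport_def)
qed

definition involution_group :: "('x \<Rightarrow> 'x) set \<Rightarrow> ('x \<Rightarrow> 'x) monoid" where
  "involution_group S = \<lparr>carrier = {foldr (\<circ>) w id | w. set w \<subseteq> S}, mult = (\<circ>), one = id\<rparr>"

lemma wprod_involution_group: "wprod (involution_group S) w = foldr (\<circ>) w id"
  by (induction w) (simp_all add: involution_group_def)

lemma foldr_comp_append: "foldr (\<circ>) (u @ v) id = foldr (\<circ>) u id \<circ> foldr (\<circ>) v id"
  by (induction u) auto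

lemma foldr_comp_rev: "(\<And>s. s \<in> set w \<Longrightarrow> s \<circ> s = id) \<Longrightarrow> foldr (\<circ>) (rev w) id \<circ> foldr (\<circ>) w id = id"
proof (induction w)
  case (Cons s w)
  have ss: "s \<circ> s = id" by (rule Cons.prems) simp
  have "foldr (\<circ>) (rev (s # w)) id \<circ> foldr (\<circ>) (s # w) id = foldr (\<circ>) (rev w) id \<circ> (s \<circ> s) \<circ> foldr (\<circ>) w id"
    by (simp add: foldr_comp_append o_assoc del: foldr_append)
  also have "\<dots> = foldr (\<circ>) (rev w) id \<circ> foldr (\<circ>) w id" by (simp only: ss comp_id)
  also have "\<dots> = id" by (rule Cons.IH) (rule Cons.prems, simp)
  finally show ?case .
qed simp

lemma involution_marked_involution_group:
  assumes "finite S" "S \<noteq> {}" "\<And>s. s \<in> S \<Longrightarrow> s \<circ> s = id"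
  shows "involution_marked (involution_group S) S"
proof (intro involution_marked.intro involution_marked_axioms.intro)
  let ?K = "involution_group S"
  show "group ?K"
  proof (rule groupI)
    fix x y assume "x \<in> carrier ?K" "y \<in> carrier ?K"
    then obtain u v where "set u \<subseteq> S" "x = foldr (\<circ>) u id" "set v \<subseteq> S" "y = foldr (\<circ>) v id"
      by (auto simp: involution_group_def)
    then show "x \<otimes>\<^bsub>?K\<^esub> y \<in> carrier ?K"
      by (auto simp: involution_group_def foldr_comp_append simp del: foldr_append intro!: exI[of _ "u @ v"])
  next
    fix x assume "x \<in> carrier ?K"
    then obtain u where u: "set u \<subseteq> S" "x = foldr (\<circ>) u id" by (auto simp: involution_group_def)
    then have "foldr (\<circ>) (rev u) id \<circ> x = id" using assms(3) by (auto intro!: foldr_comp_rev)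
    moreover have "foldr (\<circ>) (rev u) id \<in> carrier ?K" using u by (force simp: involution_group_def)
    ultimately show "\<exists>y\<in>carrier ?K. y \<otimes>\<^bsub>?K\<^esub> x = \<one>\<^bsub>?K\<^esub>" by (auto simp: involution_group_def)
  qed (auto simp: involution_group_def o_assoc intro: exI[of _ "[]"])
  show "S \<subseteq> carrier ?K"
  proof
    fix s assume "s \<in> S"
    then show "s \<in> carrier ?K" by (auto simp: involution_group_def intro!: exI[of _ "[s]"])
  qed
qed (use assms in \<open>auto simp: involution_group_def\<close>)

text \<open>In row \<open>i\<close> the letters \<open>0\<close> and \<open>1\<close> act as the reflections generating the infinite dihedral group
  of \<open>\<int>\<close>, and the letter \<open>2\<close> as the transposition of \<open>0\<close> and \<open>i + 2\<close>.\<close>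

definition row :: "nat \<Rightarrow> nat \<Rightarrow> int \<Rightarrow> int" where
  "row c i n = (if c = 0 then - n else if c = 1 then 1 - n
     else if n = 0 then int i + 2 else if n = int i + 2 then 0 else n)"

text \<open>Rows outside \<open>W\<close> stay fixed, so all groups act on one set and forgetting
  rows is a quotient map.\<close>

definition gen :: "nat set \<Rightarrow> nat \<Rightarrow> nat \<times> int \<Rightarrow> nat \<times> int" where
  "gen W c = (\<lambda>(i, n). (i, if i \<in> W then row c i n else n))"

definition gens :: "nat set \<Rightarrow> (nat \<times> int \<Rightarrow> nat \<times> int) set" where
  "gens W = gen W ` {..<3}"

lemma row_row: "row c i (row c i n) = n"
  by (auto simp: row_def)

lemma gen_gen: "gen W c \<circ> gen W c = id"
  by (auto simp: gen_def fun_eq_iff row_row)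

lemma less_3: "(c::nat) < 3 \<longleftrightarrow> c = 0 \<or> c = 1 \<or> c = 2"
  by auto

text \<open>The images of three points already tell apart the identity, the letters and the products
  of two different letters. The point \<open>i + 7\<close> is fixed by the transposition, and so are
  its two reflections.\<close>

definition samples :: "(int \<Rightarrow> int) \<Rightarrow> nat \<Rightarrow> int \<times> int \<times> int" where
  "samples h i = (h 0, h 1, h (int i + 7))"

lemma samples_row:
  "samples (row 0 i) i = (0, - 1, - int i - 7)" "samples (row (Suc 0) i) i = (1, 0, - int i - 6)"
  "samples (row 2 i) i = (int i + 2, 1, int i + 7)" "samples id i = (0, 1, int i + 7)"
  by (auto simp: samples_def row_def)

lemma samples_row_pair:
  "samples (row 0 i \<circ> row (Suc 0) i) i = (- 1, 0, int i + 6)"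
  "samples (row (Suc 0) i \<circ> row 0 i) i = (1, 2, int i + 8)"
  "samples (row 0 i \<circ> row 2 i) i = (- int i - 2, - 1, - int i - 7)"
  "samples (row 2 i \<circ> row 0 i) i = (int i + 2, - 1, - int i - 7)"
  "samples (row (Suc 0) i \<circ> row 2 i) i = (- int i - 1, 0, - int i - 6)"
  "samples (row 2 i \<circ> row (Suc 0) i) i = (1, int i + 2, - int i - 6)"
  by (auto simp: samples_def row_def)

lemma row_distinct:
  assumes "c < 3" "d < 3" "row c i = row d i" shows "c = d"
proof -
  have "samples (row c i) i = samples (row d i) i" using assms by simp
  then show ?thesis using assms(1,2) unfolding less_3
    by (elim disjE; simp add: samples_row)
qed

lemma row_pair_distinct:
  assumes "c < 3" "d < 3" "c \<noteq> d" "c' < 3" "d' < 3" "c' \<noteq> d'"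
    and "row c i \<circ> row d i = row c' i \<circ> row d' i"
  shows "c = c' \<and> d = d'"
proof -
  have "samples (row c i \<circ> row d i) i = samples (row c' i \<circ> row d' i) i" using assms by simp
  then show ?thesis using assms(1-6) unfolding less_3
    by (elim disjE; simp add: samples_row_pair)
qed

lemma row_pair_not_row:
  assumes "c < 3" "d < 3" "c \<noteq> d" "e < 3"
  shows "row c i \<circ> row d i \<noteq> row e i" "row c i \<circ> row d i \<noteq> id" "row e i \<noteq> id"
proof -
  have "samples (row c i \<circ> row d i) i \<noteq> samples (row e i) i"
    using assms unfolding less_3 by (elim disjE; simp add: samples_row samples_row_pair)
  then show "row c i \<circ> row d i \<noteq> row e i" by metis
  have "samples (row c i \<circ> row d i) i \<noteq> samples id i"
    using assms unfolding less_3 by (elim disjE; simp add: samples_row samples_row_pair)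
  then show "row c i \<circ> row d i \<noteq> id" by metis
  have "samples (row e i) i \<noteq> samples id i"
    using assms unfolding less_3 by (elim disjE; simp add: samples_row)
  then show "row e i \<noteq> id" by metis
qed

definition row_word :: "nat \<Rightarrow> nat list \<Rightarrow> int \<Rightarrow> int" where
  "row_word i w = foldr (\<lambda>c. row c i) w"

lemma row_word_simps [simp]: "row_word i [] n = n" "row_word i (c # w) n = row c i (row_word i w n)"
  and row_word_append [simp]: "row_word i (u @ v) n = row_word i u (row_word i v n)"
  by (simp_all add: row_word_def)

lemma gen_word: "foldr (\<circ>) (map (gen W) w) id (i, n) = (i, if i \<in> W then row_word i w n else n)"
  by (induction w) (auto simp: gen_def)

lemma gen_word_eq_id: "foldr (\<circ>) (map (gen W) w) id = id \<longleftrightarrow> (\<forall>i\<in>W. \<forall>n. row_word i w n = n)"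
proof
  assume h: "foldr (\<circ>) (map (gen W) w) id = id"
  show "\<forall>i\<in>W. \<forall>n. row_word i w n = n"
  proof (intro ballI allI)
    fix i n assume "i \<in> W"
    then show "row_word i w n = n" using fun_cong[OF h, of "(i, n)"] by (simp add: gen_word)
  qed
qed (auto simp: fun_eq_iff gen_word)

lemma gen_rows: assumes "i \<in> W" "gen W c = gen W d" shows "row c i = row d i"
proof
  fix n show "row c i n = row d i n" using fun_cong[OF assms(2), of "(i, n)"] assms(1) by (simp add: gen_def)
qed

lemma gen_pair_rows: assumes "i \<in> W" "gen W c \<circ> gen W d = gen W c' \<circ> gen W d'"
  shows "row c i \<circ> row d i = row c' i \<circ> row d' i"
proof
  fix n show "(row c i \<circ> row d i) n = (row c' i \<circ> row d' i) n"
    using fun_cong[OF assms(2), of "(i, n)"] assms(1) by (simp add: gen_def)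
qed

lemma gen_pair_row: assumes "i \<in> W" "gen W c \<circ> gen W d = gen W e"
  shows "row c i \<circ> row d i = row e i"
proof
  fix n show "(row c i \<circ> row d i) n = row e i n"
    using fun_cong[OF assms(2), of "(i, n)"] assms(1) by (simp add: gen_def)
qed

lemma gen_pair_id: assumes "i \<in> W" "gen W c \<circ> gen W d = id" shows "row c i \<circ> row d i = id"
proof
  fix n show "(row c i \<circ> row d i) n = id n"
    using fun_cong[OF assms(2), of "(i, n)"] assms(1) by (simp add: gen_def)
qed

lemma gen_id: assumes "i \<in> W" "gen W c = id" shows "row c i = id"
proof
  fix n show "row c i n = id n"
    using fun_cong[OF assms(2), of "(i, n)"] assms(1) by (simp add: gen_def)
qed

lemma card_gens: assumes "W \<noteq> {}" shows "card (gens W) = 3"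
proof -
  obtain i where i: "i \<in> W" using assms by auto
  have "inj_on (gen W) {..<3}"
  proof (rule inj_onI)
    fix c d :: nat assume "c \<in> {..<3}" "d \<in> {..<3}" "gen W c = gen W d"
    then show "c = d" using row_distinct gen_rows[OF i] by blast
  qed
  then show ?thesis by (simp add: gens_def card_image)
qed

abbreviation row_group :: "nat set \<Rightarrow> (nat \<times> int \<Rightarrow> nat \<times> int) monoid" where
  "row_group W \<equiv> involution_group (gens W)"

lemma row_group_marked: "involution_marked (row_group W) (gens W)"
proof (rule involution_marked_involution_group)
  have "gen W 0 \<in> gens W" by (simp add: gens_def)
  then show "gens W \<noteq> {}" by blast
qed (auto simp: gens_def gen_gen)

lemma one_notin_gens: assumes "W \<noteq> {}" shows "\<one>\<^bsub>row_group W\<^esub> \<notin> gens W"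
proof
  assume "\<one>\<^bsub>row_group W\<^esub> \<in> gens W"
  then obtain c where c: "c < 3" "gen W c = id" by (auto simp: gens_def involution_group_def)
  obtain i where i: "i \<in> W" using assms by auto
  show False using row_pair_not_row(3)[of 0 1 c i] gen_id[OF i c(2)] c by simp
qed

lemma gens_pairs_inj: assumes "W \<noteq> {}"
  shows "inj_on (\<lambda>(s, t). s \<otimes>\<^bsub>row_group W\<^esub> t) {(s, t). s \<in> gens W \<and> t \<in> gens W \<and> s \<noteq> t}"
proof (rule inj_onI)
  obtain i where i: "i \<in> W" using assms by auto
  fix p q
  assume p: "p \<in> {(s, t). s \<in> gens W \<and> t \<in> gens W \<and> s \<noteq> t}" and q: "q \<in> {(s, t). s \<in> gens W \<and> t \<in> gens W \<and> s \<noteq> t}"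
    and eq: "(\<lambda>(s, t). s \<otimes>\<^bsub>row_group W\<^esub> t) p = (\<lambda>(s, t). s \<otimes>\<^bsub>row_group W\<^esub> t) q"
  obtain c d where cd: "p = (gen W c, gen W d)" "c < 3" "d < 3" "c \<noteq> d" using p by (auto simp: gens_def)
  obtain c' d' where cd': "q = (gen W c', gen W d')" "c' < 3" "d' < 3" "c' \<noteq> d'" using q by (auto simp: gens_def)
  have "gen W c \<circ> gen W d = gen W c' \<circ> gen W d'" using eq cd cd' by (simp add: involution_group_def)
  from row_pair_distinct[OF cd(2-4) cd'(2-4) gen_pair_rows[OF i this]] show "p = q" using cd cd' by simp
qed

lemma gens_pairs_notin: assumes "W \<noteq> {}" "s \<in> gens W" "t \<in> gens W" "s \<noteq> t"
  shows "s \<otimes>\<^bsub>row_group W\<^esub> t \<notin> insert \<one>\<^bsub>row_group W\<^esub> (gens W)"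
proof
  assume st: "s \<otimes>\<^bsub>row_group W\<^esub> t \<in> insert \<one>\<^bsub>row_group W\<^esub> (gens W)"
  obtain i where i: "i \<in> W" using assms by auto
  obtain c d where cd: "s = gen W c" "t = gen W d" "c < 3" "d < 3" "c \<noteq> d" using assms by (auto simp: gens_def)
  from st consider "gen W c \<circ> gen W d = id" | e where "e < 3" "gen W c \<circ> gen W d = gen W e"
    using cd by (auto simp: gens_def involution_group_def)
  then show False
  proof cases
    case 1 then show False using gen_pair_id[OF i 1] row_pair_not_row(2)[OF cd(3-5), of 0] by simp
  next
    case 2 then show False using gen_pair_row[OF i 2(2)] row_pair_not_row(1)[OF cd(3-5) 2(1)] by simp
  qed
qed

definition restrict_rows :: "nat set \<Rightarrow> (nat \<times> int \<Rightarrow> nat \<times> int) \<Rightarrow> nat \<times> int \<Rightarrow> nat \<times> int" where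
  "restrict_rows V f = (\<lambda>(i, n). if i \<in> V then f (i, n) else (i, n))"

lemma row_group_carrier: "f \<in> carrier (row_group W) \<longleftrightarrow> (\<exists>w. set w \<subseteq> {..<3} \<and> f = foldr (\<circ>) (map (gen W) w) id)"
proof
  assume "f \<in> carrier (row_group W)"
  then obtain u where u: "set u \<subseteq> gens W" "f = foldr (\<circ>) u id" by (auto simp: involution_group_def)
  then have "u \<in> lists (gen W ` {..<3})" by (auto simp: gens_def)
  then have "u \<in> map (gen W) ` lists {..<3}" by (simp add: lists_image)
  then show "\<exists>w. set w \<subseteq> {..<3} \<and> f = foldr (\<circ>) (map (gen W) w) id" using u by auto
next
  assume "\<exists>w. set w \<subseteq> {..<3} \<and> f = foldr (\<circ>) (map (gen W) w) id"
  then obtain w where w: "set w \<subseteq> {..<3}" "f = foldr (\<circ>) (map (gen W) w) id" by auto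
  then have "set (map (gen W) w) \<subseteq> gens W" unfolding gens_def set_map by (intro image_mono)
  then show "f \<in> carrier (row_group W)" using w(2)
    unfolding involution_group_def partial_object.simps mem_Collect_eq by blast
qed

lemma restrict_gen_word: "V \<subseteq> W \<Longrightarrow>
  restrict_rows V (foldr (\<circ>) (map (gen W) w) id) = foldr (\<circ>) (map (gen V) w) id"
  by (auto simp: fun_eq_iff restrict_rows_def gen_word)

lemma restrict_gen: "V \<subseteq> W \<Longrightarrow> restrict_rows V (gen W c) = gen V c"
  by (auto simp: fun_eq_iff restrict_rows_def gen_def)

text \<open>Restriction sends the product of a word over \<open>W\<close> to the product of the same
  word over \<open>V\<close>, hence is multiplicative.\<close>

lemma row_group_covering:
  assumes "V \<subseteq> W" "V \<noteq> {}"
  shows "involution_covering (row_group W) (gens W) (row_group V) (gens V) (restrict_rows V)"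
proof (intro involution_covering.intro involution_covering_axioms.intro row_group_marked)
  show "restrict_rows V \<in> hom (row_group W) (row_group V)"
  proof (rule homI)
    fix f assume "f \<in> carrier (row_group W)"
    then show "restrict_rows V f \<in> carrier (row_group V)"
      unfolding row_group_carrier using restrict_gen_word[OF assms(1)] by blast
  next
    fix f g assume "f \<in> carrier (row_group W)" "g \<in> carrier (row_group W)"
    then obtain u v where uv: "f = foldr (\<circ>) (map (gen W) u) id" "g = foldr (\<circ>) (map (gen W) v) id"
      unfolding row_group_carrier by blast
    have "f \<circ> g = foldr (\<circ>) (map (gen W) (u @ v)) id"
      unfolding uv map_append foldr_comp_append ..
    then have "restrict_rows V (f \<circ> g) = foldr (\<circ>) (map (gen V) (u @ v)) id"
      by (simp only: restrict_gen_word[OF assms(1)])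
    also have "\<dots> = restrict_rows V f \<circ> restrict_rows V g"
      unfolding uv restrict_gen_word[OF assms(1)] map_append foldr_comp_append ..
    finally show "restrict_rows V (f \<otimes>\<^bsub>row_group W\<^esub> g) = restrict_rows V f \<otimes>\<^bsub>row_group V\<^esub> restrict_rows V g"
      by (simp add: involution_group_def)
  qed
  have im: "restrict_rows V ` gens W = gens V"
    unfolding gens_def image_image using restrict_gen[OF assms(1)] by simp
  have "W \<noteq> {}" using assms by auto
  \<comment> \<open>Both generating sets have three elements, so the surjection between them is
    injective.\<close>
  then have "card (restrict_rows V ` gens W) = card (gens W)"
    unfolding im using assms(2) by (simp add: card_gens)
  then have "inj_on (restrict_rows V) (gens W)"
    by (intro eq_card_imp_inj_on) (auto simp: gens_def)
  then show "bij_betw (restrict_rows V) (gens W) (gens V)" using im by (simp add: bij_betw_def)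
qed

text \<open>The commutator of the transposition with its translate by \<open>k\<close>; in row \<open>i\<close> the two transpositions
  are disjoint unless \<open>k = i + 2\<close>.\<close>

definition commutator_word :: "nat \<Rightarrow> nat list" where
  "commutator_word k = (let u = concat (replicate k [0, 1]) @ [2] @ concat (replicate k [1, 0]) in [2] @ u @ [2] @ u)"

lemma row_translations:
  "row_word i (concat (replicate k [0, 1])) n = n - int k"
  "row_word i (concat (replicate k [1, 0])) n = n + int k"
proof -
  show "row_word i (concat (replicate k [0, 1])) n = n - int k"
    by (induction k arbitrary: n) (auto simp: row_def)
  show "row_word i (concat (replicate k [1, 0])) n = n + int k"
    by (induction k arbitrary: n) (auto simp: row_def)
qed

lemma row_commutator:
  "row_word i (commutator_word k) n = row 2 i (row 2 i (row 2 i (row 2 i (n + int k) - int k) + int k) - int k)"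
  by (simp only: commutator_word_def Let_def row_word_append row_word_simps row_translations)

text \<open>The translated transposition exchanges \<open>- k\<close> and \<open>i + 2 - k\<close>.
  For \<open>k > 0\<close> these points avoid \<open>0\<close> and \<open>i + 2\<close> unless
  \<open>k = i + 2\<close>, and disjoint transpositions commute.\<close>

lemma row_commutator_trivial: assumes "k > 0" "k \<noteq> i + 2" shows "row_word i (commutator_word k) n = n"
proof -
  have k: "int k > 0" "int k \<noteq> int i + 2" using assms by auto
  consider "n = - int k" | "n = int i + 2 - int k" | "n = 0" | "n = int i + 2"
    | "n \<noteq> - int k" "n \<noteq> int i + 2 - int k" "n \<noteq> 0" "n \<noteq> int i + 2" by blast
  then show ?thesis
    by cases (use k in \<open>simp_all add: row_commutator row_def\<close>)
qed

text \<open>The two transpositions share exactly the point \<open>0\<close>, so their commutator is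
  a 3-cycle moving it.\<close>

lemma row_commutator_nontrivial: "row_word i (commutator_word (i + 2)) 0 \<noteq> 0"
  unfolding row_commutator by (auto simp: row_def)

lemma set_commutator_word: "set (commutator_word k) \<subseteq> {..<3}"
  by (auto simp: commutator_word_def Let_def)

text \<open>Parity is what \<open>spectral_radius_strict\<close> asks for: it works with words of
  even length, where moments are nonnegative.\<close>

lemma even_length_commutator_word: "even (length (commutator_word k))"
  by (simp add: commutator_word_def Let_def length_concat sum_list_replicate)

text \<open>The commutator for \<open>k = j + 2\<close> acts in row \<open>j\<close> alone, so
  forgetting that row kills it.\<close>

lemma row_group_kernel_word:
  assumes "V \<subseteq> W" "j \<in> W" "j \<notin> V"
  obtains w n where "w \<in> words (gens W) (2 * n)" "wprod (row_group W) w \<noteq> \<one>\<^bsub>row_group W\<^esub>"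
    "restrict_rows V (wprod (row_group W) w) = \<one>\<^bsub>row_group V\<^esub>"
proof -
  let ?c = "commutator_word (j + 2)"
  let ?w = "map (gen W) ?c"
  obtain n where n: "length ?c = 2 * n" using even_length_commutator_word by blast
  have "set ?w \<subseteq> gens W" unfolding gens_def set_map by (intro image_mono set_commutator_word)
  then have 1: "?w \<in> words (gens W) (2 * n)" using n by (simp add: words_def)
  have "foldr (\<circ>) ?w id \<noteq> id"
    unfolding gen_word_eq_id using row_commutator_nontrivial[of j] assms(2) by blast
  then have 2: "wprod (row_group W) ?w \<noteq> \<one>\<^bsub>row_group W\<^esub>"
    unfolding wprod_involution_group by (simp add: involution_group_def)
  have "foldr (\<circ>) (map (gen V) ?c) id = id"
    unfolding gen_word_eq_id
  proof (intro ballI allI)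
    fix i n assume "i \<in> V"
    then have "i \<noteq> j" using assms(3) by auto
    then show "row_word i ?c n = n" by (intro row_commutator_trivial) auto
  qed
  then have 3: "restrict_rows V (wprod (row_group W) ?w) = \<one>\<^bsub>row_group V\<^esub>"
    unfolding wprod_involution_group restrict_gen_word[OF assms(1)] by (simp add: involution_group_def)
  show thesis by (rule that[OF 1 2 3])
qed

lemma countable_row_group: "countable (carrier (row_group W))"
proof -
  have "carrier (row_group W) \<subseteq> range (\<lambda>w. foldr (\<circ>) (map (gen W) w) id)"
    using row_group_carrier by blast
  then show ?thesis by (rule countable_subset) simp
qed

lemma countable_fp_lists: "countable (fp_lists (row_group W))"
  by (rule countable_subset[OF _ countable_lists[OF countable_row_group]])
     (auto simp: fp_lists_def)

text \<open>Numbering the reduced lists puts the groups for all \<open>W\<close> on the one type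
  \<open>nat\<close>.\<close>

definition code :: "nat set \<Rightarrow> (nat \<times> int \<Rightarrow> nat \<times> int) list \<Rightarrow> nat" where
  "code W = to_nat_on (fp_lists (row_group W))"

definition coded_group :: "nat set \<Rightarrow> nat monoid" where
  "coded_group W = transport (code W) (free_product (row_group W))"

lemma coded_group_marked: "fp_marked (row_group W) (gens W) (coded_group W) (code W)"
proof -
  interpret involution_marked "row_group W" "gens W" by (rule row_group_marked)
  have inj: "inj_on (code W) (carrier (free_product (row_group W)))"
    unfolding FP_simps code_def by (rule inj_on_to_nat_on[OF countable_fp_lists])
  show ?thesis
    by (intro fp_marked.intro fp_marked_axioms.intro row_group_marked)
       (simp_all add: coded_group_def group_transport group_free_product inj transport_iso)
qed

abbreviation coded_gens :: "nat set \<Rightarrow> nat set" where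
  "coded_gens W \<equiv> code W ` fp_gens (row_group W) (gens W)"

lemma coded_group_regular:
  assumes "W \<noteq> {}"
  shows "group (coded_group W)" "symmetric_generating_set (coded_group W) (coded_gens W)"
    "regular_simple_graph 4 (carrier (coded_group W)) (cayley_edges (coded_group W) (coded_gens W))"
proof -
  interpret fp_marked "row_group W" "gens W" "coded_group W" "code W" by (rule coded_group_marked)
  show "group (coded_group W)" by (rule group_H)
  show "symmetric_generating_set (coded_group W) (coded_gens W)"
  proof (rule symmetric_generating_T)
    fix a assume "a \<in> carrier (row_group W)"
    then show "\<exists>w. set w \<subseteq> gens W \<and> a = wprod (row_group W) w"
      unfolding wprod_involution_group by (auto simp: involution_group_def)
  qed
  show "regular_simple_graph 4 (carrier (coded_group W)) (cayley_edges (coded_group W) (coded_gens W))"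
    using regular_T[OF one_notin_gens[OF assms]] by (simp add: card_gens[OF assms])
qed

text \<open>More rows lower the spectral radius and both thresholds and raise the entropy; that the
  values differ is the form common to all four.\<close>

lemma coded_group_strict:
  assumes "V \<subset> W" "V \<noteq> {}"
    and f: "f \<in> {spectral_radius, asymptotic_entropy, pc_site, pc_bond}"
  shows "f (coded_group V) (coded_gens V) \<noteq> f (coded_group W) (coded_gens W)"
proof -
  have W: "W \<noteq> {}" "V \<subseteq> W" using assms by auto
  obtain j where j: "j \<in> W" "j \<notin> V" using assms by auto
  interpret C: involution_covering "row_group W" "gens W" "row_group V" "gens V" "restrict_rows V"
    by (rule row_group_covering[OF W(2) assms(2)])
  interpret A: fp_marked "row_group W" "gens W" "coded_group W" "code W" by (rule coded_group_marked)
  interpret A': fp_marked "row_group V" "gens V" "coded_group V" "code V" by (rule coded_group_marked)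
  obtain w n where w: "w \<in> words (gens W) (2 * n)" "wprod (row_group W) w \<noteq> \<one>\<^bsub>row_group W\<^esub>"
    "restrict_rows V (wprod (row_group W) w) = \<one>\<^bsub>row_group V\<^esub>"
    by (rule row_group_kernel_word[OF W(2) j])
  note S3 = card_gens[OF W(1)]
  have inj: "inj_on (code W) (carrier (free_product (row_group W)))"
    using A.inj_phi by (simp add: C.G.FP_simps(1))
  have inj': "inj_on (code V) (carrier (free_product (row_group V)))"
    using A'.inj_phi by (simp add: C.G'.FP_simps(1))
  have pc: "pc b (coded_group W) (coded_gens W) < pc b (coded_group V) (coded_gens V)" for b
  proof (rule pc_strict)
    show "involution_covering (row_group W) (gens W) (row_group V) (gens V) (restrict_rows V)"
      by (rule row_group_covering[OF W(2) assms(2)])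
    show "w \<in> words (gens W) (2 * n)" by (rule w)
    show "s \<otimes>\<^bsub>row_group V\<^esub> t \<notin> insert \<one>\<^bsub>row_group V\<^esub> (gens V)" if "s \<in> gens V" "t \<in> gens V" "s \<noteq> t" for s t
      using that by (rule gens_pairs_notin[OF assms(2)])
  qed (use w S3 in \<open>simp_all add: coded_group_marked one_notin_gens gens_pairs_inj assms(2)\<close>)
  from f consider "f = spectral_radius" | "f = asymptotic_entropy" | "f = pc_site" | "f = pc_bond" by auto
  then show ?thesis
  proof cases
    case 1
    show ?thesis unfolding 1 A.cov.spectral_radius_iso[OF inj] A'.cov.spectral_radius_iso[OF inj']
      using C.free_product_strict(1)[OF S3 w] by simp
  next
    case 2
    show ?thesis unfolding 2 A.cov.asymptotic_entropy_iso[OF inj] A'.cov.asymptotic_entropy_iso[OF inj']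
      using C.free_product_strict(2)[OF S3 w] by simp
  next
    case 3
    show ?thesis unfolding 3 using pc[of False] by (simp add: pc_simps)
  next
    case 4
    show ?thesis unfolding 4 using pc[of True] by (simp add: pc_simps)
  qed
qed

text \<open>\<open>from_nat\<close> decodes naturals as rationals. The subsets of a countable set
  thus contain a chain ordered like the real line.\<close>

definition cut :: "real \<Rightarrow> nat set" where
  "cut r = {n. real_of_rat (from_nat n) < r}"

lemma cut_nonempty: "cut r \<noteq> {}"
proof -
  obtain q where "real_of_rat q < r" using of_rat_dense[of "r - 1" r] by auto
  then have "to_nat q \<in> cut r" by (simp add: cut_def)
  then show ?thesis by auto
qed

lemma cut_strict: assumes "r < r'" shows "cut r \<subset> cut r'"
proof -
  obtain q where "r < real_of_rat q" "real_of_rat q < r'" using of_rat_dense[OF assms] by auto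
  then have "to_nat q \<in> cut r'" "to_nat q \<notin> cut r" by (simp_all add: cut_def)
  moreover have "cut r \<subseteq> cut r'" using assms by (auto simp: cut_def)
  ultimately show ?thesis by auto
qed

theorem theorem1p1:
  fixes f :: "nat monoid \<Rightarrow> nat set \<Rightarrow> real"
  assumes "f \<in> {spectral_radius, asymptotic_entropy, pc_site, pc_bond}"
  shows "\<exists>(\<Omega> :: real set) (G :: real \<Rightarrow> nat monoid) (S :: real \<Rightarrow> nat set).
           (\<forall>\<omega>\<in>\<Omega>. group (G \<omega>) \<and> symmetric_generating_set (G \<omega>) (S \<omega>) \<and>
              regular_simple_graph 4 (carrier (G \<omega>)) (cayley_edges (G \<omega>) (S \<omega>))) \<and>
           (\<lambda>\<omega>. f (G \<omega>) (S \<omega>)) ` \<Omega> \<approx> (UNIV :: real set)"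
proof (intro exI conjI ballI)
  let ?G = "\<lambda>\<omega>. coded_group (cut \<omega>)" and ?S = "\<lambda>\<omega>. coded_gens (cut \<omega>)"
  fix \<omega> :: real
  show "group (?G \<omega>)" "symmetric_generating_set (?G \<omega>) (?S \<omega>)"
    "regular_simple_graph 4 (carrier (?G \<omega>)) (cayley_edges (?G \<omega>) (?S \<omega>))"
    by (rule coded_group_regular[OF cut_nonempty])+
next
  let ?G = "\<lambda>\<omega>. coded_group (cut \<omega>)" and ?S = "\<lambda>\<omega>. coded_gens (cut \<omega>)"
  have "f (?G r) (?S r) \<noteq> f (?G r') (?S r')" if "r < r'" for r r' :: real
    by (rule coded_group_strict[OF cut_strict[OF that] cut_nonempty assms])
  then have "inj_on (\<lambda>\<omega>. f (?G \<omega>) (?S \<omega>)) UNIV"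
    by (intro inj_onI) (metis linorder_neqE_linordered_idom)
  then show "(\<lambda>\<omega>. f (?G \<omega>) (?S \<omega>)) ` UNIV \<approx> (UNIV :: real set)"
    by (rule inj_on_image_eqpoll_self)
qed

end
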